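(* Let $G$ be a finite-dimensional Lie group with Lie algebra $\mathfrak{g}$, equipped with a left-invariant Riemannian metric $\langle\cdot,\cdot\rangle$. Let $u_0\in\mathfrak{g}$ and let $\gamma(t)$ be the geodesic in $G$ with $\gamma(0)=\mathrm{id}$ and $\gamma'(0)=u_0$. (i) If $u_0$ is not orthogonal to $[\mathfrak{g},\mathfrak{g}]$ and $\mathrm{Ad}_{\gamma(t)}$ is uniformly bounded below as an operator on $\mathfrak{g}$, then there is a conjugate point along $\gamma$. (ii) Conversely, if $u_0$ is orthogonal to $[\mathfrak{g},\mathfrak{g}]$, then there is no conjugate point along $\gamma$.
   Context: $[\mathfrak{g},\mathfrak{g}]$ is the span of all brackets $[p,q]$, $p,q\in\mathfrak{g}$; orthogonality is with respect to the inner product $\langle\cdot,\cdot\rangle$ on $\mathfrak{g}$ that defines the left-invariant metric. "$\mathrm{Ad}_{\gamma(t)}$ is uniformly bounded below" means there is a constant $c>0$ such that $|\mathrm{Ad}_{\gamma(t)}w|\ge c|w|$ for all $t\in\mathbb{R}$ and all $w\in\mathfrak{g}$ (norm of $\langle\cdot,\cdot\rangle$). "There is a conjugate point along $\gamma$" means that for some $\tau>0$ there is a nontrivial Jacobi field along $\gamma$ vanishing at $t=0$ and $t=\tau$. *)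

theory Defs
  imports "HOL-Analysis.Analysis" "HOL-Library.Function_Algebras"
begin

section \<open>Real vector space structure on functions\<close>

instantiation "fun" :: (type, real_vector) real_vector
begin

definition scaleR_fun :: "real \<Rightarrow> ('a \<Rightarrow> 'b) \<Rightarrow> 'a \<Rightarrow> 'b" where
  "scaleR_fun r f = (\<lambda>x. r *\<^sub>R f x)"

instance
  by standard (simp_all add: scaleR_fun_def fun_eq_iff scaleR_right_distrib scaleR_left_distrib)

end

section \<open>Smooth manifolds\<close>

text \<open>Only used for open \<open>S\<close>, so the derivative at a point is the two-sided one.\<close>

primrec Ck_on :: "nat \<Rightarrow> 'a::euclidean_space set \<Rightarrow> ('a \<Rightarrow> 'b::real_normed_vector) \<Rightarrow> bool" where
  "Ck_on 0 S f \<longleftrightarrow> continuous_on S f"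
| "Ck_on (Suc k) S f \<longleftrightarrow>
     (\<forall>x\<in>S. f differentiable (at x)) \<and>
     (\<forall>v. Ck_on k S (\<lambda>x. frechet_derivative f (at x) v))"

definition smooth_on :: "'a::euclidean_space set \<Rightarrow> ('a \<Rightarrow> 'b::real_normed_vector) \<Rightarrow> bool" where
  "smooth_on S f \<longleftrightarrow> (\<forall>k. Ck_on k S f)"

text \<open>A chart is a pair \<open>(U, \<phi>)\<close>; the values of \<open>\<phi>\<close> outside \<open>U\<close> are irrelevant.\<close>

type_synonym ('m, 'e) chart = "'m set \<times> ('m \<Rightarrow> 'e)"

definition chart_inv :: "('m, 'e) chart \<Rightarrow> 'e \<Rightarrow> 'm" where
  "chart_inv c = inv_into (fst c) (snd c)"

definition charts_at :: "('m, 'e) chart set \<Rightarrow> 'm \<Rightarrow> ('m, 'e) chart set" where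
  "charts_at A p = {c \<in> A. p \<in> fst c}"

definition smooth_atlas ::
  "('m::topological_space, 'e::euclidean_space) chart set \<Rightarrow> bool" where
  "smooth_atlas A \<longleftrightarrow>
     (\<forall>c\<in>A. open (fst c) \<and> open (snd c ` fst c) \<and>
        homeomorphism (fst c) (snd c ` fst c) (snd c) (chart_inv c)) \<and>
     (\<forall>p. charts_at A p \<noteq> {}) \<and>
     (\<forall>c\<in>A. \<forall>d\<in>A. smooth_on (snd c ` (fst c \<inter> fst d)) (snd d \<circ> chart_inv c))"

definition smooth_map ::
  "('m::topological_space, 'e::euclidean_space) chart set \<Rightarrow>
   ('n::topological_space, 'f::euclidean_space) chart set \<Rightarrow> ('m \<Rightarrow> 'n) \<Rightarrow> bool" where
  "smooth_map A B f \<longleftrightarrow> continuous_on UNIV f \<and>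
     (\<forall>c\<in>A. \<forall>d\<in>B. smooth_on (snd c ` (fst c \<inter> f -` fst d)) (snd d \<circ> f \<circ> chart_inv c))"

definition euclidean_atlas :: "('a, 'a) chart set" where
  "euclidean_atlas = {(UNIV, \<lambda>x. x)}"

definition product_atlas ::
  "('m, 'e) chart set \<Rightarrow> ('n, 'f) chart set \<Rightarrow> ('m \<times> 'n, 'e \<times> 'f) chart set" where
  "product_atlas A B = {(fst c \<times> fst d, map_prod (snd c) (snd d)) | c d. c \<in> A \<and> d \<in> B}"

section \<open>Tangent vectors and vector fields\<close>

text \<open>A tangent vector at \<open>p\<close> is the family of its coordinate vectors in all charts around
  \<open>p\<close>, transforming by the differentials of the coordinate changes.  Components at charts
  not containing \<open>p\<close> are set to \<open>0\<close>, so that equality and the pointwise vector space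
  operations are the correct ones.\<close>

type_synonym ('m, 'e) tvec = "('m, 'e) chart \<Rightarrow> 'e"

definition tangent_space ::
  "('m, 'e::euclidean_space) chart set \<Rightarrow> 'm \<Rightarrow> ('m, 'e) tvec set" where
  "tangent_space A p = {v.
     (\<forall>c\<in>charts_at A p. \<forall>d\<in>charts_at A p.
        v d = frechet_derivative (snd d \<circ> chart_inv c) (at (snd c p)) (v c)) \<and>
     (\<forall>c. c \<notin> charts_at A p \<longrightarrow> v c = 0)}"

text \<open>The tangent vector at \<open>p\<close> with coordinates \<open>a\<close> in the chart \<open>c\<close>.\<close>

definition coord_vec ::
  "('m, 'e::euclidean_space) chart set \<Rightarrow> ('m, 'e) chart \<Rightarrow> 'm \<Rightarrow> 'e \<Rightarrow> ('m, 'e) tvec" where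
  "coord_vec A c p a = (\<lambda>d. if d \<in> charts_at A p
     then frechet_derivative (snd d \<circ> chart_inv c) (at (snd c p)) a else 0)"

text \<open>The differential of \<open>f\<close> at \<open>p\<close>; for smooth \<open>f\<close> it does not depend on the chosen
  chart \<open>c\<close> around \<open>p\<close>.\<close>

definition tangent_map ::
  "('m, 'e::euclidean_space) chart set \<Rightarrow> ('n, 'f::euclidean_space) chart set \<Rightarrow>
   ('m \<Rightarrow> 'n) \<Rightarrow> 'm \<Rightarrow> ('m, 'e) tvec \<Rightarrow> ('n, 'f) tvec" where
  "tangent_map A B f p v = (\<lambda>d. if d \<in> charts_at B (f p)
     then (let c = (SOME c. c \<in> charts_at A p)
           in frechet_derivative (snd d \<circ> f \<circ> chart_inv c) (at (snd c p)) (v c))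
     else 0)"

text \<open>\<open>[X, Y] = DY(X) - DX(Y)\<close> in coordinates.\<close>

definition field_bracket ::
  "('m, 'e::euclidean_space) chart set \<Rightarrow> ('m \<Rightarrow> ('m, 'e) tvec) \<Rightarrow> ('m \<Rightarrow> ('m, 'e) tvec) \<Rightarrow>
   'm \<Rightarrow> ('m, 'e) tvec" where
  "field_bracket A X Y p = (\<lambda>c. if c \<in> charts_at A p
     then frechet_derivative (\<lambda>x. Y (chart_inv c x) c) (at (snd c p)) (X p c)
        - frechet_derivative (\<lambda>x. X (chart_inv c x) c) (at (snd c p)) (Y p c)
     else 0)"

section \<open>Riemannian metrics, geodesics, Jacobi fields\<close>

type_synonym ('m, 'e) metric = "'m \<Rightarrow> ('m, 'e) tvec \<Rightarrow> ('m, 'e) tvec \<Rightarrow> real"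

definition inner_product_on :: "'v::real_vector set \<Rightarrow> ('v \<Rightarrow> 'v \<Rightarrow> real) \<Rightarrow> bool" where
  "inner_product_on V B \<longleftrightarrow>
     (\<forall>u\<in>V. \<forall>v\<in>V. B u v = B v u) \<and>
     (\<forall>u\<in>V. \<forall>v\<in>V. \<forall>w\<in>V. B (u + v) w = B u w + B v w) \<and>
     (\<forall>r. \<forall>u\<in>V. \<forall>w\<in>V. B (r *\<^sub>R u) w = r * B u w) \<and>
     (\<forall>u\<in>V. u \<noteq> 0 \<longrightarrow> 0 < B u u)"

definition metric_coeff ::
  "('m, 'e::euclidean_space) chart set \<Rightarrow> ('m, 'e) metric \<Rightarrow> ('m, 'e) chart \<Rightarrow>
   'e \<Rightarrow> 'e \<Rightarrow> 'e \<Rightarrow> real" where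
  "metric_coeff A h c x a b =
     h (chart_inv c x) (coord_vec A c (chart_inv c x) a) (coord_vec A c (chart_inv c x) b)"

definition riemannian_metric ::
  "('m, 'e::euclidean_space) chart set \<Rightarrow> ('m, 'e) metric \<Rightarrow> bool" where
  "riemannian_metric A h \<longleftrightarrow>
     (\<forall>p. inner_product_on (tangent_space A p) (h p)) \<and>
     (\<forall>c\<in>A. \<forall>a b. smooth_on (snd c ` fst c) (\<lambda>x. metric_coeff A h c x a b))"

text \<open>\<open>christoffel A h c x a b\<close> is the vector \<open>\<Gamma>\<^bsub>ij\<^esub>\<^sup>k a\<^sup>i b\<^sup>j\<close>, with
  \<open>2 g\<^bsub>kl\<^esub> \<Gamma>\<^bsub>ij\<^esub>\<^sup>k = \<partial>\<^sub>i g\<^bsub>jl\<^esub> + \<partial>\<^sub>j g\<^bsub>il\<^esub> - \<partial>\<^sub>l g\<^bsub>ij\<^esub>\<close> (Levi-Civita connection).\<close>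

definition christoffel ::
  "('m, 'e::euclidean_space) chart set \<Rightarrow> ('m, 'e) metric \<Rightarrow> ('m, 'e) chart \<Rightarrow>
   'e \<Rightarrow> 'e \<Rightarrow> 'e \<Rightarrow> 'e" where
  "christoffel A h c x a b = (THE z. \<forall>w.
     2 * metric_coeff A h c x z w =
       frechet_derivative (\<lambda>y. metric_coeff A h c y b w) (at x) a
     + frechet_derivative (\<lambda>y. metric_coeff A h c y a w) (at x) b
     - frechet_derivative (\<lambda>y. metric_coeff A h c y a b) (at x) w)"

text \<open>Sign convention: \<open>R(u,v)w = \<nabla>\<^sub>u\<nabla>\<^sub>v w - \<nabla>\<^sub>v\<nabla>\<^sub>u w - \<nabla>\<^bsub>[u,v]\<^esub> w\<close>.\<close>

definition curvature ::
  "('m, 'e::euclidean_space) chart set \<Rightarrow> ('m, 'e) metric \<Rightarrow> 'm \<Rightarrow>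
   ('m, 'e) tvec \<Rightarrow> ('m, 'e) tvec \<Rightarrow> ('m, 'e) tvec \<Rightarrow> ('m, 'e) tvec" where
  "curvature A h p u v w = (\<lambda>c. if c \<in> charts_at A p then
     (let x = snd c p; \<Gamma> = christoffel A h c in
        frechet_derivative (\<lambda>y. \<Gamma> y (v c) (w c)) (at x) (u c)
      - frechet_derivative (\<lambda>y. \<Gamma> y (u c) (w c)) (at x) (v c)
      + \<Gamma> x (u c) (\<Gamma> x (v c) (w c))
      - \<Gamma> x (v c) (\<Gamma> x (u c) (w c)))
     else 0)"

definition velocity ::
  "('m, 'e::euclidean_space) chart set \<Rightarrow> (real \<Rightarrow> 'm) \<Rightarrow> real \<Rightarrow> ('m, 'e) tvec" where
  "velocity A \<gamma> t = (\<lambda>c. if c \<in> charts_at A (\<gamma> t)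
     then vector_derivative (\<lambda>s. snd c (\<gamma> s)) (at t) else 0)"

definition smooth_field_along ::
  "('m, 'e::euclidean_space) chart set \<Rightarrow> (real \<Rightarrow> 'm) \<Rightarrow> (real \<Rightarrow> ('m, 'e) tvec) \<Rightarrow> bool" where
  "smooth_field_along A \<gamma> V \<longleftrightarrow>
     (\<forall>t. V t \<in> tangent_space A (\<gamma> t)) \<and>
     (\<forall>c\<in>A. smooth_on (\<gamma> -` fst c) (\<lambda>t. V t c))"

definition covariant_derivative ::
  "('m, 'e::euclidean_space) chart set \<Rightarrow> ('m, 'e) metric \<Rightarrow> (real \<Rightarrow> 'm) \<Rightarrow>
   (real \<Rightarrow> ('m, 'e) tvec) \<Rightarrow> real \<Rightarrow> ('m, 'e) tvec" where
  "covariant_derivative A h \<gamma> V t = (\<lambda>c. if c \<in> charts_at A (\<gamma> t)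
     then vector_derivative (\<lambda>s. V s c) (at t)
        + christoffel A h c (snd c (\<gamma> t)) (velocity A \<gamma> t c) (V t c)
     else 0)"

definition geodesic ::
  "('m::topological_space, 'e::euclidean_space) chart set \<Rightarrow> ('m, 'e) metric \<Rightarrow>
   (real \<Rightarrow> 'm) \<Rightarrow> bool" where
  "geodesic A h \<gamma> \<longleftrightarrow> smooth_map euclidean_atlas A \<gamma> \<and>
     (\<forall>t. covariant_derivative A h \<gamma> (velocity A \<gamma>) t = 0)"

definition jacobi_field ::
  "('m, 'e::euclidean_space) chart set \<Rightarrow> ('m, 'e) metric \<Rightarrow> (real \<Rightarrow> 'm) \<Rightarrow>
   (real \<Rightarrow> ('m, 'e) tvec) \<Rightarrow> bool" where
  "jacobi_field A h \<gamma> J \<longleftrightarrow> smooth_field_along A \<gamma> J \<and>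
     (\<forall>t. covariant_derivative A h \<gamma> (covariant_derivative A h \<gamma> J) t
        + curvature A h (\<gamma> t) (J t) (velocity A \<gamma> t) (velocity A \<gamma> t) = 0)"

definition has_conjugate_point ::
  "('m, 'e::euclidean_space) chart set \<Rightarrow> ('m, 'e) metric \<Rightarrow> (real \<Rightarrow> 'm) \<Rightarrow> bool" where
  "has_conjugate_point A h \<gamma> \<longleftrightarrow>
     (\<exists>\<tau>>0. \<exists>J. jacobi_field A h \<gamma> J \<and> (\<exists>t. J t \<noteq> 0) \<and> J 0 = 0 \<and> J \<tau> = 0)"

section \<open>Lie groups\<close>

definition lie_group ::
  "('g::{t2_space, second_countable_topology}, 'e::euclidean_space) chart set \<Rightarrow>
   ('g \<Rightarrow> 'g \<Rightarrow> 'g) \<Rightarrow> 'g \<Rightarrow> ('g \<Rightarrow> 'g) \<Rightarrow> bool" where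
  "lie_group A mul e iv \<longleftrightarrow> smooth_atlas A \<and> group mul e iv \<and>
     smooth_map (product_atlas A A) A (\<lambda>(x, y). mul x y) \<and> smooth_map A A iv"

definition left_invariant_field ::
  "('g, 'e::euclidean_space) chart set \<Rightarrow> ('g \<Rightarrow> 'g \<Rightarrow> 'g) \<Rightarrow> 'g \<Rightarrow>
   ('g, 'e) tvec \<Rightarrow> 'g \<Rightarrow> ('g, 'e) tvec" where
  "left_invariant_field A mul e u p = tangent_map A A (mul p) e u"

text \<open>The Lie algebra is \<open>tangent_space A e\<close>, with the bracket of left-invariant fields.\<close>

definition lie_bracket ::
  "('g, 'e::euclidean_space) chart set \<Rightarrow> ('g \<Rightarrow> 'g \<Rightarrow> 'g) \<Rightarrow> 'g \<Rightarrow>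
   ('g, 'e) tvec \<Rightarrow> ('g, 'e) tvec \<Rightarrow> ('g, 'e) tvec" where
  "lie_bracket A mul e u v =
     field_bracket A (left_invariant_field A mul e u) (left_invariant_field A mul e v) e"

definition derived_algebra ::
  "('g, 'e::euclidean_space) chart set \<Rightarrow> ('g \<Rightarrow> 'g \<Rightarrow> 'g) \<Rightarrow> 'g \<Rightarrow> ('g, 'e) tvec set" where
  "derived_algebra A mul e =
     span {lie_bracket A mul e p q | p q. p \<in> tangent_space A e \<and> q \<in> tangent_space A e}"

definition Ad ::
  "('g, 'e::euclidean_space) chart set \<Rightarrow> ('g \<Rightarrow> 'g \<Rightarrow> 'g) \<Rightarrow> 'g \<Rightarrow> ('g \<Rightarrow> 'g) \<Rightarrow> 'g \<Rightarrow>
   ('g, 'e) tvec \<Rightarrow> ('g, 'e) tvec" where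
  "Ad A mul e iv g = tangent_map A A (\<lambda>x. mul (mul g x) (iv g)) e"

definition left_invariant_metric ::
  "('g, 'e::euclidean_space) chart set \<Rightarrow> ('g \<Rightarrow> 'g \<Rightarrow> 'g) \<Rightarrow> ('g, 'e) metric \<Rightarrow> bool" where
  "left_invariant_metric A mul h \<longleftrightarrow> riemannian_metric A h \<and>
     (\<forall>p q. \<forall>v\<in>tangent_space A q. \<forall>w\<in>tangent_space A q.
        h (mul p q) (tangent_map A A (mul p) q v) (tangent_map A A (mul p) q w) = h q v w)"

definition metric_norm :: "('m, 'e) metric \<Rightarrow> 'm \<Rightarrow> ('m, 'e) tvec \<Rightarrow> real" where
  "metric_norm h p v = sqrt (h p v v)"

definition orthogonal_to :: "('m, 'e) metric \<Rightarrow> 'm \<Rightarrow> ('m, 'e) tvec \<Rightarrow> ('m, 'e) tvec set \<Rightarrow> bool" where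
  "orthogonal_to h p v W \<longleftrightarrow> (\<forall>w\<in>W. h p v w = 0)"

definition Ad_bounded_below_along ::
  "('g, 'e::euclidean_space) chart set \<Rightarrow> ('g \<Rightarrow> 'g \<Rightarrow> 'g) \<Rightarrow> 'g \<Rightarrow> ('g \<Rightarrow> 'g) \<Rightarrow>
   ('g, 'e) metric \<Rightarrow> (real \<Rightarrow> 'g) \<Rightarrow> bool" where
  "Ad_bounded_below_along A mul e iv h \<gamma> \<longleftrightarrow>
     (\<exists>c>0. \<forall>t. \<forall>w\<in>tangent_space A e.
        metric_norm h e (Ad A mul e iv (\<gamma> t) w) \<ge> c * metric_norm h e w)"

end

theory Submission
  imports Defs
begin

text \<open>Right-invariant fields are Killing fields of a left-invariant metric.  Write a field along the
  geodesic \<open>\<gamma>\<close> as \<open>J(t) = dR\<^bsub>\<gamma>(t)\<^esub> w(t)\<close> with \<open>w\<close> a curve in the Lie algebra.  Pairing with the Killing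
  Jacobi fields \<open>dR\<^bsub>\<gamma>\<^esub> b\<close> shows that \<open>J\<close> is a Jacobi field iff \<open>\<Lambda>(t) w' + K w\<close> is constant, where
  \<open>\<Lambda>(t)(a, b) = \<langle>dR\<^bsub>\<gamma>(t)\<^esub> a, dR\<^bsub>\<gamma>(t)\<^esub> b\<rangle>\<close> and \<open>K(a, b) = - \<langle>u\<^sub>0, [a, b]\<rangle>\<close> is antisymmetric and independent of \<open>t\<close>.
  If \<open>u\<^sub>0 \<perp> [g, g]\<close>, then \<open>K = 0\<close>, so \<open>\<Lambda> w' = m\<close> is constant and \<open>\<langle>m, w\<rangle>\<close> is strictly monotone.
  Otherwise let \<open>W(t)\<close> be the solution operator with \<open>\<Lambda> W' + K W = 1\<close>, \<open>W(0) = 0\<close>.  If \<open>W\<close> were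
  invertible for all \<open>t > 0\<close>, then \<open>s = tr W\<^sup>-\<^sup>1\<close> would satisfy \<open>s' \<le> - (\<alpha> s\<^sup>2 + \<beta>)\<close> with
  \<open>\<alpha>, \<beta> > 0\<close>, because the lower bound on \<open>Ad\<^bsub>\<gamma>(t)\<^esub>\<close> bounds \<open>\<Lambda>\<close> from above; this is impossible on an
  infinite interval.\<close>

section \<open>Calculus of smooth maps\<close>

text \<open>Right-invariant fields are the frame of choice because Killing fields are Jacobi fields:
  the undifferentiated \<open>w\<close> drops out of the Jacobi equation, which can then be
  integrated once. The constant of integration is a momentum vector \<open>a\<close>;
  \<open>W(t) a\<close> runs through the solutions that vanish at time 0, so a conjugate point is a
  time at which \<open>W\<close> is singular. The antisymmetric \<open>K\<close> makes
  \<open>V\<close>, the inverse of \<open>W\<close>, non-symmetric, and this drives the blow-up. The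
  adjoint of \<open>V\<close> is \<open>r = V - K\<close>, and \<open>V' = - V M r\<close> with
  \<open>M\<close> the inverse of \<Lambda>, so \<open>s'\<close> is minus the sum of the
  \<open>M (r i) \<bullet> r i\<close>. The trace of \<open>r\<close> is \<open>s\<close>, which
  gives the quadratic term; the antisymmetric part of \<open>r\<close> is \<open>- K / 2\<close>,
  which gives the constant term. With \<open>K = 0\<close> only the quadratic term would remain, and
  \<open>s\<close> could decay like \<open>1 / t\<close> for ever. Tangent vectors are families of
  coordinate vectors, so geometric identities are checked in one chart at a time, while the linear
  system lives on the whole time line.\<close>

abbreviation fd :: "('a::real_normed_vector \<Rightarrow> 'b::real_normed_vector) \<Rightarrow> 'a \<Rightarrow> 'a \<Rightarrow> 'b" where
  "fd f x \<equiv> frechet_derivative f (at x)"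

lemma fd_eqI: "(f has_derivative f') (at x) \<Longrightarrow> fd f x = f'"
  using frechet_derivative_at by metis

lemma fd_cong:
  assumes "open T" "x \<in> T" "\<And>y. y \<in> T \<Longrightarrow> f y = g y"
  shows "fd f x = fd g x"
proof -
  have "(f has_derivative D) (at x) \<longleftrightarrow> (g has_derivative D) (at x)" for D
    using has_derivative_transform_within_open[OF _ assms(1,2)] assms(3) by metis
  then show ?thesis by (simp add: frechet_derivative_def)
qed

lemma differentiable_cong:
  assumes "open T" "x \<in> T" "\<And>y. y \<in> T \<Longrightarrow> f y = g y" "f differentiable (at x)"
  shows "g differentiable (at x)"
proof -
  obtain D where "(f has_derivative D) (at x)" using assms(4) by (auto simp: differentiable_def)
  from has_derivative_transform_within_open[OF this assms(1,2)] assms(3)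
  show ?thesis by (auto simp: differentiable_def)
qed

lemma fd_linear: "f differentiable (at x) \<Longrightarrow> linear (fd f x)"
  by (rule linear_frechet_derivative)

lemma fd_has_derivative: "f differentiable (at x) \<Longrightarrow> (f has_derivative fd f x) (at x)"
  using frechet_derivative_works by blast

lemma Ck_on_cong:
  assumes "open S" "\<And>x. x \<in> S \<Longrightarrow> f x = g x" "Ck_on k S f"
  shows "Ck_on k S g"
  using assms(2,3)
proof (induction k arbitrary: f g)
  case 0
  then show ?case by (simp cong: continuous_on_cong)
next
  case (Suc k)
  have d: "fd f x = fd g x" if "x \<in> S" for x
    using fd_cong[OF assms(1) that] Suc.prems(1) by blast
  have "Ck_on k S (\<lambda>x. fd g x v)" for v
    by (rule Suc.IH[of "\<lambda>x. fd f x v"]) (use d Suc.prems in auto)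
  moreover have "g differentiable (at x)" if "x \<in> S" for x
    using differentiable_cong[OF assms(1) that] Suc.prems that by auto
  ultimately show ?case by simp
qed

lemma Ck_on_subset: "Ck_on k S f \<Longrightarrow> T \<subseteq> S \<Longrightarrow> Ck_on k T f"
proof (induction k arbitrary: f)
  case 0
  then show ?case using continuous_on_subset by auto
next
  case (Suc k)
  then show ?case by (simp add: subset_iff)
qed

text \<open>Differentiability at a point is already local; only continuity, the base case, needs the
  neighbourhood. This glues the smoothness of curves from the charts that they pass through.\<close>

lemma Ck_on_local:
  assumes "\<And>x. x \<in> S \<Longrightarrow> \<exists>T. open T \<and> x \<in> T \<and> Ck_on k (T \<inter> S) f"
  shows "Ck_on k S f"
  using assms
proof (induction k arbitrary: f)
  case 0
  have "continuous (at x within S) f" if x: "x \<in> S" for x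
  proof -
    obtain T where T: "open T" "x \<in> T" "continuous_on (T \<inter> S) f" using 0[OF x] by auto
    have "continuous (at x within (S \<inter> T)) f"
      using T x by (simp add: continuous_on_eq_continuous_within Int_commute)
    moreover have "at x within (S \<inter> T) = at x within S"
      by (rule at_within_nhd[of x T]) (use T in auto)
    ultimately show ?thesis by simp
  qed
  then show ?case by (simp add: continuous_on_eq_continuous_within)
next
  case (Suc k)
  have "Ck_on k S (\<lambda>x. fd f x v)" for v
  proof (rule Suc.IH)
    fix x assume "x \<in> S"
    then obtain T where T: "open T" "x \<in> T" "Ck_on (Suc k) (T \<inter> S) f" using Suc.prems by blast
    then show "\<exists>T. open T \<and> x \<in> T \<and> Ck_on k (T \<inter> S) (\<lambda>x. fd f x v)" by (intro exI[of _ T]) simp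
  qed
  moreover have "f differentiable (at x)" if x: "x \<in> S" for x
  proof -
    obtain T where "x \<in> T" "Ck_on (Suc k) (T \<inter> S) f" using Suc.prems[OF x] by blast
    then show ?thesis using x by simp
  qed
  ultimately show ?case by simp
qed

lemma Ck_on_SucD: "Ck_on (Suc k) S f \<Longrightarrow> Ck_on k S f"
proof (induction k arbitrary: f)
  case 0
  then show ?case
    by (auto intro!: continuous_at_imp_continuous_on differentiable_imp_continuous_within)
next
  case (Suc k)
  have "Ck_on k S (\<lambda>x. fd f x v)" for v
    by (rule Suc.IH) (use Suc.prems in simp)
  then show ?case using Suc.prems by simp
qed

lemma Ck_on_const: "Ck_on k S (\<lambda>x. c)"
proof (induction k arbitrary: c)
  case (Suc k)
  have "fd (\<lambda>x::'a. c) x v = 0" for x v by simp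
  then show ?case using Suc[of 0] by simp
qed simp

text \<open>The recursion of \<open>Ck_on\<close> speaks of \<open>frechet_derivative\<close>; by
  uniqueness any explicit derivative may be used, so the inductions below can follow the usual rules
  of calculus.\<close>

lemma Ck_on_SucI:
  assumes "open S" "\<And>x. x \<in> S \<Longrightarrow> (f has_derivative f' x) (at x)" "\<And>v. Ck_on k S (\<lambda>x. f' x v)"
  shows "Ck_on (Suc k) S f"
proof -
  have "Ck_on k S (\<lambda>x. fd f x v)" for v
    by (rule Ck_on_cong[OF assms(1) _ assms(3)[of v]]) (simp add: fd_eqI[OF assms(2)])
  then show ?thesis using assms(2) by (auto simp: differentiable_def)
qed

lemma Ck_on_SucE:
  assumes "Ck_on (Suc k) S f"
  shows "\<And>x. x \<in> S \<Longrightarrow> (f has_derivative fd f x) (at x)" "\<And>v. Ck_on k S (\<lambda>x. fd f x v)"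
  using assms fd_has_derivative by auto

lemma Ck_on_bounded_linear:
  assumes "bounded_linear L" "open S" "Ck_on k S f"
  shows "Ck_on k S (\<lambda>x. L (f x))"
  using assms(3)
proof (induction k arbitrary: f)
  case 0
  then show ?case using bounded_linear.continuous_on[OF assms(1)] by auto
next
  case (Suc k)
  show ?case
  proof (rule Ck_on_SucI[OF assms(2)])
    show "((\<lambda>x. L (f x)) has_derivative (\<lambda>v. L (fd f x v))) (at x)" if "x \<in> S" for x
      by (rule bounded_linear.has_derivative[OF assms(1) Ck_on_SucE(1)[OF Suc.prems that]])
    show "Ck_on k S (\<lambda>x. L (fd f x v))" for v
      by (rule Suc.IH[OF Ck_on_SucE(2)[OF Suc.prems]])
  qed
qed

lemma Ck_on_add:
  assumes "open S" "Ck_on k S f" "Ck_on k S g"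
  shows "Ck_on k S (\<lambda>x. f x + g x)"
  using assms(2,3)
proof (induction k arbitrary: f g)
  case 0
  then show ?case by (auto intro: continuous_on_add)
next
  case (Suc k)
  show ?case
  proof (rule Ck_on_SucI[OF assms(1)])
    show "((\<lambda>x. f x + g x) has_derivative (\<lambda>v. fd f x v + fd g x v)) (at x)" if "x \<in> S" for x
      by (rule has_derivative_add[OF Ck_on_SucE(1)[OF Suc.prems(1) that] Ck_on_SucE(1)[OF Suc.prems(2) that]])
    show "Ck_on k S (\<lambda>x. fd f x v + fd g x v)" for v
      by (intro Suc.IH Ck_on_SucE(2) Suc.prems)
  qed
qed

lemma Ck_on_sum:
  assumes "open S" "\<And>i. i \<in> I \<Longrightarrow> Ck_on k S (f i)"
  shows "Ck_on k S (\<lambda>x. \<Sum>i\<in>I. f i x)"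
  using assms(2)
  by (induction I rule: infinite_finite_induct) (auto intro: Ck_on_const Ck_on_add[OF assms(1)])

lemma Ck_on_bilinear:
  assumes "bounded_bilinear B" "open S" "Ck_on k S f" "Ck_on k S g"
  shows "Ck_on k S (\<lambda>x. B (f x) (g x))"
  using assms(3,4)
proof (induction k arbitrary: f g)
  case 0
  then show ?case using bounded_bilinear.continuous_on[OF assms(1)] by auto
next
  case (Suc k)
  show ?case
  proof (rule Ck_on_SucI[OF assms(2)])
    show "((\<lambda>x. B (f x) (g x)) has_derivative (\<lambda>v. B (f x) (fd g x v) + B (fd f x v) (g x))) (at x)"
      if "x \<in> S" for x
      by (rule bounded_bilinear.FDERIV[OF assms(1) Ck_on_SucE(1)[OF Suc.prems(1) that] Ck_on_SucE(1)[OF Suc.prems(2) that]])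
    show "Ck_on k S (\<lambda>x. B (f x) (fd g x v) + B (fd f x v) (g x))" for v
      by (intro Suc.IH Ck_on_add[OF assms(2)] Ck_on_SucE(2) Suc.prems Ck_on_SucD[OF Suc.prems(1)]
          Ck_on_SucD[OF Suc.prems(2)])
  qed
qed

lemma linear_eq_sum_Basis:
  fixes L :: "'a::euclidean_space \<Rightarrow> 'b::real_vector"
  assumes "linear L"
  shows "L v = (\<Sum>i\<in>Basis. (v \<bullet> i) *\<^sub>R L i)"
proof -
  have "L v = L (\<Sum>i\<in>Basis. (v \<bullet> i) *\<^sub>R i)" by (simp add: euclidean_representation)
  then show ?thesis by (simp add: linear_sum[OF assms] linear_scale[OF assms])
qed

lemma Ck_on_compose:
  fixes g :: "'a::euclidean_space \<Rightarrow> 'b::euclidean_space" and f :: "'b \<Rightarrow> 'c::real_normed_vector"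
  assumes "open S" "open T" "g ` S \<subseteq> T" "Ck_on k T f" "Ck_on k S g"
  shows "Ck_on k S (\<lambda>x. f (g x))"
  using assms(4,5)
proof (induction k arbitrary: f)
  case 0
  then show ?case using continuous_on_compose2[of T f S g] assms(3) by auto
next
  case (Suc k)
  show ?case
  proof (rule Ck_on_SucI[OF assms(1)])
    fix x assume x: "x \<in> S"
    have f: "(f has_derivative fd f (g x)) (at (g x))"
      by (rule Ck_on_SucE(1)[OF Suc.prems(1)]) (use x assms(3) in auto)
    have g: "(g has_derivative fd g x) (at x)" by (rule Ck_on_SucE(1)[OF Suc.prems(2) x])
    have "((\<lambda>x. f (g x)) has_derivative (\<lambda>v. fd f (g x) (fd g x v))) (at x)"
      using diff_chain_at[OF g f] by (simp add: o_def)
    \<comment> \<open>\<open>Ck_on\<close> controls derivatives in fixed directions only, whereas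
      \<open>fd g x v\<close> moves with \<open>x\<close>. The expansion in \<open>Basis\<close>
      separates moving coefficients from fixed directions.\<close>
    moreover have "(\<lambda>v. fd f (g x) (fd g x v)) = (\<lambda>v. \<Sum>i\<in>Basis. (fd g x v \<bullet> i) *\<^sub>R fd f (g x) i)"
      by (rule ext, rule linear_eq_sum_Basis[OF has_derivative_linear[OF f]])
    ultimately show "((\<lambda>x. f (g x)) has_derivative
        (\<lambda>v. \<Sum>i\<in>Basis. (fd g x v \<bullet> i) *\<^sub>R fd f (g x) i)) (at x)"
      by simp
  next
    fix v
    show "Ck_on k S (\<lambda>x. \<Sum>i\<in>Basis. (fd g x v \<bullet> i) *\<^sub>R fd f (g x) i)"
      by (intro Ck_on_sum[OF assms(1)] Ck_on_bilinear[OF bounded_bilinear_scaleR assms(1)]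
          Ck_on_bounded_linear[OF bounded_linear_inner_left assms(1)] Ck_on_SucE(2) Suc.IH Suc.prems
          Ck_on_SucD[OF Suc.prems(2)])
  qed
qed

lemma Ck_on_ident: "open S \<Longrightarrow> Ck_on k S (\<lambda>x. x)"
proof (cases k)
  case (Suc k')
  assume "open S"
  then have "Ck_on (Suc k') S (\<lambda>x. x)"
    by (rule Ck_on_SucI[where f' = "\<lambda>_ v. v"]) (auto intro: Ck_on_const has_derivative_ident)
  then show ?thesis using Suc by simp
qed simp

lemma smooth_on_imp_Ck_on: "smooth_on S f \<Longrightarrow> Ck_on k S f"
  by (simp add: smooth_on_def)

lemma smooth_on_cong:
  "open S \<Longrightarrow> (\<And>x. x \<in> S \<Longrightarrow> f x = g x) \<Longrightarrow> smooth_on S f \<Longrightarrow> smooth_on S g"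
  unfolding smooth_on_def using Ck_on_cong[of S f g] by blast

lemma smooth_on_subset: "smooth_on S f \<Longrightarrow> T \<subseteq> S \<Longrightarrow> smooth_on T f"
  using Ck_on_subset unfolding smooth_on_def by blast

lemma smooth_on_local:
  assumes "\<And>x. x \<in> S \<Longrightarrow> \<exists>T. open T \<and> x \<in> T \<and> smooth_on (T \<inter> S) f"
  shows "smooth_on S f"
  unfolding smooth_on_def
proof
  fix k
  show "Ck_on k S f"
    by (rule Ck_on_local) (use assms in \<open>auto simp: smooth_on_def\<close>)
qed

lemma smooth_on_differentiable: "smooth_on S f \<Longrightarrow> x \<in> S \<Longrightarrow> f differentiable (at x)"
  using smooth_on_imp_Ck_on[of S f "Suc 0"] by simp

lemma smooth_on_has_derivative: "smooth_on S f \<Longrightarrow> x \<in> S \<Longrightarrow> (f has_derivative fd f x) (at x)"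
  using smooth_on_differentiable fd_has_derivative by blast

lemma smooth_on_continuous: "smooth_on S f \<Longrightarrow> continuous_on S f"
  using smooth_on_imp_Ck_on[of S f 0] by simp

lemma smooth_on_fd: "smooth_on S f \<Longrightarrow> smooth_on S (\<lambda>x. fd f x v)"
  unfolding smooth_on_def by (intro allI Ck_on_SucE(2)) simp

lemma smooth_on_const: "smooth_on S (\<lambda>x. c)"
  by (simp add: smooth_on_def Ck_on_const)

lemma smooth_on_ident: "open S \<Longrightarrow> smooth_on S (\<lambda>x. x)"
  by (simp add: smooth_on_def Ck_on_ident)

lemma smooth_on_bounded_linear:
  "bounded_linear L \<Longrightarrow> open S \<Longrightarrow> smooth_on S f \<Longrightarrow> smooth_on S (\<lambda>x. L (f x))"
  by (simp add: smooth_on_def Ck_on_bounded_linear)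

lemma smooth_on_add:
  "open S \<Longrightarrow> smooth_on S f \<Longrightarrow> smooth_on S g \<Longrightarrow> smooth_on S (\<lambda>x. f x + g x)"
  by (simp add: smooth_on_def Ck_on_add)

lemma smooth_on_sum:
  "open S \<Longrightarrow> (\<And>i. i \<in> I \<Longrightarrow> smooth_on S (f i)) \<Longrightarrow> smooth_on S (\<lambda>x. \<Sum>i\<in>I. f i x)"
  by (simp add: smooth_on_def Ck_on_sum)

lemma smooth_on_bilinear:
  "bounded_bilinear B \<Longrightarrow> open S \<Longrightarrow> smooth_on S f \<Longrightarrow> smooth_on S g \<Longrightarrow>
    smooth_on S (\<lambda>x. B (f x) (g x))"
  by (simp add: smooth_on_def Ck_on_bilinear)

lemmas smooth_on_scaleR = smooth_on_bilinear[OF bounded_bilinear_scaleR]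

lemma smooth_on_cmult: "open S \<Longrightarrow> smooth_on S f \<Longrightarrow> smooth_on S (\<lambda>x. c *\<^sub>R f x)"
  by (intro smooth_on_scaleR smooth_on_const)

lemma smooth_on_diff:
  assumes "open S" "smooth_on S f" "smooth_on S g"
  shows "smooth_on S (\<lambda>x. f x - g x)"
  using smooth_on_add[OF assms(1,2) smooth_on_cmult[OF assms(1,3), of "-1"]] by simp

lemma smooth_on_compose:
  fixes g :: "'a::euclidean_space \<Rightarrow> 'b::euclidean_space" and f :: "'b \<Rightarrow> 'c::real_normed_vector"
  assumes "open S" "open T" "\<And>x. x \<in> S \<Longrightarrow> g x \<in> T" "smooth_on T f" "smooth_on S g"
  shows "smooth_on S (\<lambda>x. f (g x))"
  unfolding smooth_on_def
proof
  fix k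
  show "Ck_on k S (\<lambda>x. f (g x))"
    by (rule Ck_on_compose[OF assms(1,2)]) (use assms(3-5) in \<open>auto simp: smooth_on_def\<close>)
qed

lemma smooth_on_Pair:
  fixes f :: "'a::euclidean_space \<Rightarrow> 'b::euclidean_space" and g :: "'a \<Rightarrow> 'c::euclidean_space"
  assumes "open S" "smooth_on S f" "smooth_on S g"
  shows "smooth_on S (\<lambda>x. (f x, g x))"
proof -
  have b: "bounded_linear (\<lambda>a::'b. (a, 0::'c))" "bounded_linear (\<lambda>a::'c. (0::'b, a))"
    by (auto intro!: bounded_linear_Pair bounded_linear_ident bounded_linear_zero)
  show ?thesis
    using smooth_on_add[OF assms(1) smooth_on_bounded_linear[OF b(1) assms(1,2)]
        smooth_on_bounded_linear[OF b(2) assms(1,3)]] by simp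
qed

lemma smooth_on_vector_derivative:
  assumes "smooth_on I f" "open I"
  shows "smooth_on I (\<lambda>t. vector_derivative f (at t))"
  by (rule smooth_on_cong[OF assms(2) _ smooth_on_fd[OF assms(1), of 1]])
    (simp add: frechet_derivative_eq_vector_derivative smooth_on_differentiable[OF assms(1)])

lemma smooth_on_has_vector_derivative:
  assumes "smooth_on I f" "t \<in> I"
  shows "(f has_vector_derivative vector_derivative f (at t)) (at t)"
  using smooth_on_differentiable[OF assms] vector_derivative_works by blast

subsection \<open>Symmetry of second derivatives\<close>

text \<open>The mean value theorem is applied twice to the second difference of \<open>f\<close>,
  first along \<open>u\<close> and then along \<open>v\<close>; the whole parallelogram lies in
  \<open>S\<close>, so both derivatives exist.\<close>

lemma mixed_mean_value:
  fixes f :: "'a::euclidean_space \<Rightarrow> real"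
  assumes f: "Ck_on 2 S f" and h: "0 < h"
    and S: "\<And>s t. s \<in> {0..h} \<Longrightarrow> t \<in> {0..h} \<Longrightarrow> x + s *\<^sub>R u + t *\<^sub>R v \<in> S"
  shows "\<exists>s\<in>{0..h}. \<exists>t\<in>{0..h}. f (x + h *\<^sub>R u + h *\<^sub>R v) - f (x + h *\<^sub>R u) - f (x + h *\<^sub>R v) + f x
    = h\<^sup>2 * fd (\<lambda>y. fd f y u) (x + s *\<^sub>R u + t *\<^sub>R v) v"
proof -
  have line: "((\<lambda>s. F (p + s *\<^sub>R w)) has_real_derivative fd F (p + s *\<^sub>R w) w) (at s)"
    if "F differentiable (at (p + s *\<^sub>R w))" for F :: "'a \<Rightarrow> real" and p w s
  proof -
    have "((\<lambda>s. p + s *\<^sub>R w) has_derivative (\<lambda>r. r *\<^sub>R w)) (at s)" by (auto intro!: derivative_eq_intros)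
    from diff_chain_at[OF this fd_has_derivative[OF that]]
    have "((\<lambda>s. F (p + s *\<^sub>R w)) has_derivative (\<lambda>r. r * fd F (p + s *\<^sub>R w) w)) (at s)"
      by (simp add: o_def linear_scale[OF fd_linear[OF that]])
    then show ?thesis by (rule has_derivative_imp_has_field_derivative) simp
  qed
  have f2: "Ck_on (Suc (Suc 0)) S f" using f by (simp add: numeral_2_eq_2)
  have d1: "f differentiable (at y)" and d2: "(\<lambda>y. fd f y u) differentiable (at y)" if "y \<in> S" for y
    using f2 that by auto
  let ?\<phi> = "\<lambda>s. f ((x + h *\<^sub>R v) + s *\<^sub>R u) - f (x + s *\<^sub>R u)"
  have der: "(?\<phi> has_real_derivative fd f ((x + h *\<^sub>R v) + s *\<^sub>R u) u - fd f (x + s *\<^sub>R u) u) (at s)"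
    if "0 \<le> s" "s \<le> h" for s
    by (rule DERIV_diff; rule line; rule d1)
      (use S[of s h] S[of s 0] that h in \<open>auto simp: algebra_simps\<close>)
  obtain s where s: "0 < s" "s < h"
    "?\<phi> h - ?\<phi> 0 = (h - 0) * (fd f ((x + h *\<^sub>R v) + s *\<^sub>R u) u - fd f (x + s *\<^sub>R u) u)"
    using MVT2[of 0 h, OF h der] by blast
  have der2: "((\<lambda>t. fd f ((x + s *\<^sub>R u) + t *\<^sub>R v) u) has_real_derivative
      fd (\<lambda>y. fd f y u) ((x + s *\<^sub>R u) + t *\<^sub>R v) v) (at t)" if "0 \<le> t" "t \<le> h" for t
    by (rule line; rule d2) (use S[of s t] that s in auto)
  obtain t where t: "0 < t" "t < h" "fd f ((x + s *\<^sub>R u) + h *\<^sub>R v) u - fd f ((x + s *\<^sub>R u) + 0 *\<^sub>R v) u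
     = (h - 0) * fd (\<lambda>y. fd f y u) ((x + s *\<^sub>R u) + t *\<^sub>R v) v"
    using MVT2[of 0 h, OF h der2] by blast
  show ?thesis
    using s t by (intro bexI[of _ s] bexI[of _ t]) (auto simp: algebra_simps power2_eq_square)
qed

text \<open>Exchanging \<open>u\<close> and \<open>v\<close> leaves the second difference unchanged,
  so the two mixed derivatives agree at points arbitrarily close to \<open>x\<close>; their
  continuity transfers this to \<open>x\<close>.\<close>

lemma second_derivative_symmetric_real:
  fixes f :: "'a::euclidean_space \<Rightarrow> real"
  assumes S: "open S" "x \<in> S" and f: "Ck_on 2 S f"
  shows "fd (\<lambda>y. fd f y u) x v = fd (\<lambda>y. fd f y v) x u"
proof (rule ccontr)
  define a where "a = (\<lambda>y. fd (\<lambda>y. fd f y u) y v)"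
  define b where "b = (\<lambda>y. fd (\<lambda>y. fd f y v) y u)"
  assume "\<not> ?thesis"
  \<comment> \<open>Half the gap: two errors below this size cannot bridge the distance from
    \<open>a x\<close> to \<open>b x\<close>.\<close>
  then have e: "0 < \<bar>a x - b x\<bar> / 2" by (simp add: a_def b_def)
  have f2: "Ck_on (Suc (Suc 0)) S f" using f by (simp add: numeral_2_eq_2)
  have "isCont a x" "isCont b x"
    using f2 S by (auto simp: a_def b_def continuous_on_eq_continuous_at)
  then obtain d1 d2 where d: "0 < d1" "\<And>y. dist y x < d1 \<Longrightarrow> dist (a y) (a x) < \<bar>a x - b x\<bar> / 2"
     "0 < d2" "\<And>y. dist y x < d2 \<Longrightarrow> dist (b y) (b x) < \<bar>a x - b x\<bar> / 2"
    unfolding continuous_at_eps_delta using e by blast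
  obtain d3 where d3: "0 < d3" "ball x d3 \<subseteq> S" using S openE by blast
  define d where "d = min d1 (min d2 d3)"
  \<comment> \<open>Makes the parallelogram of side \<open>h\<close> fit into the ball of radius
    \<open>d\<close>; the summand 1 keeps the denominator positive when \<open>u\<close> and
    \<open>v\<close> vanish.\<close>
  define h where "h = d / (2 * (norm u + norm v + 1))"
  have "0 < d" using d d3 by (simp add: d_def)
  have n: "0 < norm u + norm v + 1" by (simp add: add_nonneg_pos)
  then have h: "0 < h" using \<open>0 < d\<close> by (simp add: h_def)
  have close: "dist (x + s *\<^sub>R u + t *\<^sub>R v) x < d" if "s \<in> {0..h}" "t \<in> {0..h}" for s t
  proof -
    have "dist (x + s *\<^sub>R u + t *\<^sub>R v) x = norm (s *\<^sub>R u + t *\<^sub>R v)"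
      by (simp add: dist_norm add.assoc)
    also have "\<dots> \<le> s * norm u + t * norm v"
      by (rule order_trans[OF norm_triangle_ineq]) (use that in simp)
    also have "\<dots> \<le> h * norm u + h * norm v"
      by (intro add_mono mult_right_mono) (use that in auto)
    also have "\<dots> \<le> h * (norm u + norm v + 1)" using h by (simp add: algebra_simps)
    also have "\<dots> = d / 2" 
    proof -
      have "d / (2 * N) * N = d / 2" if "0 < N" for N :: real using that by simp
      from this[OF n] show ?thesis by (simp only: h_def)
    qed
    also have "\<dots> < d" using \<open>0 < d\<close> by simp
    finally show ?thesis .
  qed
  have inS: "x + s *\<^sub>R u + t *\<^sub>R v \<in> S" if "s \<in> {0..h}" "t \<in> {0..h}" for s t
    using close[OF that] d3 by (auto simp: d_def dist_commute)
  obtain s t where st: "s \<in> {0..h}" "t \<in> {0..h}"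
    "f (x + h *\<^sub>R u + h *\<^sub>R v) - f (x + h *\<^sub>R u) - f (x + h *\<^sub>R v) + f x = h\<^sup>2 * a (x + s *\<^sub>R u + t *\<^sub>R v)"
    using mixed_mean_value[OF f h inS] unfolding a_def by blast
  obtain s' t' where st': "s' \<in> {0..h}" "t' \<in> {0..h}"
    "f (x + h *\<^sub>R v + h *\<^sub>R u) - f (x + h *\<^sub>R v) - f (x + h *\<^sub>R u) + f x = h\<^sup>2 * b (x + t' *\<^sub>R v + s' *\<^sub>R u)"
  proof -
    have "x + t *\<^sub>R v + s *\<^sub>R u \<in> S" if "t \<in> {0..h}" "s \<in> {0..h}" for s t
      using inS[OF that(2,1)] by (simp add: add_ac)
    from mixed_mean_value[OF f h this] show ?thesis using that unfolding b_def by blast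
  qed
  have eq: "a (x + s *\<^sub>R u + t *\<^sub>R v) = b (x + s' *\<^sub>R u + t' *\<^sub>R v)"
  proof -
    have eqx: "x + h *\<^sub>R u + h *\<^sub>R v = x + h *\<^sub>R v + h *\<^sub>R u" by (simp add: add_ac)
    have "h\<^sup>2 * a (x + s *\<^sub>R u + t *\<^sub>R v) = h\<^sup>2 * b (x + t' *\<^sub>R v + s' *\<^sub>R u)"
      unfolding st(3)[symmetric] st'(3)[symmetric] eqx by simp
    moreover have "x + t' *\<^sub>R v + s' *\<^sub>R u = x + s' *\<^sub>R u + t' *\<^sub>R v" by (simp add: add_ac)
    ultimately show ?thesis using h by simp
  qed
  have "dist (a (x + s *\<^sub>R u + t *\<^sub>R v)) (a x) < \<bar>a x - b x\<bar> / 2"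
    by (rule d(2)) (use close[OF st(1,2)] in \<open>simp add: d_def\<close>)
  moreover have "dist (b (x + s' *\<^sub>R u + t' *\<^sub>R v)) (b x) < \<bar>a x - b x\<bar> / 2"
    by (rule d(4)) (use close[OF st'(1,2)] in \<open>simp add: d_def\<close>)
  ultimately show False using eq dist_triangle2[of "a x" "b x" "a (x + s *\<^sub>R u + t *\<^sub>R v)"]
    by (simp add: dist_real_def abs_minus_commute)
qed

lemma second_derivative_symmetric:
  fixes f :: "'a::euclidean_space \<Rightarrow> 'b::euclidean_space"
  assumes S: "open S" "x \<in> S" and f: "smooth_on S f"
  shows "fd (\<lambda>y. fd f y u) x v = fd (\<lambda>y. fd f y v) x u"
proof (rule euclidean_eqI)
  fix i :: 'b
  have in1: "fd (\<lambda>y. g y \<bullet> i) y w = fd g y w \<bullet> i" if "y \<in> S" "smooth_on S g" for g :: "'a \<Rightarrow> 'b" and y w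
    by (rule fd_eqI[THEN fun_cong], rule bounded_linear.has_derivative[OF bounded_linear_inner_left])
      (rule smooth_on_has_derivative[OF that(2,1)])
  have in2: "fd (\<lambda>y. fd f y u) x v \<bullet> i = fd (\<lambda>y. fd (\<lambda>y. f y \<bullet> i) y u) x v" for u v
  proof -
    have "fd (\<lambda>y. fd f y u) x v \<bullet> i = fd (\<lambda>y. fd f y u \<bullet> i) x v"
      by (rule in1[OF S(2) smooth_on_fd[OF f], symmetric])
    also have "fd (\<lambda>y. fd f y u \<bullet> i) x = fd (\<lambda>y. fd (\<lambda>y. f y \<bullet> i) y u) x"
      by (rule fd_cong[OF S]) (rule in1[OF _ f, symmetric])
    finally show ?thesis .
  qed
  have "smooth_on S (\<lambda>y. f y \<bullet> i)"
    by (rule smooth_on_bounded_linear[OF bounded_linear_inner_left S(1) f])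
  then show "fd (\<lambda>y. fd f y u) x v \<bullet> i = fd (\<lambda>y. fd f y v) x u \<bullet> i"
    unfolding in2 by (intro second_derivative_symmetric_real[OF S] smooth_on_imp_Ck_on)
qed

section \<open>Smooth families of linear and bilinear maps\<close>

text \<open>Smoothness is asked for each fixed argument. In finite dimension the expansion in
  \<open>Basis\<close> upgrades this to joint smoothness, so families of linear maps are handled
  without a norm on operators.\<close>

definition lin_family :: "'a::euclidean_space set \<Rightarrow> ('a \<Rightarrow> 'b::euclidean_space \<Rightarrow> 'c::real_normed_vector) \<Rightarrow> bool" where
  "lin_family S L \<longleftrightarrow> (\<forall>x\<in>S. linear (L x)) \<and> (\<forall>a. smooth_on S (\<lambda>x. L x a))"

definition bil_family :: "'a::euclidean_space set \<Rightarrow>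
    ('a \<Rightarrow> 'b::euclidean_space \<Rightarrow> 'c::euclidean_space \<Rightarrow> 'd::real_normed_vector) \<Rightarrow> bool" where
  "bil_family S B \<longleftrightarrow> (\<forall>a. lin_family S (\<lambda>x. B x a)) \<and> (\<forall>b. lin_family S (\<lambda>x a. B x a b))"

lemma lin_familyD:
  assumes "lin_family S L"
  shows "x \<in> S \<Longrightarrow> linear (L x)" "smooth_on S (\<lambda>x. L x a)"
  using assms by (auto simp: lin_family_def)

lemma bil_familyD:
  assumes "bil_family S B"
  shows "lin_family S (\<lambda>x. B x a)" "lin_family S (\<lambda>x a. B x a b)" "smooth_on S (\<lambda>x. B x a b)"
  using assms by (auto simp: bil_family_def lin_family_def)

lemma lin_family_eq_sum:
  "lin_family S L \<Longrightarrow> x \<in> S \<Longrightarrow> L x a = (\<Sum>i\<in>Basis. (a \<bullet> i) *\<^sub>R L x i)"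
  using linear_eq_sum_Basis lin_familyD(1) by metis

lemma smooth_on_inner_Basis: "open T \<Longrightarrow> smooth_on T a \<Longrightarrow> smooth_on T (\<lambda>z. a z \<bullet> i)"
  by (rule smooth_on_bounded_linear[OF bounded_linear_inner_left])

lemma smooth_on_lin_family:
  fixes p :: "'z::euclidean_space \<Rightarrow> 'a::euclidean_space"
  assumes L: "lin_family S L" and S: "open S" and T: "open T" and p: "smooth_on T p"
    and pS: "\<And>z. z \<in> T \<Longrightarrow> p z \<in> S" and a: "smooth_on T a"
  shows "smooth_on T (\<lambda>z. L (p z) (a z))"
proof -
  have "smooth_on T (\<lambda>z. L (p z) i)" for i
    by (rule smooth_on_compose[OF T S pS lin_familyD(2)[OF L] p])
  then have "smooth_on T (\<lambda>z. \<Sum>i\<in>Basis. (a z \<bullet> i) *\<^sub>R L (p z) i)"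
    by (intro smooth_on_sum[OF T] smooth_on_scaleR[OF T] smooth_on_inner_Basis[OF T a])
  then show ?thesis
    by (rule smooth_on_cong[OF T, rotated]) (rule lin_family_eq_sum[OF L pS, symmetric])
qed

lemma smooth_on_bil_family:
  fixes p :: "'z::euclidean_space \<Rightarrow> 'a::euclidean_space"
  assumes B: "bil_family S B" and S: "open S" and T: "open T" and p: "smooth_on T p"
    and pS: "\<And>z. z \<in> T \<Longrightarrow> p z \<in> S" and a: "smooth_on T a" and b: "smooth_on T b"
  shows "smooth_on T (\<lambda>z. B (p z) (a z) (b z))"
proof -
  have "smooth_on T (\<lambda>z. B (p z) i (b z))" for i
    by (rule smooth_on_lin_family[OF bil_familyD(1)[OF B] S T p pS b])
  then have "smooth_on T (\<lambda>z. \<Sum>i\<in>Basis. (a z \<bullet> i) *\<^sub>R B (p z) i (b z))"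
    by (intro smooth_on_sum[OF T] smooth_on_scaleR[OF T] smooth_on_inner_Basis[OF T a])
  then show ?thesis
    by (rule smooth_on_cong[OF T, rotated]) (rule lin_family_eq_sum[OF bil_familyD(2)[OF B] pS, symmetric])
qed

lemma lin_family_fd:
  assumes L: "lin_family S L" and S: "open S"
  shows "lin_family S (\<lambda>x a. fd (\<lambda>y. L y a) x v)"
  unfolding lin_family_def
proof (intro conjI ballI allI linearI)
  note D = smooth_on_has_derivative[OF lin_familyD(2)[OF L]]
  fix x r and a b :: 'b assume x: "x \<in> S"
  have "fd (\<lambda>y. L y (a + b)) x = fd (\<lambda>y. L y a + L y b) x"
    by (rule fd_cong[OF S x]) (use lin_familyD(1)[OF L] in \<open>simp add: linear_add\<close>)
  also have "\<dots> = (\<lambda>v. fd (\<lambda>y. L y a) x v + fd (\<lambda>y. L y b) x v)"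
    by (rule fd_eqI) (intro has_derivative_add D[OF x])
  finally show "fd (\<lambda>y. L y (a + b)) x v = fd (\<lambda>y. L y a) x v + fd (\<lambda>y. L y b) x v" by simp
  have "fd (\<lambda>y. L y (r *\<^sub>R a)) x = fd (\<lambda>y. r *\<^sub>R L y a) x"
    by (rule fd_cong[OF S x]) (use lin_familyD(1)[OF L] in \<open>simp add: linear_scale\<close>)
  also have "\<dots> = (\<lambda>v. r *\<^sub>R fd (\<lambda>y. L y a) x v)"
    by (rule fd_eqI) (intro has_derivative_scaleR_right D[OF x])
  finally show "fd (\<lambda>y. L y (r *\<^sub>R a)) x v = r *\<^sub>R fd (\<lambda>y. L y a) x v" by simp
next
  show "smooth_on S (\<lambda>x. fd (\<lambda>y. L y a) x v)" for a
    by (rule smooth_on_fd[OF lin_familyD(2)[OF L]])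
qed

lemma lin_family_fd_dir:
  assumes "smooth_on S f"
  shows "lin_family S (\<lambda>x. fd f x)"
  unfolding lin_family_def
  using fd_linear[OF smooth_on_differentiable[OF assms]] smooth_on_fd[OF assms] by blast

lemma bil_family_fd_dir:
  assumes L: "lin_family S L" and S: "open S"
  shows "bil_family S (\<lambda>x a v. fd (\<lambda>y. L y a) x v)"
  unfolding bil_family_def
  by (intro conjI allI lin_family_fd[OF L S] lin_family_fd_dir[OF lin_familyD(2)[OF L]])

lemma continuous_neighbourhood:
  "continuous (at z) p \<Longrightarrow> open S \<Longrightarrow> p z \<in> S \<Longrightarrow> \<exists>T. open T \<and> z \<in> T \<and> (\<forall>w\<in>T. p w \<in> S)"
  unfolding continuous_at_open by blast

text \<open>Product rule for a moving linear map and a moving argument; expanding \<open>a z\<close>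
  in \<open>Basis\<close> reduces it to scalar multiples of the curves
  \<open>L (p z) i\<close>.\<close>

lemma lin_family_has_derivative:
  assumes L: "lin_family S L" and S: "open S" and p: "(p has_derivative p') (at z)" "p z \<in> S"
    and a: "(a has_derivative a') (at z)"
  shows "((\<lambda>z. L (p z) (a z)) has_derivative
    (\<lambda>h. fd (\<lambda>y. L y (a z)) (p z) (p' h) + L (p z) (a' h))) (at z)"
proof -
  have lin: "((\<lambda>z. L (p z) i) has_derivative (\<lambda>h. fd (\<lambda>y. L y i) (p z) (p' h))) (at z)" for i
    using diff_chain_at[OF p(1) smooth_on_has_derivative[OF lin_familyD(2)[OF L] p(2)]]
    by (simp add: o_def)
  have ai: "((\<lambda>z. a z \<bullet> i) has_derivative (\<lambda>h. a' h \<bullet> i)) (at z)" for i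
    by (rule bounded_linear.has_derivative[OF bounded_linear_inner_left a])
  have "((\<lambda>z. \<Sum>i\<in>Basis. (a z \<bullet> i) *\<^sub>R L (p z) i) has_derivative
     (\<lambda>h. \<Sum>i\<in>Basis. (a z \<bullet> i) *\<^sub>R fd (\<lambda>y. L y i) (p z) (p' h) + (a' h \<bullet> i) *\<^sub>R L (p z) i)) (at z)"
    by (intro has_derivative_sum has_derivative_scaleR ai lin)
  moreover have "(\<Sum>i\<in>Basis. (a z \<bullet> i) *\<^sub>R fd (\<lambda>y. L y i) (p z) (p' h) + (a' h \<bullet> i) *\<^sub>R L (p z) i)
     = fd (\<lambda>y. L y (a z)) (p z) (p' h) + L (p z) (a' h)" for h
    using lin_family_eq_sum[OF L p(2), of "a' h"]
      lin_family_eq_sum[OF lin_family_fd[OF L S] p(2), of "a z" "p' h"]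
    by (simp add: sum.distrib)
  ultimately have D: "((\<lambda>z. \<Sum>i\<in>Basis. (a z \<bullet> i) *\<^sub>R L (p z) i) has_derivative
      (\<lambda>h. fd (\<lambda>y. L y (a z)) (p z) (p' h) + L (p z) (a' h))) (at z)" by simp
  obtain T where T: "open T" "z \<in> T" "\<forall>w\<in>T. p w \<in> S"
    using continuous_neighbourhood[OF has_derivative_continuous[OF p(1)] S p(2)] by (elim exE conjE)
  show ?thesis
    by (rule has_derivative_transform_within_open[OF D T(1,2)])
      (rule lin_family_eq_sum[OF L T(3)[rule_format], symmetric])
qed

lemma bil_family_has_derivative:
  assumes B: "bil_family S B" and S: "open S" and p: "(p has_derivative p') (at z)" "p z \<in> S"
    and a: "(a has_derivative a') (at z)" and b: "(b has_derivative b') (at z)"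
  shows "((\<lambda>z. B (p z) (a z) (b z)) has_derivative
    (\<lambda>h. fd (\<lambda>y. B y (a z) (b z)) (p z) (p' h) + B (p z) (a' h) (b z) + B (p z) (a z) (b' h))) (at z)"
proof -
  note L1 = bil_familyD(1)[OF B] and L2 = bil_familyD(2)[OF B]
  have lin: "((\<lambda>w. B (p w) i (b w)) has_derivative
      (\<lambda>h. fd (\<lambda>y. B y i (b z)) (p z) (p' h) + B (p z) i (b' h))) (at z)" for i
    by (rule lin_family_has_derivative[OF L1 S p b])
  have ai: "((\<lambda>z. a z \<bullet> i) has_derivative (\<lambda>h. a' h \<bullet> i)) (at z)" for i
    by (rule bounded_linear.has_derivative[OF bounded_linear_inner_left a])
  have "((\<lambda>w. \<Sum>i\<in>Basis. (a w \<bullet> i) *\<^sub>R B (p w) i (b w)) has_derivative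
     (\<lambda>h. \<Sum>i\<in>Basis. (a z \<bullet> i) *\<^sub>R (fd (\<lambda>y. B y i (b z)) (p z) (p' h) + B (p z) i (b' h))
        + (a' h \<bullet> i) *\<^sub>R B (p z) i (b z))) (at z)"
    by (intro has_derivative_sum has_derivative_scaleR ai lin)
  moreover have "(\<Sum>i\<in>Basis. (a z \<bullet> i) *\<^sub>R (fd (\<lambda>y. B y i (b z)) (p z) (p' h) + B (p z) i (b' h))
        + (a' h \<bullet> i) *\<^sub>R B (p z) i (b z))
     = fd (\<lambda>y. B y (a z) (b z)) (p z) (p' h) + B (p z) (a' h) (b z) + B (p z) (a z) (b' h)" for h
    using lin_family_eq_sum[OF L2 p(2), of "a' h" "b z"] lin_family_eq_sum[OF L2 p(2), of "a z" "b' h"]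
      lin_family_eq_sum[OF lin_family_fd[OF L2 S] p(2), of "a z" "b z" "p' h"]
    by (simp add: sum.distrib scaleR_add_right add_ac)
  ultimately have D: "((\<lambda>w. \<Sum>i\<in>Basis. (a w \<bullet> i) *\<^sub>R B (p w) i (b w)) has_derivative
      (\<lambda>h. fd (\<lambda>y. B y (a z) (b z)) (p z) (p' h) + B (p z) (a' h) (b z) + B (p z) (a z) (b' h))) (at z)"
    by simp
  obtain T where T: "open T" "z \<in> T" "\<forall>w\<in>T. p w \<in> S"
    using continuous_neighbourhood[OF has_derivative_continuous[OF p(1)] S p(2)] by (elim exE conjE)
  show ?thesis
    by (rule has_derivative_transform_within_open[OF D T(1,2)])
      (rule lin_family_eq_sum[OF L2 T(3)[rule_format], symmetric])
qed

lemma lin_family_has_vector_derivative: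
  assumes L: "lin_family S L" and S: "open S" and p: "(p has_vector_derivative p') (at t)" "p t \<in> S"
    and a: "(a has_vector_derivative a') (at t)"
  shows "((\<lambda>t. L (p t) (a t)) has_vector_derivative
    (fd (\<lambda>y. L y (a t)) (p t) p' + L (p t) a')) (at t)"
proof -
  have "linear (fd (\<lambda>y. L y (a t)) (p t))"
    by (rule lin_familyD(1)[OF lin_family_fd_dir[OF lin_familyD(2)[OF L]] p(2)])
  then show ?thesis
    using lin_family_has_derivative[OF L S p(1)[unfolded has_vector_derivative_def] p(2)
        a[unfolded has_vector_derivative_def]] lin_familyD(1)[OF L p(2)]
    by (simp add: has_vector_derivative_def linear_scale scaleR_add_right)
qed

lemma bil_family_has_vector_derivative:
  assumes B: "bil_family S B" and S: "open S" and p: "(p has_vector_derivative p') (at t)" "p t \<in> S"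
    and a: "(a has_vector_derivative a') (at t)" and b: "(b has_vector_derivative b') (at t)"
  shows "((\<lambda>t. B (p t) (a t) (b t)) has_vector_derivative
    (fd (\<lambda>y. B y (a t) (b t)) (p t) p' + B (p t) a' (b t) + B (p t) (a t) b')) (at t)"
proof -
  have "linear (fd (\<lambda>y. B y (a t) (b t)) (p t))"
    by (rule lin_familyD(1)[OF lin_family_fd_dir[OF bil_familyD(3)[OF B]] p(2)])
  then show ?thesis
    using bil_family_has_derivative[OF B S p(1)[unfolded has_vector_derivative_def] p(2)
        a[unfolded has_vector_derivative_def] b[unfolded has_vector_derivative_def]]
      lin_familyD(1)[OF bil_familyD(1)[OF B] p(2), of "a t"]
      linear_scale[OF lin_familyD(1)[OF bil_familyD(2)[OF B] p(2), of "b t"]]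
    by (simp add: has_vector_derivative_def linear_scale scaleR_add_right)
qed

subsection \<open>Solutions of smooth linear systems\<close>

text \<open>Injectivity is stable: \<open>N y\<close> dominates the operator norm of
  \<open>L y - L x\<close> and tends to 0, so half of the lower bound at \<open>x\<close> survives
  nearby.\<close>

lemma lin_family_eventually_bounded_below:
  fixes L :: "'a::euclidean_space \<Rightarrow> 'b::euclidean_space \<Rightarrow> 'c::euclidean_space"
  assumes L: "lin_family S L" and S: "open S" "x \<in> S" and inj: "inj (L x)"
  obtains c N where "0 < c" "(N \<longlongrightarrow> 0) (at x)"
    "\<forall>y\<in>S. \<forall>a. norm (L y a - L x a) \<le> N y * norm a"
    "eventually (\<lambda>y. y \<in> S \<and> (\<forall>a. c * norm a \<le> norm (L y a))) (at x)"
proof -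
  obtain c where c: "0 < c" "\<And>a. c * norm a \<le> norm (L x a)"
    using linear_inj_bounded_below_pos[OF lin_familyD(1)[OF L S(2)] inj] by (auto simp: mult.commute)
  define N where "N y = (\<Sum>i\<in>Basis. norm (L y i - L x i))" for y
  have N1: "norm (L y a - L x a) \<le> N y * norm a" if "y \<in> S" for y a
  proof -
    have "L y a - L x a = (\<Sum>i\<in>Basis. (a \<bullet> i) *\<^sub>R (L y i - L x i))"
      unfolding lin_family_eq_sum[OF L that, of a] lin_family_eq_sum[OF L S(2), of a]
      by (simp add: sum_subtractf scaleR_diff_right)
    also have "norm \<dots> \<le> (\<Sum>i\<in>Basis. norm a * norm (L y i - L x i))"
      by (rule sum_norm_le) (auto intro!: mult_right_mono Basis_le_norm)
    also have "\<dots> = N y * norm a" by (simp add: N_def sum_distrib_left mult.commute)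
    finally show ?thesis .
  qed
  have "isCont (\<lambda>y. L y i) x" for i
    using smooth_on_continuous[OF lin_familyD(2)[OF L]] S by (simp add: continuous_on_eq_continuous_at)
  then have "((\<lambda>y. norm (L y i - L x i)) \<longlongrightarrow> 0) (at x)" for i
    by (simp add: LIM_zero_iff isCont_def tendsto_norm_zero)
  then have N2: "(N \<longlongrightarrow> 0) (at x)"
    unfolding N_def by (intro tendsto_null_sum)
  have "eventually (\<lambda>y. y \<in> S \<and> N y < c / 2) (at x)"
    using order_tendstoD(2)[OF N2, of "c / 2"] c(1) eventually_at_in_open'[OF S]
    by (auto intro: eventually_conj)
  then have "eventually (\<lambda>y. y \<in> S \<and> (\<forall>a. (c / 2) * norm a \<le> norm (L y a))) (at x)"
  proof (rule eventually_mono)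
    fix y assume y: "y \<in> S \<and> N y < c / 2"
    have "(c / 2) * norm a \<le> norm (L y a)" for a
    proof -
      have "norm (L x a) \<le> norm (L y a) + norm (L y a - L x a)"
        using norm_triangle_ineq4[of "L y a" "L y a - L x a"] by simp
      moreover have "N y * norm a \<le> (c / 2) * norm a"
        using y by (intro mult_right_mono) auto
      ultimately show ?thesis using c(2)[of a] N1[of y a] y by (simp add: field_simps)
    qed
    then show "y \<in> S \<and> (\<forall>a. (c / 2) * norm a \<le> norm (L y a))" using y by blast
  qed
  with c(1) N1 N2 show ?thesis by (intro that[of "c / 2" N]) auto
qed

text \<open>The equations at \<open>y\<close> and \<open>x\<close> express
  \<open>L y (z y - z x)\<close> by small quantities; the uniform lower bound on \<open>L y\<close>
  then controls \<open>z y - z x\<close> itself.\<close>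

lemma linear_solution_continuous:
  fixes L :: "'a::euclidean_space \<Rightarrow> 'b::euclidean_space \<Rightarrow> 'c::euclidean_space"
  assumes L: "lin_family S L" and S: "open S" and inj: "\<And>x. x \<in> S \<Longrightarrow> inj (L x)"
    and f: "continuous_on S f" and eq: "\<And>x. x \<in> S \<Longrightarrow> L x (z x) = f x"
  shows "continuous_on S z"
proof -
  have "isCont z x" if x: "x \<in> S" for x
  proof -
    obtain c N where c: "0 < c" "(N \<longlongrightarrow> 0) (at x)"
      "\<forall>y\<in>S. \<forall>a. norm (L y a - L x a) \<le> N y * norm a"
      "eventually (\<lambda>y. y \<in> S \<and> (\<forall>a. c * norm a \<le> norm (L y a))) (at x)"
      by (rule lin_family_eventually_bounded_below[OF L S x inj[OF x]])
    have "eventually (\<lambda>y. norm (z y - z x) \<le> (norm (f y - f x) + N y * norm (z x)) / c) (at x)"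
      using c(4)
    proof (rule eventually_mono)
      fix y assume y: "y \<in> S \<and> (\<forall>a. c * norm a \<le> norm (L y a))"
      have "L y (z y - z x) = (f y - f x) - (L y (z x) - L x (z x))"
        using eq[of y] eq[OF x] y linear_diff[OF lin_familyD(1)[OF L, of y]] by simp
      then have "c * norm (z y - z x) \<le> norm (f y - f x) + norm (L y (z x) - L x (z x))"
        using y by (metis norm_triangle_ineq4 order_trans)
      also have "\<dots> \<le> norm (f y - f x) + N y * norm (z x)" using c(3) y by simp
      finally show "norm (z y - z x) \<le> (norm (f y - f x) + N y * norm (z x)) / c"
        using c(1) by (simp add: field_simps)
    qed
    moreover have "((\<lambda>y. (norm (f y - f x) + N y * norm (z x)) / c) \<longlongrightarrow> (0 + 0 * norm (z x)) / c) (at x)"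
    proof (intro tendsto_intros c(2))
      show "((\<lambda>y. norm (f y - f x)) \<longlongrightarrow> 0) (at x)"
        using f S x by (simp add: continuous_on_eq_continuous_at isCont_def LIM_zero_iff tendsto_norm_zero)
    qed (use c(1) in simp)
    then have "((\<lambda>y. (norm (f y - f x) + N y * norm (z x)) / c) \<longlongrightarrow> 0) (at x)" by simp
    ultimately have "((\<lambda>y. z y - z x) \<longlongrightarrow> 0) (at x)"
      by (rule Lim_null_comparison)
    then show ?thesis by (simp add: isCont_def LIM_zero_iff)
  qed
  then show ?thesis by (simp add: continuous_at_imp_continuous_on)
qed

text \<open>Implicit differentiation of \<open>L z = f\<close>: a derivative must satisfy
  \<open>L z' = f' - (DL) z\<close>, which is solvable because an injective linear map of a
  finite-dimensional space into itself is bijective.\<close>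

lemma linear_solution_has_derivative:
  fixes L :: "'a::euclidean_space \<Rightarrow> 'b::euclidean_space \<Rightarrow> 'b"
  assumes L: "lin_family S L" and S: "open S" "x \<in> S" and inj: "inj (L x)"
    and f: "(f has_derivative f') (at x)" and eq: "\<And>x. x \<in> S \<Longrightarrow> L x (z x) = f x"
  shows "\<exists>z'. (z has_derivative z') (at x) \<and>
    (\<forall>h. L x (z' h) = f' h - fd (\<lambda>y. L y (z x)) x h)"
proof -
  obtain c N where c: "0 < c" "(N \<longlongrightarrow> 0) (at x)"
    "\<forall>y\<in>S. \<forall>a. norm (L y a - L x a) \<le> N y * norm a"
    "eventually (\<lambda>y. y \<in> S \<and> (\<forall>a. c * norm a \<le> norm (L y a))) (at x)"
    by (rule lin_family_eventually_bounded_below[OF L S inj])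
  define A where "A = fd (\<lambda>y. L y (z x)) x"
  have A: "((\<lambda>y. L y (z x)) has_derivative A) (at x)"
    unfolding A_def by (rule smooth_on_has_derivative[OF lin_familyD(2)[OF L] S(2)])
  obtain K where K: "linear K" "\<And>a. K (L x a) = a" "\<And>a. L x (K a) = a"
    using linear_injective_isomorphism[OF lin_familyD(1)[OF L S(2)] inj] by auto
  define B where "B = (\<lambda>h. K (f' h - A h))"
  have LB: "L x (B h) = f' h - A h" for h by (simp add: B_def K)
  have Bl: "bounded_linear B"
    unfolding B_def
    by (intro bounded_linear_compose[OF linear_conv_bounded_linear[THEN iffD1, OF K(1)]]
        bounded_linear_sub has_derivative_bounded_linear[OF f] has_derivative_bounded_linear[OF A])
  obtain b where b: "0 < b" "\<And>h. norm (B h) \<le> norm h * b"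
    using bounded_linear.pos_bounded[OF Bl] by blast
  have "eventually (\<lambda>y. norm (z y - z x - B (y - x)) \<le> e * norm (y - x)) (at x)" if e: "0 < e" for e
  proof -
    \<comment> \<open>Three error terms of size \<open>e' * norm (y - x)\<close> are collected, and
      the lower bound \<open>c\<close> is divided out at the end.\<close>
    define e' where "e' = e * c / 3"
    have e': "0 < e'" using e c(1) by (simp add: e'_def)
    have "eventually (\<lambda>y. norm (f y - f x - f' (y - x)) \<le> e' * norm (y - x)) (at x)"
      using f e' unfolding has_derivative_within_alt2 by blast
    moreover have "eventually (\<lambda>y. norm (L y (z x) - L x (z x) - A (y - x)) \<le> e' * norm (y - x)) (at x)"
      using A e' unfolding has_derivative_within_alt2 by blast
    moreover have "eventually (\<lambda>y. N y < e' / b) (at x)"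
      using order_tendstoD(2)[OF c(2), of "e' / b"] e' b by simp
    ultimately show ?thesis using c(4)
    proof eventually_elim
      case (elim y)
      have y: "y \<in> S" using elim by blast
      note lin = lin_familyD(1)[OF L y]
      have "L y (z y - z x - B (y - x)) = (f y - f x - f' (y - x))
          - (L y (z x) - L x (z x) - A (y - x)) - (L y (B (y - x)) - L x (B (y - x)))"
        using eq[OF y] eq[OF S(2)] LB by (simp add: linear_diff[OF lin])
      then have "norm (L y (z y - z x - B (y - x))) \<le> norm (f y - f x - f' (y - x))
          + norm (L y (z x) - L x (z x) - A (y - x)) + norm (L y (B (y - x)) - L x (B (y - x)))"
        by (metis norm_triangle_le_diff order_refl add_mono)
      moreover have "norm (L y (B (y - x)) - L x (B (y - x))) \<le> e' * norm (y - x)"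
      proof -
        have "norm (L y (B (y - x)) - L x (B (y - x))) \<le> N y * norm (B (y - x))" using c(3) y by blast
        also have "\<dots> \<le> (e' / b) * (norm (y - x) * b)"
          using elim b e' by (intro mult_mono) auto
        also have "\<dots> = e' * norm (y - x)" using b(1) by simp
        finally show ?thesis .
      qed
      moreover have "c * norm (z y - z x - B (y - x)) \<le> norm (L y (z y - z x - B (y - x)))"
        using elim by blast
      ultimately have "c * norm (z y - z x - B (y - x)) \<le> 3 * (e' * norm (y - x))"
        using elim by linarith
      then show ?case using c(1) by (simp add: e'_def field_simps)
    qed
  qed
  then have "(z has_derivative B) (at x)" unfolding has_derivative_within_alt2 using Bl by blast
  then show ?thesis using LB unfolding A_def by blast
qed

text \<open>The derivative of a solution solves the system with the same \<open>L\<close> and a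
  right-hand side built from \<open>z\<close> and the derivative of \<open>f\<close>. The induction
  therefore runs over arbitrary right-hand sides and uses its hypothesis twice, for \<open>z\<close>
  and for \<open>z'\<close>.\<close>

lemma linear_solution_smooth:
  fixes L :: "'a::euclidean_space \<Rightarrow> 'b::euclidean_space \<Rightarrow> 'b"
  assumes L: "lin_family S L" and S: "open S" and inj: "\<And>x. x \<in> S \<Longrightarrow> inj (L x)"
    and f: "smooth_on S f" and eq: "\<And>x. x \<in> S \<Longrightarrow> L x (z x) = f x"
  shows "smooth_on S z"
proof -
  have "Ck_on k S z" if "Ck_on k S f" "\<And>x. x \<in> S \<Longrightarrow> L x (z x) = f x" for k z f
    using that
  proof (induction k arbitrary: z f)
    case 0
    then show ?case using linear_solution_continuous[OF L S inj] by simp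
  next
    case (Suc k)
    have "\<exists>z'. (z has_derivative z') (at x) \<and> (\<forall>h. L x (z' h) = fd f x h - fd (\<lambda>y. L y (z x)) x h)"
      if "x \<in> S" for x
      by (rule linear_solution_has_derivative[OF L S that inj[OF that] Ck_on_SucE(1)[OF Suc.prems(1) that]
            Suc.prems(2)])
    then obtain z' where z': "\<And>x. x \<in> S \<Longrightarrow> (z has_derivative z' x) (at x)"
      "\<And>x h. x \<in> S \<Longrightarrow> L x (z' x h) = fd f x h - fd (\<lambda>y. L y (z x)) x h" by metis
    have z: "Ck_on k S z" by (rule Suc.IH[OF Ck_on_SucD[OF Suc.prems(1)] Suc.prems(2)])
    show ?case
    proof (rule Ck_on_SucI[OF S z'(1)])
      fix v
      note Lv = lin_family_fd[OF L S, of v]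
      have "Ck_on k S (\<lambda>x. \<Sum>i\<in>Basis. (z x \<bullet> i) *\<^sub>R fd (\<lambda>y. L y i) x v)"
        by (intro Ck_on_sum[OF S] Ck_on_bilinear[OF bounded_bilinear_scaleR S]
            Ck_on_bounded_linear[OF bounded_linear_inner_left S z] smooth_on_imp_Ck_on[OF lin_familyD(2)[OF Lv]])
      then have "Ck_on k S (\<lambda>x. fd f x v + (- 1) *\<^sub>R (\<Sum>i\<in>Basis. (z x \<bullet> i) *\<^sub>R fd (\<lambda>y. L y i) x v))"
        by (intro Ck_on_add[OF S] Ck_on_SucE(2)[OF Suc.prems(1)]
            Ck_on_bounded_linear[OF bounded_linear_scaleR_right S])
      then show "Ck_on k S (\<lambda>x. z' x v)"
      proof (rule Suc.IH)
        fix x assume x: "x \<in> S"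
        show "L x (z' x v) = fd f x v + (- 1) *\<^sub>R (\<Sum>i\<in>Basis. (z x \<bullet> i) *\<^sub>R fd (\<lambda>y. L y i) x v)"
          using z'(2)[OF x] lin_family_eq_sum[OF Lv x, of "z x"] by simp
      qed
    qed
  qed
  then show ?thesis using f eq unfolding smooth_on_def by blast
qed

section \<open>Linear differential equations\<close>

lemma antiderivative_exists:
  fixes f :: "real \<Rightarrow> 'a::banach"
  assumes f: "continuous_on UNIV f"
  shows "\<exists>F. F 0 = 0 \<and> (\<forall>t. (F has_vector_derivative f t) (at t))"
proof -
  \<comment> \<open>For nonzero \<open>t\<close> one of the two intervals is empty, so this is the
    oriented integral from 0 to \<open>t\<close>.\<close>
  define F where "F t = integral {0..t} f - integral {t..0} f" for t
  have "(F has_vector_derivative f t) (at t)" for t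
  proof -
    define T where "T = \<bar>t\<bar> + 1"
    have fi: "f integrable_on {a..b}" for a b
      by (rule integrable_continuous_interval[OF continuous_on_subset[OF f]]) simp
    have FT: "integral {-T..s} f - integral {-T..0} f = F s" if "s \<in> {-T<..<T}" for s
    proof (cases "0 \<le> s")
      case True
      then have "integral {-T..0} f + integral {0..s} f = integral {-T..s} f"
        by (intro Henstock_Kurzweil_Integration.integral_combine fi) (auto simp: T_def)
      then show ?thesis using True by (cases "s = 0") (auto simp: F_def algebra_simps)
    next
      case False
      then have "integral {-T..s} f + integral {s..0} f = integral {-T..0} f"
        using that by (intro Henstock_Kurzweil_Integration.integral_combine fi) (auto simp: T_def)
      then show ?thesis using False by (auto simp: F_def algebra_simps)
    qed
    have "((\<lambda>u. integral {-T..u} f) has_vector_derivative f t) (at t within {-T..T})"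
      by (rule integral_has_vector_derivative[OF continuous_on_subset[OF f]]) (auto simp: T_def)
    then have "((\<lambda>u. integral {-T..u} f) has_vector_derivative f t) (at t)"
      using at_within_Icc_at[of "-T" t T] by (simp add: T_def abs_less_iff abs_if split: if_splits)
    then have "((\<lambda>u. integral {-T..u} f - integral {-T..0} f) has_vector_derivative f t - 0) (at t)"
      by (intro has_vector_derivative_diff has_vector_derivative_const)
    then have "((\<lambda>u. integral {-T..u} f - integral {-T..0} f) has_vector_derivative f t) (at t)" by simp
    then show ?thesis
    proof (rule has_vector_derivative_transform_within_open[of _ _ _ "{-T<..<T}"])
      show "t \<in> {-T<..<T}" by (auto simp: T_def)
    qed (simp_all add: FT)
  qed
  moreover have "F 0 = 0" by (simp add: F_def)
  ultimately show ?thesis by blast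
qed

text \<open>Running through \<open>y (s * t)\<close> for \<open>s\<close> in the unit interval
  treats both signs of \<open>t\<close> at once. The divisor \<open>Suc k\<close> gained per
  integration builds up the factorials of the Picard series.\<close>

lemma norm_le_of_derivative_bound:
  fixes y :: "real \<Rightarrow> 'a::real_normed_vector"
  assumes y: "\<And>s. (y has_vector_derivative y' s) (at s)" "y 0 = 0"
    and b: "\<And>s. \<bar>s\<bar> \<le> \<bar>t\<bar> \<Longrightarrow> norm (y' s) \<le> C * \<bar>s\<bar> ^ k"
  shows "norm (y t) \<le> C * \<bar>t\<bar> ^ Suc k / Suc k"
proof -
  have d: "((\<lambda>s. y (s * t)) has_vector_derivative t *\<^sub>R y' (s * t)) (at s)" for s
  proof -
    have "((\<lambda>s. s * t) has_vector_derivative t) (at s)"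
      by (auto intro!: derivative_eq_intros)
    from vector_diff_chain_at[OF this y(1)] show ?thesis by (simp add: o_def)
  qed
  have "norm (y (1 * t) - y (0 * t)) \<le> C * \<bar>t\<bar> ^ Suc k * 1 ^ Suc k / Suc k - C * \<bar>t\<bar> ^ Suc k * 0 ^ Suc k / Suc k"
  proof (rule differentiable_bound_general[where f = "\<lambda>s. y (s * t)" and f' = "\<lambda>s. t *\<^sub>R y' (s * t)"
        and \<phi> = "\<lambda>s. C * \<bar>t\<bar> ^ Suc k * s ^ Suc k / Suc k" and \<phi>' = "\<lambda>s. C * \<bar>t\<bar> ^ Suc k * s ^ k"])
    show "continuous_on {0..1} (\<lambda>s. y (s * t))"
      by (intro continuous_at_imp_continuous_on ballI) (rule has_vector_derivative_continuous[OF d])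
    show "continuous_on {0..1} (\<lambda>s. C * \<bar>t\<bar> ^ Suc k * s ^ Suc k / Suc k)"
      by (intro continuous_intros) auto
    show "((\<lambda>s. C * \<bar>t\<bar> ^ Suc k * s ^ Suc k / Suc k) has_vector_derivative C * \<bar>t\<bar> ^ Suc k * s ^ k) (at s)" for s
    proof -
      have "((\<lambda>s. C * \<bar>t\<bar> ^ Suc k * s ^ Suc k / Suc k) has_real_derivative
          C * \<bar>t\<bar> ^ Suc k * (real (Suc k) * s ^ (Suc k - Suc 0)) / Suc k) (at s)"
        by (intro DERIV_cdivide DERIV_cmult DERIV_pow)
      then show ?thesis by (simp add: has_real_derivative_iff_has_vector_derivative mult.assoc del: power_Suc)
    qed
    show "norm (t *\<^sub>R y' (s * t)) \<le> C * \<bar>t\<bar> ^ Suc k * s ^ k" if "0 < s" "s < 1" for s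
    proof -
      have "\<bar>s * t\<bar> \<le> \<bar>t\<bar>" using that mult_right_mono[of s 1 "\<bar>t\<bar>"] by (simp add: abs_mult)
      then have "\<bar>t\<bar> * norm (y' (s * t)) \<le> \<bar>t\<bar> * (C * \<bar>s * t\<bar> ^ k)"
        by (intro mult_left_mono b) auto
      also have "\<dots> = C * \<bar>t\<bar> ^ Suc k * s ^ k" using that by (simp add: abs_mult power_mult_distrib)
      finally show ?thesis by simp
    qed
  qed (use d in auto)
  then show ?thesis using y(2) by simp
qed

text \<open>Picard iteration written as a series: \<open>Y 0\<close> integrates \<open>f\<close>,
  and each further term integrates \<open>B\<close> applied to its predecessor. Linearity bounds the
  terms by an exponential series on every compact interval, so the solution is global.\<close>

lemma linear_ode_exists:
  fixes B :: "real \<Rightarrow> 'a::euclidean_space \<Rightarrow> 'a" and f :: "real \<Rightarrow> 'a"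
  assumes B: "lin_family UNIV B" and f: "continuous_on UNIV f"
  shows "\<exists>y. y 0 = 0 \<and> (\<forall>t. (y has_vector_derivative B t (y t) + f t) (at t))"
proof -
  define I where "I g = (SOME F. F 0 = 0 \<and> (\<forall>t. (F has_vector_derivative g t) (at t)))" for g :: "real \<Rightarrow> 'a"
  have I: "I g 0 = 0 \<and> (\<forall>t. (I g has_vector_derivative g t) (at t))" if "continuous_on UNIV g" for g
    unfolding I_def by (rule someI_ex[OF antiderivative_exists[OF that]])
  define Y where "Y k = ((\<lambda>g. I (\<lambda>t. B t (g t))) ^^ k) (I f)" for k
  have Y0: "Y 0 = I f" and YS: "Y (Suc k) = I (\<lambda>t. B t (Y k t))" for k by (simp_all add: Y_def)
  have contB: "continuous_on UNIV (\<lambda>t. B t (g t))" if "continuous_on UNIV g" for g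
  proof -
    have "continuous_on UNIV (\<lambda>t. \<Sum>i\<in>Basis. (g t \<bullet> i) *\<^sub>R B t i)"
      by (intro continuous_intros that smooth_on_continuous[OF lin_familyD(2)[OF B]])
    then show ?thesis by (simp only: lin_family_eq_sum[OF B UNIV_I, symmetric])
  qed
  have contI: "continuous_on UNIV (I g)" if "continuous_on UNIV g" for g
    by (intro continuous_at_imp_continuous_on ballI)
      (rule has_vector_derivative_continuous[OF I[OF that, THEN conjunct2, rule_format]])
  have Yc: "continuous_on UNIV (Y k)" for k
    by (induction k) (simp_all add: Y0 YS contI contB f)
  have Y0d: "(Y 0 has_vector_derivative f t) (at t)" for t using I[OF f] by (simp add: Y0)
  have YSd: "(Y (Suc k) has_vector_derivative B t (Y k t)) (at t)" for t k
    using I[OF contB[OF Yc]] by (simp add: YS)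
  have Yz: "Y k 0 = 0" for k
    by (cases k) (use I[OF f] I[OF contB[OF Yc]] in \<open>simp_all add: Y0 YS\<close>)
  \<comment> \<open>The derivative of \<open>Y k\<close>. The shift by one index turns the sum of
    the derivatives into \<open>f\<close> plus \<open>B\<close> applied to the sum.\<close>
  define D where "D k t = (case k of 0 \<Rightarrow> f t | Suc j \<Rightarrow> B t (Y j t))" for k t
  have YD: "(Y k has_vector_derivative D k t) (at t)" for k t
    by (cases k) (simp_all add: D_def Y0d YSd)
  have main: "summable (\<lambda>k. Y k t) \<and> ((\<lambda>t. \<Sum>k. Y k t) has_vector_derivative B t (\<Sum>k. Y k t) + f t) (at t)" for t
  proof -
    define T where "T = \<bar>t\<bar> + 1"
    define S where "S = {-T<..<T}"
    have S: "open S" "convex S" "t \<in> S" by (auto simp: S_def T_def)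
    have Sin: "S \<subseteq> {-T..T}" by (auto simp: S_def)
    have bdd: "\<exists>c. \<forall>s\<in>{-T..T}. norm (g s) \<le> c" if "continuous_on UNIV g" for g :: "real \<Rightarrow> 'a"
    proof -
      have "compact (g ` {-T..T})"
        by (rule compact_continuous_image[OF continuous_on_subset[OF that]]) auto
      then show ?thesis using compact_imp_bounded by (fastforce simp: bounded_iff)
    qed
    obtain M where M: "\<forall>s\<in>{-T..T}. norm (Y 0 s) \<le> M" using bdd[OF Yc] by blast
    have "\<forall>i. \<exists>c. \<forall>s\<in>{-T..T}. norm (B s i) \<le> c"
      using bdd[OF smooth_on_continuous[OF lin_familyD(2)[OF B]]] by blast
    then obtain l where l: "\<And>i s. s \<in> {-T..T} \<Longrightarrow> norm (B s i) \<le> l i" by metis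
    define L where "L = (\<Sum>i\<in>Basis. l i)"
    have T0: "0 < T" by (simp add: T_def add_nonneg_pos)
    have l0: "0 \<le> l i" for i by (rule order_trans[OF norm_ge_zero l[of 0 i]]) (use T0 in simp)
    have L0: "0 \<le> L" unfolding L_def by (intro sum_nonneg l0)
    have M0: "0 \<le> M" by (rule order_trans[OF norm_ge_zero M[rule_format, of 0]]) (use T0 in simp)
    have L: "norm (B s a) \<le> L * norm a" if "s \<in> {-T..T}" for s a
    proof -
      have "norm (B s a) \<le> (\<Sum>i\<in>Basis. norm a * l i)"
        unfolding lin_family_eq_sum[OF B UNIV_I, of s a]
        by (rule sum_norm_le) (use l[OF that] in \<open>auto intro!: mult_mono Basis_le_norm\<close>)
      then show ?thesis by (simp add: L_def sum_distrib_left mult.commute)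
    qed
    \<comment> \<open>Each integration contributes the factor
      \<open>L * \<bar>s\<bar> / Suc k\<close>.\<close>
    have Yb: "norm (Y k s) \<le> M * L ^ k / fact k * \<bar>s\<bar> ^ k" if "s \<in> {-T..T}" for k s
      using that
    proof (induction k arbitrary: s)
      case 0
      then show ?case using M by simp
    next
      case (Suc k)
      have "norm (B r (Y k r)) \<le> L * (M * L ^ k / fact k) * \<bar>r\<bar> ^ k" if "\<bar>r\<bar> \<le> \<bar>s\<bar>" for r
      proof -
        have r: "r \<in> {-T..T}" using that Suc.prems by auto
        have "norm (B r (Y k r)) \<le> L * norm (Y k r)" by (rule L[OF r])
        also have "\<dots> \<le> L * (M * L ^ k / fact k * \<bar>r\<bar> ^ k)" by (intro mult_left_mono Suc.IH r L0)
        finally show ?thesis by (simp add: mult.assoc)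
      qed
      from norm_le_of_derivative_bound[OF YSd Yz this]
      have "norm (Y (Suc k) s) \<le> L * (M * L ^ k / fact k) * \<bar>s\<bar> ^ Suc k / Suc k" by simp
      also have "\<dots> = M * L ^ Suc k / fact (Suc k) * \<bar>s\<bar> ^ Suc k" by (simp add: field_simps)
      finally show ?case .
    qed
    define m where "m k = M * ((L * T) ^ k / fact k)" for k
    have Ym: "norm (Y k s) \<le> m k" if "s \<in> {-T..T}" for k s
    proof -
      have "\<bar>s\<bar> ^ k \<le> T ^ k" using that by (intro power_mono) auto
      then have "M * L ^ k / fact k * \<bar>s\<bar> ^ k \<le> M * L ^ k / fact k * T ^ k"
        using M0 L0 by (intro mult_left_mono) auto
      also have "\<dots> = m k" by (simp add: m_def power_mult_distrib)
      finally show ?thesis using Yb[OF that, of k] by simp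
    qed
    have summ: "summable m"
      unfolding m_def by (intro summable_mult) (use summable_exp_generic[of "L * T"] in \<open>simp add: field_simps\<close>)
    have Ysum: "summable (\<lambda>k. Y k s)" if "s \<in> {-T..T}" for s
      by (rule summable_comparison_test'[OF summ, of 0]) (use Ym[OF that] in simp)
    have Bsums: "(\<lambda>k. B s (Y k s)) sums B s (\<Sum>k. Y k s)" if "s \<in> {-T..T}" for s
      by (rule bounded_linear.sums[OF _ summable_sums[OF Ysum[OF that]]])
        (simp add: lin_familyD(1)[OF B] linear_conv_bounded_linear[symmetric])
    have Dsum: "(\<Sum>k. D k s) = f s + B s (\<Sum>k. Y k s)" if "s \<in> {-T..T}" for s
    proof -
      have "(\<lambda>k. D (Suc k) s) sums B s (\<Sum>k. Y k s)" using Bsums[OF that] by (simp add: D_def)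
      then have "(\<lambda>k. D k s) sums (B s (\<Sum>k. Y k s) + D 0 s)" by (rule sums_Suc)
      then show ?thesis by (simp add: sums_iff D_def)
    qed
    obtain Cf where Cf: "\<forall>s\<in>{-T..T}. norm (f s) \<le> Cf" using bdd[OF f] by blast
    \<comment> \<open>Majorant of the differentiated series: again shifted by one, with a bound for
      \<open>f\<close> in front.\<close>
    define m' where "m' k = (case k of 0 \<Rightarrow> Cf | Suc j \<Rightarrow> L * m j)" for k
    have Dm: "norm (D k s) \<le> m' k" if "s \<in> S" for k s
    proof (cases k)
      case 0
      then show ?thesis using Cf that Sin by (auto simp: D_def m'_def)
    next
      case (Suc j)
      have s: "s \<in> {-T..T}" using that Sin by auto
      have "norm (B s (Y j s)) \<le> L * norm (Y j s)" by (rule L[OF s])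
      also have "\<dots> \<le> L * m j" by (intro mult_left_mono Ym s L0)
      finally show ?thesis by (simp add: D_def m'_def Suc)
    qed
    have sm: "summable m'"
      by (subst summable_Suc_iff[symmetric]) (simp add: m'_def summ)
    have ul: "uniform_limit S (\<lambda>n s. \<Sum>k<n. D k s) (\<lambda>s. \<Sum>k. D k s) sequentially"
      by (rule Weierstrass_m_test[OF Dm sm])
    have "\<exists>g. \<forall>s\<in>S. (\<lambda>k. Y k s) sums g s \<and> (g has_derivative (\<lambda>h. h *\<^sub>R (\<Sum>k. D k s))) (at s within S)"
    proof (rule has_derivative_series[where f' = "\<lambda>k s h. h *\<^sub>R D k s" and x = t])
      show "(Y k has_derivative (\<lambda>h. h *\<^sub>R D k s)) (at s within S)" for k s
        using YD[of k s] has_derivative_at_withinI by (auto simp: has_vector_derivative_def)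
      show "\<forall>\<^sub>F n in sequentially. \<forall>s\<in>S. \<forall>h. norm ((\<Sum>k<n. h *\<^sub>R D k s) - h *\<^sub>R (\<Sum>k. D k s)) \<le> e * norm h"
        if "e > 0" for e
        using uniform_limitD[OF ul that]
      proof eventually_elim
        case (elim n)
        show ?case
        proof (intro ballI allI)
          fix s and h :: real assume "s \<in> S"
          then have "norm ((\<Sum>k<n. D k s) - (\<Sum>k. D k s)) \<le> e" using elim by (auto simp: dist_norm intro: less_imp_le)
          then have "\<bar>h\<bar> * norm ((\<Sum>k<n. D k s) - (\<Sum>k. D k s)) \<le> \<bar>h\<bar> * e" by (intro mult_left_mono) auto
          moreover have "(\<Sum>k<n. h *\<^sub>R D k s) - h *\<^sub>R (\<Sum>k. D k s) = h *\<^sub>R ((\<Sum>k<n. D k s) - (\<Sum>k. D k s))"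
            by (simp add: scaleR_sum_right scaleR_diff_right)
          ultimately show "norm ((\<Sum>k<n. h *\<^sub>R D k s) - h *\<^sub>R (\<Sum>k. D k s)) \<le> e * norm h"
            by (simp add: mult.commute)
        qed
      qed
      show "(\<lambda>k. Y k t) sums (\<Sum>k. Y k t)" using Ysum S(3) Sin by (blast intro: summable_sums)
    qed (use S in auto)
    then obtain g where g: "\<forall>s\<in>S. (\<lambda>k. Y k s) sums g s \<and> (g has_derivative (\<lambda>h. h *\<^sub>R (\<Sum>k. D k s))) (at s within S)"
      by blast
    have "(g has_vector_derivative (\<Sum>k. D k t)) (at t)"
      using g[rule_format, OF S(3)] at_within_open[OF S(3,1)] by (simp only: has_vector_derivative_def)
    then have "((\<lambda>t. \<Sum>k. Y k t) has_vector_derivative (\<Sum>k. D k t)) (at t)"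
      by (rule has_vector_derivative_transform_within_open[OF _ S(1,3)]) (use g in \<open>simp add: sums_iff\<close>)
    moreover have t: "t \<in> {-T..T}" using S(3) Sin by blast
    ultimately show ?thesis using Ysum[OF t] Dsum[OF t] by (simp add: add.commute)
  qed
  show ?thesis
    by (rule exI[of _ "\<lambda>t. \<Sum>k. Y k t"]) (use main Yz in auto)
qed

text \<open>Bootstrapping: the equation expresses the derivative by \<open>y\<close> itself, so each
  order of differentiability yields the next.\<close>

lemma linear_ode_smooth:
  fixes B :: "real \<Rightarrow> 'a::euclidean_space \<Rightarrow> 'a" and f :: "real \<Rightarrow> 'a"
  assumes B: "lin_family UNIV B" and f: "smooth_on UNIV f"
    and y: "\<And>t. (y has_vector_derivative B t (y t) + f t) (at t)"
  shows "smooth_on UNIV y"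
proof -
  have "Ck_on k UNIV y" for k
  proof (induction k)
    case 0
    show ?case using has_vector_derivative_continuous[OF y] by (simp add: continuous_at_imp_continuous_on)
  next
    case (Suc k)
    show ?case
    proof (rule Ck_on_SucI[OF open_UNIV y[unfolded has_vector_derivative_def]])
      fix v
      have "Ck_on k UNIV (\<lambda>t. (\<Sum>i\<in>Basis. (y t \<bullet> i) *\<^sub>R B t i) + f t)"
        by (intro Ck_on_add Ck_on_sum Ck_on_bilinear[OF bounded_bilinear_scaleR]
            Ck_on_bounded_linear[OF bounded_linear_inner_left _ Suc.IH] open_UNIV
            smooth_on_imp_Ck_on[OF lin_familyD(2)[OF B]] smooth_on_imp_Ck_on[OF f])
      then show "Ck_on k UNIV (\<lambda>t. v *\<^sub>R (B t (y t) + f t))"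
        unfolding lin_family_eq_sum[OF B UNIV_I, symmetric]
        by (rule Ck_on_bounded_linear[OF bounded_linear_scaleR_right open_UNIV])
    qed
  qed
  then show ?thesis by (simp add: smooth_on_def)
qed

section \<open>Conjugate points of a linear Hamiltonian system\<close>

text \<open>Passing to the arctangent makes the slope constant:
  \<open>arctan (q * s t) + d * t\<close> cannot increase, yet the arctangent is confined to an
  interval of length \<open>pi\<close>.\<close>

lemma riccati_inequality_blowup:
  fixes s :: "real \<Rightarrow> real"
  assumes s: "\<And>t. 0 < t \<Longrightarrow> \<exists>D. (s has_real_derivative D) (at t) \<and> D \<le> - (\<alpha> * (s t)\<^sup>2 + \<beta>)"
    and pos: "0 < \<alpha>" "0 < \<beta>"
  shows False
proof -
  \<comment> \<open>Chosen so that
    \<open>\<alpha> * s^2 + \<beta> = \<beta> * (1 + (q * s)^2)\<close>, which cancels the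
    denominator in the derivative of \<open>arctan\<close>.\<close>
  define q where "q = sqrt (\<alpha> / \<beta>)"
  have q: "0 < q" "q\<^sup>2 = \<alpha> / \<beta>" using pos by (simp_all add: q_def)
  define d where "d = q * \<beta>"
  have d: "0 < d" using q pos by (simp add: d_def)
  \<comment> \<open>The comparison starts at time 1 because the inequality is assumed at positive
    times only; over the length \<open>pi / d\<close> the linear term grows by exactly
    \<open>pi\<close>.\<close>
  define T where "T = 1 + pi / d"
  have T: "1 \<le> T" using d by (simp add: T_def)
  have "arctan (q * s T) + d * T \<le> arctan (q * s 1) + d * 1"
  proof (rule DERIV_nonpos_imp_nonincreasing[OF T, where f = "\<lambda>t. arctan (q * s t) + d * t"])
    fix t assume t: "1 \<le> t" "t \<le> T"
    then obtain D where D: "(s has_real_derivative D) (at t)" "D \<le> - (\<alpha> * (s t)\<^sup>2 + \<beta>)" using s[of t] by auto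
    have "((\<lambda>t. arctan (q * s t) + d * t) has_real_derivative
        inverse (1 + (q * s t)\<^sup>2) * (q * D) + d) (at t)"
      by (intro DERIV_add DERIV_chain2[OF DERIV_arctan DERIV_cmult[OF D(1)]] DERIV_cmult_Id)
    moreover have "inverse (1 + (q * s t)\<^sup>2) * (q * D) + d \<le> 0"
    proof -
      have p: "0 < 1 + (q * s t)\<^sup>2" by (simp add: add_pos_nonneg)
      have "\<alpha> * (s t)\<^sup>2 + \<beta> = \<beta> * (1 + (q * s t)\<^sup>2)"
        using pos by (simp add: power_mult_distrib q(2) field_simps)
      then have "q * D \<le> - (d * (1 + (q * s t)\<^sup>2))"
        using mult_left_mono[OF D(2), of q] q(1) by (simp add: d_def mult.assoc)
      then have "inverse (1 + (q * s t)\<^sup>2) * (q * D) \<le> inverse (1 + (q * s t)\<^sup>2) * (- (d * (1 + (q * s t)\<^sup>2)))"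
        using p by (intro mult_left_mono) auto
      also have "\<dots> = - d" using p by (simp add: field_simps)
      finally show ?thesis by simp
    qed
    ultimately show "\<exists>y. ((\<lambda>t. arctan (q * s t) + d * t) has_real_derivative y) (at t) \<and> y \<le> 0" by blast
  qed
  moreover have "d * T = d + pi" using d by (simp add: T_def field_simps)
  ultimately show False using arctan_lbound[of "q * s T"] arctan_ubound[of "q * s 1"] by simp
qed

text \<open>Writing \<open>V\<close> for the inverse of \<open>W\<close>, the form \<open>V - K/2\<close> is symmetric and \<open>V\<close> solves a Riccati
  equation; its trace \<open>s\<close> satisfies \<open>s' \<le> - (\<alpha> s\<^sup>2 + \<beta>)\<close> and therefore blows up.\<close>

lemma rotating_system_degenerates:
  fixes W M :: "real \<Rightarrow> 'a::euclidean_space \<Rightarrow> 'a" and K :: "'a \<Rightarrow> 'a"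
  assumes M: "\<And>t a b. M t a \<bullet> b = a \<bullet> M t b" "0 < c" "\<And>t a. c * (a \<bullet> a) \<le> M t a \<bullet> a"
    and K: "linear K" "\<And>a b. K a \<bullet> b = - (a \<bullet> K b)" "K a\<^sub>0 \<noteq> 0"
    and W: "lin_family UNIV W" "\<And>a. W 0 a = 0"
      "\<And>t a. ((\<lambda>t. W t a) has_vector_derivative M t (a - K (W t a))) (at t)"
  shows "\<exists>\<tau>>0. \<exists>a. a \<noteq> 0 \<and> W \<tau> a = 0"
proof (rule ccontr)
  assume contra: "\<not> ?thesis"
  have Wl: "linear (W t)" for t using lin_familyD(1)[OF W(1)] by simp
  have inj: "inj (W t)" if "0 < t" for t
    using contra that linear_injective_0[OF Wl] by auto
  define V where "V t = inv (W t)" for t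
  have V: "W t (V t a) = a" if "0 < t" for t a
    unfolding V_def by (rule surj_f_inv_f[OF linear_inj_imp_surj[OF Wl inj[OF that]]])
  \<comment> \<open>A conserved quantity: with \<open>p\<close> and \<open>q\<close> as below its
    derivative is \<open>q \<bullet> M p - M q \<bullet> p\<close>, which is 0 as \<open>M\<close>
    is symmetric, and it starts at 0 because \<open>W 0 = 0\<close>. It replaces the symmetry of the
    solution operator that \<open>K\<close> destroys.\<close>
  have sym: "b \<bullet> W t a - W t b \<bullet> a - K (W t b) \<bullet> W t a = 0" for t a b
  proof -
    let ?\<phi> = "\<lambda>t. b \<bullet> W t a - W t b \<bullet> a - K (W t b) \<bullet> W t a"
    have "(?\<phi> has_real_derivative 0) (at t)" for t
    proof -
      define p q where "p = a - K (W t a)" and "q = b - K (W t b)"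
      have Wa: "((\<lambda>t. W t a) has_vector_derivative M t p) (at t)"
        and Wb: "((\<lambda>t. W t b) has_vector_derivative M t q) (at t)" unfolding p_def q_def by (rule W(3))+
      have KWb: "((\<lambda>t. K (W t b)) has_vector_derivative K (M t q)) (at t)"
        by (rule bounded_linear.has_vector_derivative[OF linear_conv_bounded_linear[THEN iffD1, OF K(1)] Wb])
      have "(?\<phi> has_vector_derivative ((b \<bullet> M t p + 0 \<bullet> W t a) - (W t b \<bullet> 0 + M t q \<bullet> a)
          - (K (W t b) \<bullet> M t p + K (M t q) \<bullet> W t a))) (at t)"
        by (intro has_vector_derivative_diff bounded_bilinear.has_vector_derivative[OF bounded_bilinear_inner]
            has_vector_derivative_const Wa Wb KWb)
      moreover have "K (M t q) \<bullet> W t a = - (M t q \<bullet> K (W t a))" by (rule K(2))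
      moreover have "b \<bullet> M t p - K (W t b) \<bullet> M t p = q \<bullet> M t p" by (simp add: q_def inner_diff_left)
      moreover have "M t q \<bullet> a - M t q \<bullet> K (W t a) = M t q \<bullet> p" by (simp add: p_def inner_diff_right)
      moreover have "M t q \<bullet> p = q \<bullet> M t p" by (rule M(1))
      ultimately show ?thesis by (simp add: has_real_derivative_iff_has_vector_derivative algebra_simps)
    qed
    then have "?\<phi> t = ?\<phi> 0" by (intro DERIV_isconst_all) blast
    then show ?thesis by (simp add: W(2) linear_0[OF K(1)])
  qed
  \<comment> \<open>\<open>M (r t a)\<close> is the time derivative of \<open>W\<close> at the fixed
    argument \<open>V t a\<close>; the identity \<open>sym\<close> says that \<open>r t\<close> is
    the adjoint of \<open>V t\<close>.\<close>
  define r where "r t a = V t a - K a" for t a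
  have r: "r t a \<bullet> b = a \<bullet> V t b" if "0 < t" for t a b
    using sym[of "V t b" t "V t a"] K(2)[of a b]
    by (simp add: V[OF that] r_def inner_diff_left inner_commute algebra_simps)
  have Vlin: "V t (a + b) = V t a + V t b" "V t (x *\<^sub>R a) = x *\<^sub>R V t a" if "0 < t" for t a b x
    by (rule injD[OF inj[OF that]], simp add: linear_add[OF Wl] linear_scale[OF Wl] V[OF that])+
  define s where "s t = (\<Sum>i\<in>Basis. V t i \<bullet> i)" for t
  \<comment> \<open>Differentiating \<open>W V = 1\<close> gives \<open>V' = - V M r\<close>; moving
    \<open>V\<close> to the other side of the inner product turns it into a second
    \<open>r\<close>.\<close>
  have sd: "(s has_real_derivative - (\<Sum>i\<in>Basis. M t (r t i) \<bullet> r t i)) (at t)" if t: "0 < t" for t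
  proof -
    have "((\<lambda>t. V t i \<bullet> i) has_real_derivative - (M t (r t i) \<bullet> r t i)) (at t)" for i
    proof -
      have sub: "lin_family {0<..} W" using W(1) smooth_on_subset unfolding lin_family_def by blast
      have "\<exists>z'. ((\<lambda>t. V t i) has_derivative z') (at t) \<and>
          (\<forall>h. W t (z' h) = 0 - fd (\<lambda>y. W y (V t i)) t h)"
        by (rule linear_solution_has_derivative[OF sub _ _ inj[OF t] has_derivative_const[of i]])
          (use t V in auto)
      then obtain z' where z': "((\<lambda>t. V t i) has_derivative z') (at t)"
        "\<And>h. W t (z' h) = - fd (\<lambda>y. W y (V t i)) t h" by auto
      have "fd (\<lambda>y. W y (V t i)) t = (\<lambda>h. h *\<^sub>R M t (r t i))"
        using W(3)[of "V t i" t] by (intro fd_eqI) (simp add: V[OF t] r_def has_vector_derivative_def)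
      then have "W t (z' h) = W t (h *\<^sub>R (- V t (M t (r t i))))" for h
        by (simp add: z'(2) V[OF t] linear_scale[OF Wl] linear_neg[OF Wl])
      then have "z' = (\<lambda>h. h *\<^sub>R (- V t (M t (r t i))))" using injD[OF inj[OF t]] by blast
      then have "((\<lambda>t. V t i \<bullet> i) has_derivative (\<lambda>h. (h *\<^sub>R (- V t (M t (r t i)))) \<bullet> i)) (at t)"
        using bounded_linear.has_derivative[OF bounded_linear_inner_left z'(1), of i] by simp
      moreover have "V t (M t (r t i)) \<bullet> i = M t (r t i) \<bullet> r t i"
        using r[OF t, of i "M t (r t i)"] by (simp add: inner_commute)
      ultimately show ?thesis by (intro has_derivative_imp_has_field_derivative) auto
    qed
    then have "(s has_real_derivative (\<Sum>i\<in>Basis. - (M t (r t i) \<bullet> r t i))) (at t)"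
      unfolding s_def by (intro DERIV_sum)
    then show ?thesis by (simp add: sum_negf)
  qed
  \<comment> \<open>With zero diagonal, \<open>K\<close> does not change the trace, so
    \<open>r\<close> also has trace \<open>s\<close>.\<close>
  have Kii: "K i \<bullet> i = 0" for i using K(2)[of i i] by (simp add: inner_commute)
  have "\<exists>i\<in>Basis. \<exists>j\<in>Basis. K i \<bullet> j \<noteq> 0"
  proof (rule ccontr)
    assume neg: "\<not> ?thesis"
    have "K i = 0" if "i \<in> Basis" for i
      by (rule euclidean_eqI) (use neg that in simp)
    then show False using linear_eq_sum_Basis[OF K(1), of a\<^sub>0] K(3) by simp
  qed
  then obtain i j where ij: "i \<in> Basis" "j \<in> Basis" "K i \<bullet> j \<noteq> 0" by blast
  have neq: "i \<noteq> j" using ij Kii by auto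
  define n where "n = real (card (Basis :: 'a set))"
  have n: "0 < n" by (simp add: n_def)
  show False
  \<comment> \<open>Half of \<open>c * R\<close> is spent on \<open>s\<close>, via
    \<open>(s t)^2 / n \<le> R\<close>, and half on \<open>K\<close>, via
    \<open>(K i \<bullet> j)^2 \<le> 2 * R\<close>.\<close>
  proof (rule riccati_inequality_blowup[of s "c / (2 * n)" "c * (K i \<bullet> j)\<^sup>2 / 4"])
    fix t :: real assume t: "0 < t"
    define R where "R = (\<Sum>i\<in>Basis. r t i \<bullet> r t i)"
    have "s t = (\<Sum>i\<in>Basis. r t i \<bullet> i)"
      using Kii by (simp add: s_def r_def inner_diff_left)
    then have "(s t)\<^sup>2 \<le> (\<Sum>i\<in>Basis. (r t i \<bullet> i)\<^sup>2) * n"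
      unfolding n_def by (simp only: sum_squared_le_sum_of_squares)
    also have "\<dots> \<le> R * n"
    proof (intro mult_right_mono)
      have "(r t k \<bullet> k)\<^sup>2 \<le> r t k \<bullet> r t k" if "k \<in> Basis" for k
        using Cauchy_Schwarz_ineq[of "r t k" k] that by (simp add: inner_Basis)
      then show "(\<Sum>i\<in>Basis. (r t i \<bullet> i)\<^sup>2) \<le> R" unfolding R_def by (intro sum_mono)
    qed (use n in simp)
    finally have R1: "(s t)\<^sup>2 / n \<le> R" using n by (simp add: field_simps)
    \<comment> \<open>Up to a constant factor \<open>K\<close> is the antisymmetric part of
      \<open>r\<close>, so it keeps \<open>r\<close> away from 0 even where the trace is
      small.\<close>
    have "K i \<bullet> j = r t j \<bullet> i - r t i \<bullet> j"
      using r[OF t, of j i] by (simp add: r_def inner_diff_left inner_diff_right inner_commute)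
    moreover have "(r t j \<bullet> i)\<^sup>2 \<le> r t j \<bullet> r t j" "(r t i \<bullet> j)\<^sup>2 \<le> r t i \<bullet> r t i"
      using Cauchy_Schwarz_ineq[of "r t j" i] Cauchy_Schwarz_ineq[of "r t i" j] ij by (simp_all add: inner_Basis)
    moreover have "(r t j \<bullet> i - r t i \<bullet> j)\<^sup>2 \<le> 2 * ((r t j \<bullet> i)\<^sup>2 + (r t i \<bullet> j)\<^sup>2)"
      using zero_le_power2[of "r t j \<bullet> i + r t i \<bullet> j"] unfolding power2_diff power2_sum
      by (simp add: algebra_simps)
    ultimately have "(K i \<bullet> j)\<^sup>2 \<le> 2 * (r t j \<bullet> r t j + r t i \<bullet> r t i)"
      by simp
    also have "r t j \<bullet> r t j + r t i \<bullet> r t i = (\<Sum>k\<in>{i,j}. r t k \<bullet> r t k)" using neq by simp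
    also have "\<dots> \<le> R" unfolding R_def by (rule sum_mono2) (use ij in auto)
    finally have R2: "(K i \<bullet> j)\<^sup>2 \<le> 2 * R" by simp
    have "c * R \<le> (\<Sum>i\<in>Basis. M t (r t i) \<bullet> r t i)"
      unfolding R_def sum_distrib_left by (intro sum_mono M(3))
    moreover have "c / (2 * n) * (s t)\<^sup>2 + c * (K i \<bullet> j)\<^sup>2 / 4 \<le> c * R"
    proof -
      have "(s t)\<^sup>2 / n / 2 + (K i \<bullet> j)\<^sup>2 / 4 \<le> R" using R1 R2 by simp
      then have "c * ((s t)\<^sup>2 / n / 2 + (K i \<bullet> j)\<^sup>2 / 4) \<le> c * R" using M(2) by (intro mult_left_mono) auto
      then show ?thesis by (simp add: algebra_simps)
    qed
    ultimately show "\<exists>D. (s has_real_derivative D) (at t) \<and> D \<le> - (c / (2 * n) * (s t)\<^sup>2 + c * (K i \<bullet> j)\<^sup>2 / 4)"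
      using sd[OF t] by fastforce
  qed (use M(2) n ij in auto)
qed

section \<open>Geodesics, Jacobi fields and Killing fields in a chart\<close>

text \<open>Allows an identity valid on an open set to be differentiated: it is applied to the
  difference of the two sides.\<close>

lemma has_derivative_zero_fun:
  assumes "open S" "x \<in> S" "\<And>y. y \<in> S \<Longrightarrow> f y = 0" "(f has_derivative f') (at x)"
  shows "f' v = 0"
proof -
  have "f' = fd f x" using fd_eqI[OF assms(4)] by simp
  also have "\<dots> = fd (\<lambda>y. 0) x" by (rule fd_cong[OF assms(1-3)])
  finally show ?thesis by simp
qed

text \<open>Base and fibre have separate types because the locale is used twice: for metric
  coefficients over a chart image, and for \<Lambda> over the time line.\<close>

locale inner_family =
  fixes S :: "'a::euclidean_space set" and G :: "'a \<Rightarrow> 'e::euclidean_space \<Rightarrow> 'e \<Rightarrow> real"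
  assumes open_S: "open S" and G: "bil_family S G"
    and G_sym: "x \<in> S \<Longrightarrow> G x a b = G x b a"
    and G_pos: "x \<in> S \<Longrightarrow> a \<noteq> 0 \<Longrightarrow> 0 < G x a a"
begin

lemmas G_fam = bil_familyD[OF G]
lemmas G_lin = lin_familyD(1)[OF G_fam(1)] lin_familyD(1)[OF G_fam(2)]

lemma G_eqI:
  assumes "x \<in> S" "\<And>w. G x z w = G x z' w"
  shows "z = z'"
proof (rule ccontr)
  assume "z \<noteq> z'"
  then have "0 < G x (z - z') (z - z')" using G_pos assms(1) by simp
  moreover have "G x (z - z') w = 0" for w
    using assms linear_diff[OF G_lin(2)[OF assms(1)]] by simp
  ultimately show False by simp
qed

text \<open>Lowering of indices by \<open>G\<close>, read as a map of the Euclidean space into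
  itself; raising an index then means solving a linear system.\<close>

definition flat :: "'a \<Rightarrow> 'e \<Rightarrow> 'e" where
  "flat x z = (\<Sum>i\<in>Basis. G x z i *\<^sub>R i)"

lemma flat_inner: "x \<in> S \<Longrightarrow> flat x z \<bullet> w = G x z w"
  unfolding flat_def inner_sum_left using linear_eq_sum_Basis[OF G_lin(1), of x z w]
  by (simp add: inner_commute mult.commute)

lemma flat_family: "lin_family S flat"
  unfolding lin_family_def
proof (intro conjI ballI allI)
  show "linear (flat x)" if "x \<in> S" for x
    unfolding flat_def using linear_add[OF G_lin(2)[OF that]] linear_scale[OF G_lin(2)[OF that]]
    by (intro linearI) (simp_all add: scaleR_add_left sum.distrib scaleR_sum_right)
  show "smooth_on S (\<lambda>x. flat x a)" for a
    unfolding flat_def by (intro smooth_on_sum smooth_on_scaleR smooth_on_const open_S G_fam(3))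
qed

lemma flat_inj: "x \<in> S \<Longrightarrow> inj (flat x)"
  by (rule injI, rule G_eqI, assumption) (simp add: flat_inner[symmetric])

lemma representation:
  assumes x: "x \<in> S" and \<phi>: "linear \<phi>"
  shows "\<exists>z. \<forall>w. G x z w = \<phi> w"
proof -
  have "surj (flat x)"
    by (rule linear_inj_imp_surj[OF lin_familyD(1)[OF flat_family x] flat_inj[OF x]])
  then obtain z where z: "flat x z = (\<Sum>i\<in>Basis. \<phi> i *\<^sub>R i)" by (metis surjD)
  have "G x z w = \<phi> w" for w
    unfolding flat_inner[OF x, symmetric] z inner_sum_left using linear_eq_sum_Basis[OF \<phi>, of w]
    by (simp add: inner_commute mult.commute)
  then show ?thesis by blast
qed

end

section \<open>Christoffel symbols and the Jacobi operator in one chart\<close>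

locale metric_chart = inner_family S G
  for S :: "'e::euclidean_space set" and G :: "'e \<Rightarrow> 'e \<Rightarrow> 'e \<Rightarrow> real"
begin

abbreviation D1 :: "'e \<Rightarrow> 'e \<Rightarrow> 'e \<Rightarrow> 'e \<Rightarrow> real" where
  "D1 x a b v \<equiv> fd (\<lambda>y. G y a b) x v"

abbreviation D2 :: "'e \<Rightarrow> 'e \<Rightarrow> 'e \<Rightarrow> 'e \<Rightarrow> 'e \<Rightarrow> real" where
  "D2 x a b u v \<equiv> fd (\<lambda>y. fd (\<lambda>z. G z a b) y v) x u"

text \<open>\<open>christoffel\<close> freed from atlas and chart, so that the calculus below speaks
  only of the coefficient functions \<open>G\<close>.\<close>

definition \<Gamma> :: "'e \<Rightarrow> 'e \<Rightarrow> 'e \<Rightarrow> 'e" where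
  "\<Gamma> x a b = (THE z. \<forall>w. 2 * G x z w = D1 x b w a + D1 x a w b - D1 x a b w)"

lemmas D1_fam = bil_family_fd_dir[OF G_fam(1) open_S] bil_family_fd_dir[OF G_fam(2) open_S]
lemmas D1_lin = lin_familyD(1)[OF bil_familyD(2)[OF D1_fam(1)]] lin_familyD(1)[OF bil_familyD(2)[OF D1_fam(2)]]
  lin_familyD(1)[OF lin_family_fd_dir[OF G_fam(3)]]

lemma D1_sym: "x \<in> S \<Longrightarrow> D1 x a b v = D1 x b a v"
  using fd_cong[OF open_S, of x "\<lambda>y. G y a b" "\<lambda>y. G y b a"] G_sym by metis

lemma D2_sym: "x \<in> S \<Longrightarrow> D2 x a b u v = D2 x a b v u"
  by (rule second_derivative_symmetric[OF open_S _ G_fam(3)])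

text \<open>The right-hand side is linear in \<open>w\<close>, hence represented by a vector, and
  positivity makes this vector unique; together these make the \<open>THE\<close> well
  defined.\<close>

lemma christoffel_eq:
  assumes x: "x \<in> S"
  shows "2 * G x (\<Gamma> x a b) w = D1 x b w a + D1 x a w b - D1 x a b w"
proof -
  let ?\<phi> = "\<lambda>w. (D1 x b w a + D1 x a w b - D1 x a b w) / 2"
  have "linear ?\<phi>"
    by (rule linearI) (simp_all add: linear_add[OF D1_lin(1)[OF x]] linear_scale[OF D1_lin(1)[OF x]]
        linear_add[OF D1_lin(3)[OF x]] linear_scale[OF D1_lin(3)[OF x]] field_simps)
  then obtain z where z: "\<forall>w. G x z w = ?\<phi> w" using representation[OF x] by blast
  have "\<forall>w. 2 * G x (\<Gamma> x a b) w = D1 x b w a + D1 x a w b - D1 x a b w"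
    unfolding \<Gamma>_def
  proof (rule theI[of _ z])
    show "\<forall>w. 2 * G x z w = D1 x b w a + D1 x a w b - D1 x a b w" using z by (simp only:) simp
  next
    fix z' assume z': "\<forall>w. 2 * G x z' w = D1 x b w a + D1 x a w b - D1 x a b w"
    have "G x z' w = G x z w" for w using z'[rule_format, of w] z[rule_format, of w] by simp
    then show "z' = z" by (rule G_eqI[OF x])
  qed
  then show ?thesis by blast
qed

lemma christoffel_sym: "x \<in> S \<Longrightarrow> \<Gamma> x a b = \<Gamma> x b a"
proof (rule G_eqI, assumption)
  fix w
  assume x: "x \<in> S"
  have "2 * G x (\<Gamma> x a b) w = 2 * G x (\<Gamma> x b a) w"
    unfolding christoffel_eq[OF x] using D1_sym[OF x, of a b] by simp
  then show "G x (\<Gamma> x a b) w = G x (\<Gamma> x b a) w" by simp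
qed

text \<open>After lowering the index, \<open>\<Gamma>\<close> solves a linear system with smooth
  coefficients and smooth right-hand side, so it is smooth without a formula for the inverse
  metric.\<close>

lemma christoffel_family: "bil_family S \<Gamma>"
proof -
  have fam: "lin_family S (\<lambda>x a. \<Gamma> x a b)" for b
    unfolding lin_family_def
  proof (intro conjI ballI allI linearI)
    fix x a a' and r :: real assume x: "x \<in> S"
    show "\<Gamma> x (a + a') b = \<Gamma> x a b + \<Gamma> x a' b"
    proof (rule G_eqI[OF x])
      fix w
      show "G x (\<Gamma> x (a + a') b) w = G x (\<Gamma> x a b + \<Gamma> x a' b) w"
        using christoffel_eq[OF x, of "a + a'" b w] christoffel_eq[OF x, of a b w] christoffel_eq[OF x, of a' b w]
        by (simp add: linear_add[OF G_lin(2)[OF x]] linear_add[OF D1_lin(3)[OF x]] linear_add[OF D1_lin(2)[OF x]])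
    qed
    show "\<Gamma> x (r *\<^sub>R a) b = r *\<^sub>R \<Gamma> x a b"
    proof (rule G_eqI[OF x])
      fix w
      have "2 * G x (\<Gamma> x (r *\<^sub>R a) b) w = r * (2 * G x (\<Gamma> x a b) w)"
        unfolding christoffel_eq[OF x]
        by (simp add: linear_scale[OF D1_lin(3)[OF x]] linear_scale[OF D1_lin(2)[OF x]] algebra_simps)
      then show "G x (\<Gamma> x (r *\<^sub>R a) b) w = G x (r *\<^sub>R \<Gamma> x a b) w"
        by (simp add: linear_scale[OF G_lin(2)[OF x]])
    qed
  next
    fix a
    let ?f = "\<lambda>x. \<Sum>i\<in>Basis. ((1/2) *\<^sub>R (D1 x b i a + D1 x a i b - D1 x a b i)) *\<^sub>R i"
    have "smooth_on S ?f"
      by (intro smooth_on_sum smooth_on_scaleR smooth_on_const open_S smooth_on_diff smooth_on_add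
          smooth_on_fd G_fam(3))
    moreover have "flat x (\<Gamma> x a b) = ?f x" if "x \<in> S" for x
      unfolding flat_def
    proof (intro sum.cong refl arg_cong[where f = "\<lambda>r. r *\<^sub>R _"])
      show "G x (\<Gamma> x a b) i = (1/2) *\<^sub>R (D1 x b i a + D1 x a i b - D1 x a b i)" for i
        using christoffel_eq[OF that, of a b i] by simp
    qed
    ultimately show "smooth_on S (\<lambda>x. \<Gamma> x a b)"
      using linear_solution_smooth[OF flat_family open_S flat_inj, of ?f "\<lambda>x. \<Gamma> x a b"] by simp
  qed
  have "lin_family S (\<lambda>x. \<Gamma> x a)" for a
  proof -
    have "linear (\<Gamma> x a)" if "x \<in> S" for x
    proof -
      have "\<Gamma> x a = (\<lambda>b. \<Gamma> x b a)" using christoffel_sym[OF that] by blast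
      then show ?thesis using lin_familyD(1)[OF fam that] by simp
    qed
    then show ?thesis using lin_familyD(2)[OF fam] unfolding lin_family_def by blast
  qed
  then show ?thesis using fam unfolding bil_family_def by blast
qed

lemmas \<Gamma>_lin = lin_familyD(1)[OF bil_familyD(1)[OF christoffel_family]]
  lin_familyD(1)[OF bil_familyD(2)[OF christoffel_family]]

text \<open>The defining equation of \<open>\<Gamma>\<close> differentiated along \<open>u\<close>;
  it trades derivatives of Christoffel symbols for second derivatives of the metric.\<close>

lemma christoffel_derivative:
  assumes x: "x \<in> S"
  shows "2 * G x (fd (\<lambda>y. \<Gamma> y a b) x u) w + 2 * D1 x (\<Gamma> x a b) w u
    = D2 x b w u a + D2 x a w u b - D2 x a b u w"
proof -
  have 1: "((\<lambda>y. G y (\<Gamma> y a b) w) has_derivative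
      (\<lambda>h. D1 x (\<Gamma> x a b) w h + G x (fd (\<lambda>y. \<Gamma> y a b) x h) w + G x (\<Gamma> x a b) 0)) (at x)"
    by (rule bil_family_has_derivative[OF G open_S has_derivative_ident x
          smooth_on_has_derivative[OF bil_familyD(3)[OF christoffel_family] x] has_derivative_const])
  have 2: "((\<lambda>y. D1 y p q v) has_derivative (\<lambda>h. D2 x p q h v)) (at x)" for p q v
    by (rule smooth_on_has_derivative[OF smooth_on_fd[OF G_fam(3)] x])
  have "((\<lambda>y. 2 * G y (\<Gamma> y a b) w - (D1 y b w a + D1 y a w b - D1 y a b w)) has_derivative
      (\<lambda>h. 2 * (D1 x (\<Gamma> x a b) w h + G x (fd (\<lambda>y. \<Gamma> y a b) x h) w + G x (\<Gamma> x a b) 0)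
        - (D2 x b w h a + D2 x a w h b - D2 x a b h w))) (at x)"
    by (intro has_derivative_diff has_derivative_add has_derivative_mult_right 1 2)
  from has_derivative_zero_fun[OF open_S x _ this, of u] show ?thesis
    by (simp add: christoffel_eq linear_0[OF G_lin(1)[OF x]])
qed

text \<open>\<open>x1\<close> and \<open>x2\<close> stand for velocity and acceleration,
  \<open>\<xi>\<close>, \<open>\<xi>1\<close>, \<open>\<xi>2\<close> for a variation and its time
  derivatives, and \<open>\<eta>\<close> for a test vector.\<close>

definition jacobi_form :: "'e \<Rightarrow> 'e \<Rightarrow> 'e \<Rightarrow> 'e \<Rightarrow> 'e \<Rightarrow> 'e \<Rightarrow> 'e \<Rightarrow> real" where
  "jacobi_form x x1 x2 \<xi> \<xi>1 \<xi>2 \<eta> = G x \<xi>2 \<eta> + D1 x \<xi>1 \<eta> x1 + D1 x x1 \<eta> \<xi>1 + D1 x x2 \<eta> \<xi>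
     + D2 x x1 \<eta> x1 \<xi> - D1 x x1 \<xi>1 \<eta> - D2 x x1 x1 \<xi> \<eta> / 2"

text \<open>Pairing with a test vector replaces \<open>\<Gamma>\<close> by first derivatives of
  \<open>G\<close>, the only data that the Killing equation can be combined with.\<close>

lemma geodesic_euler_lagrange:
  assumes x: "x \<in> S" and geo: "x2 + \<Gamma> x x1 x1 = 0"
  shows "G x x2 \<eta> + D1 x x1 \<eta> x1 - D1 x x1 x1 \<eta> / 2 = 0"
proof -
  have "x2 = (- 1) *\<^sub>R \<Gamma> x x1 x1" using geo by (simp add: add_eq_0_iff2)
  then have "G x x2 \<eta> = (- 1) *\<^sub>R G x (\<Gamma> x x1 x1) \<eta>" using linear_scale[OF G_lin(2)[OF x]] by metis
  then show ?thesis using christoffel_eq[OF x, of x1 x1 \<eta>] by simp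
qed

text \<open>The left-hand side is the Jacobi operator as it reads in a chart; along a geodesic it is the
  linearisation of the geodesic equation, and \<open>jacobi_form\<close> that of the Euler-Lagrange equation.\<close>

lemma jacobi_operator_eq:
  assumes x: "x \<in> S" and geo: "x2 + \<Gamma> x x1 x1 = 0"
  shows "G x (\<xi>2 + (fd (\<lambda>y. \<Gamma> y x1 \<xi>) x x1 + \<Gamma> x x2 \<xi> + \<Gamma> x x1 \<xi>1) + \<Gamma> x x1 (\<xi>1 + \<Gamma> x x1 \<xi>)
     + (fd (\<lambda>y. \<Gamma> y x1 x1) x \<xi> - fd (\<lambda>y. \<Gamma> y \<xi> x1) x x1
        + \<Gamma> x \<xi> (\<Gamma> x x1 x1) - \<Gamma> x x1 (\<Gamma> x \<xi> x1))) \<eta>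
    = jacobi_form x x1 x2 \<xi> \<xi>1 \<xi>2 \<eta>" (is "G x ?J \<eta> = _")
proof -
  have x2: "x2 = (- 1) *\<^sub>R \<Gamma> x x1 x1" using geo by (simp add: add_eq_0_iff2)
  have "fd (\<lambda>y. \<Gamma> y x1 \<xi>) x = fd (\<lambda>y. \<Gamma> y \<xi> x1) x"
    by (rule fd_cong[OF open_S x]) (rule christoffel_sym)
  moreover have "\<Gamma> x x2 \<xi> = - \<Gamma> x \<xi> (\<Gamma> x x1 x1)"
    unfolding christoffel_sym[OF x, of \<xi>] x2 linear_scale[OF \<Gamma>_lin(2)[OF x]] by simp
  \<comment> \<open>The terms quadratic in \<open>\<Gamma>\<close> have cancelled, and what remains
    is the linearised geodesic equation.\<close>
  ultimately have "?J = \<xi>2 + 2 *\<^sub>R \<Gamma> x x1 \<xi>1 + fd (\<lambda>y. \<Gamma> y x1 x1) x \<xi>"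
    by (simp add: linear_add[OF \<Gamma>_lin(1)[OF x]] christoffel_sym[OF x, of \<xi> x1] scaleR_2)
  then have "G x ?J \<eta> = G x \<xi>2 \<eta> + 2 * G x (\<Gamma> x x1 \<xi>1) \<eta> + G x (fd (\<lambda>y. \<Gamma> y x1 x1) x \<xi>) \<eta>"
    by (simp only: linear_add[OF G_lin(2)[OF x]] linear_scale[OF G_lin(2)[OF x]] real_scaleR_def)
  moreover have "D1 x x2 \<eta> \<xi> = - D1 x (\<Gamma> x x1 x1) \<eta> \<xi>"
    unfolding x2 linear_scale[OF D1_lin(2)[OF x]] by simp
  ultimately show ?thesis
    using christoffel_derivative[OF x, of x1 x1 \<xi> \<eta>] christoffel_eq[OF x, of x1 \<xi>1 \<eta>]
      D2_sym[OF x, of x1 \<eta> \<xi> x1]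
    by (simp add: jacobi_form_def)
qed

end

text \<open>A whole frame of Killing fields: \<open>X x a\<close> is the value at \<open>x\<close>
  of the field with label \<open>a\<close>. On the group the label is a Lie algebra element read in
  a chart at \<open>e\<close>.\<close>

locale killing_chart = metric_chart S G
  for S :: "'e::euclidean_space set" and G :: "'e \<Rightarrow> 'e \<Rightarrow> 'e \<Rightarrow> real" +
  fixes X :: "'e \<Rightarrow> 'e \<Rightarrow> 'e"
  assumes X: "lin_family S X" and X_inj: "x \<in> S \<Longrightarrow> inj (X x)"
    and killing: "x \<in> S \<Longrightarrow> D1 x p q (X x a) + G x (fd (\<lambda>y. X y a) x p) q + G x p (fd (\<lambda>y. X y a) x q) = 0"
begin

abbreviation DX :: "'e \<Rightarrow> 'e \<Rightarrow> 'e \<Rightarrow> 'e" where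
  "DX x a v \<equiv> fd (\<lambda>y. X y a) x v"

abbreviation D2X :: "'e \<Rightarrow> 'e \<Rightarrow> 'e \<Rightarrow> 'e \<Rightarrow> 'e" where
  "D2X x a u v \<equiv> fd (\<lambda>y. fd (\<lambda>z. X z a) y v) x u"

lemmas X_smooth = lin_familyD(2)[OF X]
lemmas DX_fam = bil_family_fd_dir[OF X open_S]
lemmas X_lin = lin_familyD(1)[OF X]
lemmas DX_lin = lin_familyD(1)[OF bil_familyD(1)[OF DX_fam]] lin_familyD(1)[OF bil_familyD(2)[OF DX_fam]]

lemma D2X_sym: "x \<in> S \<Longrightarrow> D2X x a u v = D2X x a v u"
  by (rule second_derivative_symmetric[OF open_S _ X_smooth])

text \<open>The Killing equation holds at every point of \<open>S\<close> and may be differentiated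
  along \<open>u\<close>; this controls the second derivatives of \<open>X\<close> that occur in the
  Jacobi equation.\<close>

lemma killing_derivative:
  assumes x: "x \<in> S"
  shows "D2 x p q u (X x a) + D1 x p q (DX x a u)
    + (D1 x (DX x a p) q u + G x (D2X x a u p) q) + (D1 x p (DX x a q) u + G x p (D2X x a u q)) = 0"
proof -
  have Xd: "((\<lambda>y. X y a) has_derivative DX x a) (at x)" by (rule smooth_on_has_derivative[OF X_smooth x])
  have DXd: "((\<lambda>y. DX y a v) has_derivative (\<lambda>h. D2X x a h v)) (at x)" for v
    by (rule smooth_on_has_derivative[OF smooth_on_fd[OF X_smooth] x])
  have 1: "((\<lambda>y. D1 y p q (X y a)) has_derivative (\<lambda>h. D2 x p q h (X x a) + D1 x p q (DX x a h))) (at x)"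
    by (rule lin_family_has_derivative[OF lin_family_fd_dir[OF G_fam(3)] open_S has_derivative_ident x Xd])
  have 2: "((\<lambda>y. G y (DX y a p) q) has_derivative (\<lambda>h. D1 x (DX x a p) q h + G x (D2X x a h p) q)) (at x)"
    by (rule lin_family_has_derivative[OF G_fam(2) open_S has_derivative_ident x DXd])
  have 3: "((\<lambda>y. G y p (DX y a q)) has_derivative (\<lambda>h. D1 x p (DX x a q) h + G x p (D2X x a h q))) (at x)"
    by (rule lin_family_has_derivative[OF G_fam(1) open_S has_derivative_ident x DXd])
  show ?thesis
    by (rule has_derivative_zero_fun[OF open_S x _ has_derivative_add[OF has_derivative_add[OF 1 2] 3], of u])
      (rule killing)
qed

text \<open>For constant \<open>w\<close> the field is Killing, hence Jacobi, so no term in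
  \<open>w\<close> itself survives. The first four summands on the right form the time derivative of
  \<open>G x (X x w1) (X x b)\<close>; the bracketed rest is the pairing of the velocity with a
  bracket of fields.\<close>

lemma jacobi_form_killing_combination:
  assumes x: "x \<in> S" and geo: "x2 + \<Gamma> x x1 x1 = 0"
  shows "jacobi_form x x1 x2 (X x w) (DX x w x1 + X x w1) (D2X x w x1 x1 + 2 *\<^sub>R DX x w1 x1 + DX x w x2 + X x w2) (X x b)
    = G x (X x w2) (X x b) + D1 x (X x w1) (X x b) x1 + G x (DX x w1 x1) (X x b) + G x (X x w1) (DX x b x1)
      + (G x x1 (DX x b (X x w1)) - G x x1 (DX x w1 (X x b)))"
proof -
  let ?\<eta> = "X x b" and ?\<xi> = "X x w"
  \<comment> \<open>\<open>K1\<close>, \<open>K2\<close>, \<open>EL\<close> and \<open>K3\<close>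
    remove the terms in \<open>w\<close>; \<open>K4\<close> and \<open>K5\<close> rearrange those in
    \<open>w1\<close>.\<close>
  note K1 = killing[OF x, of x2 ?\<eta> w]
  note K2 = killing_derivative[OF x, of x1 ?\<eta> w x1]
  note EL = geodesic_euler_lagrange[OF x geo, of "DX x w ?\<eta>"]
  note K3 = killing_derivative[OF x, of x1 x1 w ?\<eta>]
  note K4 = killing[OF x, of x1 ?\<eta> w1]
  note K5 = killing[OF x, of x1 "X x w1" b]
  have s: "D2 x x1 x1 ?\<eta> ?\<xi> = D2 x x1 x1 ?\<xi> ?\<eta>" "D2X x w ?\<eta> x1 = D2X x w x1 ?\<eta>"
    "D1 x (DX x w x1) x1 ?\<eta> = D1 x x1 (DX x w x1) ?\<eta>" "G x (D2X x w x1 ?\<eta>) x1 = G x x1 (D2X x w x1 ?\<eta>)"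
    "G x (DX x b x1) (X x w1) = G x (X x w1) (DX x b x1)"
    by (rule D2_sym[OF x] D2X_sym[OF x] D1_sym[OF x] G_sym[OF x])+
  show ?thesis
    unfolding jacobi_form_def linear_add[OF G_lin(2)[OF x]] linear_scale[OF G_lin(2)[OF x]]
      linear_add[OF D1_lin(1)[OF x]] linear_add[OF D1_lin(2)[OF x]] linear_add[OF D1_lin(3)[OF x]]
    using K1 K2 EL K3 K4 K5 unfolding s by simp
qed

text \<open>In coordinates, the metric pairing of the velocity with the bracket of the fields
  labelled \<open>a\<close> and \<open>b\<close>.\<close>

definition twist :: "'e \<Rightarrow> 'e \<Rightarrow> 'e \<Rightarrow> 'e \<Rightarrow> real" where
  "twist x x1 a b = G x x1 (DX x b (X x a)) - G x x1 (DX x a (X x b))"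

context
  fixes x :: "real \<Rightarrow> 'e" and x1 :: "real \<Rightarrow> 'e" and x2 :: 'e and t :: real
  assumes xt: "x t \<in> S" and x: "(x has_vector_derivative x1 t) (at t)" and x1: "(x1 has_vector_derivative x2) (at t)"
    and geo: "x2 + \<Gamma> (x t) (x1 t) (x1 t) = 0"
begin

text \<open>An instance of Noether's principle: brackets of Killing fields are Killing, and their
  pairing with a geodesic velocity is conserved. It is verified directly: the derivative
  \<open>?F\<close> of either half of \<open>twist\<close> is symmetric in \<open>a\<close> and
  \<open>b\<close>.\<close>

lemma twist_constant: "((\<lambda>t. twist (x t) (x1 t) a b) has_real_derivative 0) (at t)"
proof -
  let ?F = "\<lambda>a b. D1 (x t) (x1 t) (DX (x t) a (X (x t) b)) (x1 t) + G (x t) x2 (DX (x t) a (X (x t) b))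
      + G (x t) (x1 t) (D2X (x t) a (x1 t) (X (x t) b) + DX (x t) a (DX (x t) b (x1 t) + X (x t) 0))"
  have d: "((\<lambda>t. G (x t) (x1 t) (DX (x t) a (X (x t) b))) has_vector_derivative ?F a b) (at t)" for a b
    by (rule bil_family_has_vector_derivative[OF G open_S x xt x1],
        rule lin_family_has_vector_derivative[OF bil_familyD(1)[OF DX_fam] open_S x xt],
        rule lin_family_has_vector_derivative[OF X open_S x xt has_vector_derivative_const])
  have F: "?F a b = G (x t) (x1 t) (DX (x t) a (DX (x t) b (x1 t)))
      + G (x t) (x1 t) (DX (x t) b (DX (x t) a (x1 t)))
      + G (x t) (DX (x t) a (x1 t)) (DX (x t) b (x1 t)) - D2 (x t) (x1 t) (x1 t) (X (x t) b) (X (x t) a) / 2" for a b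
  proof -
    note EL = geodesic_euler_lagrange[OF xt geo, of "DX (x t) a (X (x t) b)"]
    note K3 = killing_derivative[OF xt, of "x1 t" "x1 t" a "X (x t) b"]
    note K = killing[OF xt, of "DX (x t) a (x1 t)" "x1 t" b]
    have s: "D2X (x t) a (X (x t) b) (x1 t) = D2X (x t) a (x1 t) (X (x t) b)"
      "G (x t) (D2X (x t) a (x1 t) (X (x t) b)) (x1 t) = G (x t) (x1 t) (D2X (x t) a (x1 t) (X (x t) b))"
      "D1 (x t) (x1 t) (DX (x t) a (x1 t)) (X (x t) b) = D1 (x t) (DX (x t) a (x1 t)) (x1 t) (X (x t) b)"
      "G (x t) (DX (x t) b (DX (x t) a (x1 t))) (x1 t) = G (x t) (x1 t) (DX (x t) b (DX (x t) a (x1 t)))"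
      by (rule D2X_sym[OF xt] D1_sym[OF xt] G_sym[OF xt])+
    show ?thesis
      using EL K3 K unfolding s linear_add[OF G_lin(1)[OF xt]] linear_0[OF X_lin[OF xt]] by simp
  qed
  have "?F b a - ?F a b = 0"
    unfolding F using D2_sym[OF xt, of "x1 t" "x1 t" "X (x t) a" "X (x t) b"]
      G_sym[OF xt, of "DX (x t) a (x1 t)"] by simp
  then show ?thesis
    using has_vector_derivative_diff[OF d[of b a] d[of a b]]
    by (simp add: twist_def has_real_derivative_iff_has_vector_derivative)
qed

lemma killing_combination_derivative:
  assumes "(w has_vector_derivative w1) (at t)"
  shows "((\<lambda>t. X (x t) (w t)) has_vector_derivative DX (x t) (w t) (x1 t) + X (x t) w1) (at t)"
  by (rule lin_family_has_vector_derivative[OF X open_S x xt assms])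

lemma killing_combination_derivative2:
  assumes w: "(w has_vector_derivative w1 t) (at t)" and w1: "(w1 has_vector_derivative w2) (at t)"
  shows "((\<lambda>t. DX (x t) (w t) (x1 t) + X (x t) (w1 t)) has_vector_derivative
    D2X (x t) (w t) (x1 t) (x1 t) + 2 *\<^sub>R DX (x t) (w1 t) (x1 t) + DX (x t) (w t) x2 + X (x t) w2) (at t)"
proof -
  have "((\<lambda>t. DX (x t) (w t) (x1 t)) has_vector_derivative
      (D2X (x t) (w t) (x1 t) (x1 t) + DX (x t) (w1 t) (x1 t) + DX (x t) (w t) x2)) (at t)"
    by (rule bil_family_has_vector_derivative[OF DX_fam open_S x xt w x1])
  from has_vector_derivative_add[OF this killing_combination_derivative[OF w1]]
  show ?thesis by (simp add: scaleR_2 add_ac)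
qed

text \<open>Testing with the fields \<open>X b\<close> is enough because the frame spans; each test
  value is the derivative of the pairing of \<open>X w1\<close> with \<open>X b\<close>, plus
  \<open>twist\<close>.\<close>

lemma jacobi_killing_combination_iff:
  assumes w1: "(w1 has_vector_derivative w2) (at t)"
  shows "(\<forall>\<eta>. jacobi_form (x t) (x1 t) x2 (X (x t) (w t)) (DX (x t) (w t) (x1 t) + X (x t) (w1 t))
      (D2X (x t) (w t) (x1 t) (x1 t) + 2 *\<^sub>R DX (x t) (w1 t) (x1 t) + DX (x t) (w t) x2 + X (x t) w2) \<eta> = 0)
    \<longleftrightarrow> (\<forall>b. ((\<lambda>t. G (x t) (X (x t) (w1 t)) (X (x t) b)) has_real_derivative - twist (x t) (x1 t) (w1 t) b) (at t))"
    (is "(\<forall>\<eta>. ?E \<eta> = 0) \<longleftrightarrow> (\<forall>b. (?L b has_real_derivative _) (at t))")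
proof -
  have "surj (X (x t))" by (rule linear_inj_imp_surj[OF X_lin[OF xt] X_inj[OF xt]])
  then have *: "\<exists>b. \<eta> = X (x t) b" for \<eta> by (rule surjD)
  have E: "(\<forall>\<eta>. ?E \<eta> = 0) \<longleftrightarrow> (\<forall>b. ?E (X (x t) b) = 0)"
  proof (intro iffI allI)
    fix \<eta> assume all: "\<forall>b. ?E (X (x t) b) = 0"
    obtain b where "\<eta> = X (x t) b" using * by blast
    then show "?E \<eta> = 0" using all by simp
  qed blast
  have L: "(?L b has_real_derivative ?E (X (x t) b) - twist (x t) (x1 t) (w1 t) b) (at t)" for b
  proof -
    have "(?L b has_vector_derivative (D1 (x t) (X (x t) (w1 t)) (X (x t) b) (x1 t)
        + G (x t) (DX (x t) (w1 t) (x1 t) + X (x t) w2) (X (x t) b)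
        + G (x t) (X (x t) (w1 t)) (DX (x t) b (x1 t) + X (x t) 0))) (at t)"
      by (rule bil_family_has_vector_derivative[OF G open_S x xt killing_combination_derivative[OF w1]
            killing_combination_derivative[OF has_vector_derivative_const]])
    moreover have "D1 (x t) (X (x t) (w1 t)) (X (x t) b) (x1 t)
        + G (x t) (DX (x t) (w1 t) (x1 t) + X (x t) w2) (X (x t) b)
        + G (x t) (X (x t) (w1 t)) (DX (x t) b (x1 t) + X (x t) 0) = ?E (X (x t) b) - twist (x t) (x1 t) (w1 t) b"
      unfolding jacobi_form_killing_combination[OF xt geo] twist_def
        linear_add[OF G_lin(2)[OF xt]] linear_0[OF X_lin[OF xt]] by simp
    ultimately show ?thesis by (simp only: has_real_derivative_iff_has_vector_derivative)
  qed
  have "(?L b has_real_derivative - twist (x t) (x1 t) (w1 t) b) (at t) \<longleftrightarrow> ?E (X (x t) b) = 0" for b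
  proof
    assume "(?L b has_real_derivative - twist (x t) (x1 t) (w1 t) b) (at t)"
    from DERIV_unique[OF L this] show "?E (X (x t) b) = 0" by simp
  next
    assume "?E (X (x t) b) = 0"
    with L[of b] show "(?L b has_real_derivative - twist (x t) (x1 t) (w1 t) b) (at t)" by simp
  qed
  then show ?thesis unfolding E by simp
qed

end

end

section \<open>Manifolds and tangent maps\<close>

locale smooth_manifold =
  fixes A :: "('m::topological_space, 'e::euclidean_space) chart set"
  assumes atlas: "smooth_atlas A"
begin

abbreviation img :: "('m, 'e) chart \<Rightarrow> 'e set" where
  "img c \<equiv> snd c ` fst c"

lemma charts_atD: "c \<in> charts_at A p \<Longrightarrow> c \<in> A" "c \<in> charts_at A p \<Longrightarrow> p \<in> fst c"
  by (auto simp: charts_at_def)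

lemma charts_at_ex: "\<exists>c. c \<in> charts_at A p"
  using atlas unfolding smooth_atlas_def by blast

lemma
  assumes "c \<in> A"
  shows chart_open: "open (fst c)" and img_open: "open (img c)"
    and chart_homeo: "homeomorphism (fst c) (img c) (snd c) (chart_inv c)"
  using atlas assms unfolding smooth_atlas_def by blast+

lemma chart_inv_left: "c \<in> A \<Longrightarrow> p \<in> fst c \<Longrightarrow> chart_inv c (snd c p) = p"
  by (rule homeomorphism_apply1[OF chart_homeo])

lemma chart_inv_right: "c \<in> A \<Longrightarrow> x \<in> img c \<Longrightarrow> snd c (chart_inv c x) = x"
  by (rule homeomorphism_apply2[OF chart_homeo])

lemma chart_inv_in: "c \<in> A \<Longrightarrow> x \<in> img c \<Longrightarrow> chart_inv c x \<in> fst c"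
  using chart_inv_left[of c] by auto

lemma chart_inv_at: "c \<in> A \<Longrightarrow> x \<in> img c \<Longrightarrow> c \<in> charts_at A (chart_inv c x)"
  using chart_inv_in by (auto simp: charts_at_def)

text \<open>Written as a preimage under the inverse chart, so that openness follows from the
  continuity of \<open>chart_inv\<close>.\<close>

definition dom :: "('m, 'e) chart \<Rightarrow> 'm set \<Rightarrow> 'e set" where
  "dom c U = img c \<inter> chart_inv c -` U"

lemma dom_open: "c \<in> A \<Longrightarrow> open U \<Longrightarrow> open (dom c U)"
  unfolding dom_def
  by (rule continuous_open_preimage[OF homeomorphism_cont2[OF chart_homeo] img_open])

lemma image_eq_dom: "c \<in> A \<Longrightarrow> snd c ` (fst c \<inter> U) = dom c U"
  using chart_inv_left[of c] unfolding dom_def by (auto simp: image_iff)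

lemma in_dom: "c \<in> A \<Longrightarrow> p \<in> fst c \<Longrightarrow> p \<in> U \<Longrightarrow> snd c p \<in> dom c U"
  by (auto simp: dom_def chart_inv_left)

lemma transition_smooth:
  "c \<in> A \<Longrightarrow> d \<in> A \<Longrightarrow> smooth_on (dom c (fst d)) (snd d \<circ> chart_inv c)"
  using atlas unfolding smooth_atlas_def image_eq_dom[symmetric] by blast

text \<open>Differentiable local representatives are what the chain rule for
  \<open>tangent_map\<close> asks for. They are quickly checked for translations, which are slices
  of the multiplication.\<close>

definition mdiff :: "('m \<Rightarrow> 'm) \<Rightarrow> bool" where
  "mdiff f \<longleftrightarrow> continuous_on UNIV f \<and>
    (\<forall>p. \<forall>c\<in>charts_at A p. \<forall>d\<in>charts_at A (f p). (snd d \<circ> f \<circ> chart_inv c) differentiable at (snd c p))"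

text \<open>Turns coordinate changes into representatives of the identity map, so that their
  composition rule is an instance of the chain rule.\<close>

lemma mdiff_ident: "mdiff (\<lambda>x. x)"
  unfolding mdiff_def
proof (intro conjI allI ballI continuous_on_id)
  fix p c d assume cd: "c \<in> charts_at A p" "d \<in> charts_at A p"
  have "(snd d \<circ> chart_inv c) differentiable at (snd c p)"
    by (rule smooth_on_differentiable[OF transition_smooth]) (use cd in \<open>auto simp: charts_at_def intro: in_dom\<close>)
  then show "(snd d \<circ> (\<lambda>x. x) \<circ> chart_inv c) differentiable at (snd c p)" by (simp add: comp_def)
qed

lemma local_rep_compose:
  assumes f: "mdiff f" and g: "mdiff g" and c: "c \<in> charts_at A p" and c': "c' \<in> charts_at A (f p)"
    and d: "d \<in> charts_at A (g (f p))"
  shows "((snd d \<circ> (\<lambda>x. g (f x)) \<circ> chart_inv c) has_derivative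
    (\<lambda>v. fd (snd d \<circ> g \<circ> chart_inv c') (snd c' (f p)) (fd (snd c' \<circ> f \<circ> chart_inv c) (snd c p) v))) (at (snd c p))"
proof -
  \<comment> \<open>Factoring through \<open>c'\<close> is valid only where \<open>f\<close> lands
    in \<open>fst c'\<close>, which is an open set around the point.\<close>
  let ?U = "dom c (f -` fst c')"
  have "open (f -` fst c')"
    using f chart_open[OF charts_atD(1)[OF c']] unfolding mdiff_def
    by (metis continuous_on_open_vimage open_UNIV Int_UNIV_right)
  then have U: "open ?U" by (rule dom_open[OF charts_atD(1)[OF c]])
  have x: "snd c p \<in> ?U" using c c' by (auto simp: charts_at_def intro: in_dom)
  have cp: "chart_inv c (snd c p) = p" using c by (auto simp: charts_at_def chart_inv_left)
  have 1: "((snd c' \<circ> f \<circ> chart_inv c) has_derivative fd (snd c' \<circ> f \<circ> chart_inv c) (snd c p)) (at (snd c p))"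
    using f c c' unfolding mdiff_def by (intro fd_has_derivative) blast
  have 2: "((snd d \<circ> g \<circ> chart_inv c') has_derivative fd (snd d \<circ> g \<circ> chart_inv c') (snd c' (f p)))
      (at ((snd c' \<circ> f \<circ> chart_inv c) (snd c p)))"
    using g c' d cp unfolding mdiff_def by (auto intro!: fd_has_derivative)
  have "(((snd d \<circ> g \<circ> chart_inv c') \<circ> (snd c' \<circ> f \<circ> chart_inv c)) has_derivative
    (\<lambda>v. fd (snd d \<circ> g \<circ> chart_inv c') (snd c' (f p)) (fd (snd c' \<circ> f \<circ> chart_inv c) (snd c p) v))) (at (snd c p))"
    using diff_chain_at[OF 1 2] by (simp add: comp_def)
  then show ?thesis
    by (rule has_derivative_transform_within_open[OF _ U x])
      (use c' in \<open>auto simp: dom_def chart_inv_left charts_at_def\<close>)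
qed

lemma mdiff_compose:
  assumes f: "mdiff f" and g: "mdiff g"
  shows "mdiff (\<lambda>x. g (f x))"
  unfolding mdiff_def
proof (intro conjI allI ballI)
  show "continuous_on UNIV (\<lambda>x. g (f x))"
    using f g unfolding mdiff_def by (auto intro: continuous_on_compose2)
  fix p c d assume cd: "c \<in> charts_at A p" "d \<in> charts_at A (g (f p))"
  obtain c' where "c' \<in> charts_at A (f p)" using charts_at_ex by blast
  from local_rep_compose[OF f g cd(1) this cd(2)]
  show "(snd d \<circ> (\<lambda>x. g (f x)) \<circ> chart_inv c) differentiable at (snd c p)"
    unfolding differentiable_def by blast
qed

lemma fd_local_rep_compose:
  assumes "mdiff f" "mdiff g" "c \<in> charts_at A p" "c' \<in> charts_at A (f p)" "d \<in> charts_at A (g (f p))"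
  shows "fd (snd d \<circ> (\<lambda>x. g (f x)) \<circ> chart_inv c) (snd c p) v =
    fd (snd d \<circ> g \<circ> chart_inv c') (snd c' (f p)) (fd (snd c' \<circ> f \<circ> chart_inv c) (snd c p) v)"
  by (rule fun_cong[OF fd_eqI[OF local_rep_compose[OF assms]]])

lemma comp_ident: "snd d \<circ> (\<lambda>x. x) \<circ> chart_inv c = snd d \<circ> chart_inv c"
  by (simp add: comp_def)

lemma transition_linear:
  assumes "c \<in> charts_at A p" "d \<in> charts_at A p"
  shows "linear (fd (snd d \<circ> chart_inv c) (snd c p))"
  using mdiff_ident assms unfolding mdiff_def comp_ident by (intro fd_linear) blast

lemma fd_transition_trans:
  assumes "c \<in> charts_at A p" "c' \<in> charts_at A p" "d \<in> charts_at A p"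
  shows "fd (snd d \<circ> chart_inv c) (snd c p) v =
    fd (snd d \<circ> chart_inv c') (snd c' p) (fd (snd c' \<circ> chart_inv c) (snd c p) v)"
  using fd_local_rep_compose[OF mdiff_ident mdiff_ident assms] unfolding comp_ident .

lemma tangent_spaceD:
  assumes "v \<in> tangent_space A p" "c \<in> charts_at A p" "d \<in> charts_at A p"
  shows "v d = fd (snd d \<circ> chart_inv c) (snd c p) (v c)"
  using assms unfolding tangent_space_def by blast

lemma tangent_space_outside: "v \<in> tangent_space A p \<Longrightarrow> c \<notin> charts_at A p \<Longrightarrow> v c = 0"
  unfolding tangent_space_def by blast

lemma tangent_space_eqI:
  assumes "v \<in> tangent_space A p" "w \<in> tangent_space A p" "c \<in> charts_at A p" "v c = w c"
  shows "v = w"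
proof
  fix d
  show "v d = w d"
    by (cases "d \<in> charts_at A p")
      (use assms tangent_spaceD[of v p c d] tangent_spaceD[of w p c d]
        tangent_space_outside[of v p d] tangent_space_outside[of w p d] in auto)
qed

lemma coord_vec_in: "c \<in> charts_at A p \<Longrightarrow> coord_vec A c p a \<in> tangent_space A p"
  unfolding tangent_space_def
proof (intro CollectI conjI ballI allI impI)
  fix d d' assume c: "c \<in> charts_at A p" and d: "d \<in> charts_at A p" "d' \<in> charts_at A p"
  show "coord_vec A c p a d' = fd (snd d' \<circ> chart_inv d) (snd d p) (coord_vec A c p a d)"
    using d fd_transition_trans[OF c d] by (simp only: coord_vec_def if_True)
qed (simp add: coord_vec_def)

lemma coord_vec_self:
  assumes c: "c \<in> charts_at A p"
  shows "coord_vec A c p a c = a"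
proof -
  have "fd (snd c \<circ> chart_inv c) (snd c p) = fd (\<lambda>x. x) (snd c p)"
    by (rule fd_cong[OF img_open[OF charts_atD(1)[OF c]]])
      (use c charts_atD chart_inv_right in auto)
  then show ?thesis using c by (simp add: coord_vec_def)
qed

lemma coord_vec_component: "v \<in> tangent_space A p \<Longrightarrow> c \<in> charts_at A p \<Longrightarrow> coord_vec A c p (v c) = v"
  by (rule tangent_space_eqI[OF coord_vec_in]) (auto simp: coord_vec_self)

lemma tangent_space_subspace: "subspace (tangent_space A p)"
proof (rule subspaceI)
  show "0 \<in> tangent_space A p"
    unfolding tangent_space_def
  proof (intro CollectI conjI ballI allI impI)
    fix c d assume "c \<in> charts_at A p" "d \<in> charts_at A p"
    from linear_0[OF transition_linear[OF this]]
    show "(0 :: ('m, 'e) tvec) d = fd (snd d \<circ> chart_inv c) (snd c p) (0 c)" by simp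
  qed simp
  fix v w assume v: "v \<in> tangent_space A p"
  show "r *\<^sub>R v \<in> tangent_space A p" for r
    unfolding tangent_space_def
  proof (intro CollectI conjI ballI allI impI)
    fix c d assume cd: "c \<in> charts_at A p" "d \<in> charts_at A p"
    show "(r *\<^sub>R v) d = fd (snd d \<circ> chart_inv c) (snd c p) ((r *\<^sub>R v) c)"
      unfolding scaleR_fun_def linear_scale[OF transition_linear[OF cd]] tangent_spaceD[OF v cd] ..
  qed (simp add: scaleR_fun_def tangent_space_outside[OF v])
  assume w: "w \<in> tangent_space A p"
  show "v + w \<in> tangent_space A p"
    unfolding tangent_space_def
  proof (intro CollectI conjI ballI allI impI)
    fix c d assume cd: "c \<in> charts_at A p" "d \<in> charts_at A p"
    show "(v + w) d = fd (snd d \<circ> chart_inv c) (snd c p) ((v + w) c)"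
      unfolding plus_fun_apply linear_add[OF transition_linear[OF cd]] tangent_spaceD[OF v cd] tangent_spaceD[OF w cd] ..
  qed (simp add: tangent_space_outside[OF v] tangent_space_outside[OF w])
qed

lemma coord_vec_add: "c \<in> charts_at A p \<Longrightarrow> coord_vec A c p (a + b) = coord_vec A c p a + coord_vec A c p b"
  by (rule tangent_space_eqI[OF coord_vec_in subspace_add[OF tangent_space_subspace coord_vec_in coord_vec_in]])
    (auto simp: coord_vec_self)

lemma coord_vec_scale: "c \<in> charts_at A p \<Longrightarrow> coord_vec A c p (r *\<^sub>R a) = r *\<^sub>R coord_vec A c p a"
  by (rule tangent_space_eqI[OF coord_vec_in subspace_scale[OF tangent_space_subspace coord_vec_in]])
    (auto simp: coord_vec_self scaleR_fun_def)

text \<open>\<open>tangent_map\<close> picks a chart by \<open>SOME\<close>; the transformation law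
  of \<open>v\<close> and the chain rule through the identity show that every chart gives the same
  value.\<close>

lemma tangent_map_eq:
  assumes f: "mdiff f" and v: "v \<in> tangent_space A p" and c: "c \<in> charts_at A p" and d: "d \<in> charts_at A (f p)"
  shows "tangent_map A A f p v d = fd (snd d \<circ> f \<circ> chart_inv c) (snd c p) (v c)"
proof -
  define c' where "c' = (SOME c. c \<in> charts_at A p)"
  have c': "c' \<in> charts_at A p" unfolding c'_def by (rule someI_ex[OF charts_at_ex])
  have "tangent_map A A f p v d = fd (snd d \<circ> f \<circ> chart_inv c') (snd c' p) (v c')"
    using d by (simp add: tangent_map_def Let_def c'_def)
  also have "v c' = fd (snd c' \<circ> chart_inv c) (snd c p) (v c)" by (rule tangent_spaceD[OF v c c'])
  finally show ?thesis unfolding fd_local_rep_compose[OF mdiff_ident f c c' d, unfolded comp_ident] .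
qed

lemma tangent_map_in:
  assumes f: "mdiff f" and v: "v \<in> tangent_space A p"
  shows "tangent_map A A f p v \<in> tangent_space A (f p)"
proof -
  obtain c where c: "c \<in> charts_at A p" using charts_at_ex by blast
  show ?thesis
    unfolding tangent_space_def
  proof (intro CollectI conjI ballI allI impI)
    fix d d' assume dd: "d \<in> charts_at A (f p)" "d' \<in> charts_at A (f p)"
    show "tangent_map A A f p v d' = fd (snd d' \<circ> chart_inv d) (snd d (f p)) (tangent_map A A f p v d)"
      using fd_local_rep_compose[OF f mdiff_ident c dd]
      unfolding tangent_map_eq[OF f v c dd(1)] tangent_map_eq[OF f v c dd(2)] comp_ident .
  qed (simp add: tangent_map_def)
qed

lemma tangent_map_compose:
  assumes f: "mdiff f" and g: "mdiff g" and v: "v \<in> tangent_space A p"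
  shows "tangent_map A A (\<lambda>x. g (f x)) p v = tangent_map A A g (f p) (tangent_map A A f p v)"
proof -
  obtain c where c: "c \<in> charts_at A p" using charts_at_ex by blast
  obtain c' where c': "c' \<in> charts_at A (f p)" using charts_at_ex by blast
  obtain d where d: "d \<in> charts_at A (g (f p))" using charts_at_ex by blast
  show ?thesis
    by (rule tangent_space_eqI[OF tangent_map_in[OF mdiff_compose[OF f g] v]
          tangent_map_in[OF g tangent_map_in[OF f v]] d])
      (simp add: tangent_map_eq[OF mdiff_compose[OF f g] v c d]
        tangent_map_eq[OF g tangent_map_in[OF f v] c' d] tangent_map_eq[OF f v c c']
        fd_local_rep_compose[OF f g c c' d])
qed

lemma tangent_map_ident:
  assumes v: "v \<in> tangent_space A p"
  shows "tangent_map A A (\<lambda>x. x) p v = v"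
proof -
  obtain c where c: "c \<in> charts_at A p" using charts_at_ex by blast
  have "coord_vec A c p (v c) c = v c" by (rule coord_vec_self[OF c])
  then show ?thesis
    by (intro tangent_space_eqI[OF tangent_map_in[OF mdiff_ident v] v c])
      (use c in \<open>simp add: tangent_map_eq[OF mdiff_ident v c c] comp_ident coord_vec_def\<close>)
qed

text \<open>Under a change of chart each half of the bracket acquires a second derivative of the
  transition map; the two extra terms coincide by symmetry and cancel.\<close>

lemma field_bracket_in:
  assumes Y: "\<And>p. Y p \<in> tangent_space A p" "\<And>c. c \<in> charts_at A p \<Longrightarrow> (\<lambda>x. Y (chart_inv c x) c) differentiable at (snd c p)"
    and Z: "\<And>p. Z p \<in> tangent_space A p" "\<And>c. c \<in> charts_at A p \<Longrightarrow> (\<lambda>x. Z (chart_inv c x) c) differentiable at (snd c p)"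
  shows "field_bracket A Y Z p \<in> tangent_space A p"
  unfolding tangent_space_def
proof (intro CollectI conjI ballI allI impI)
  fix c d assume c: "c \<in> charts_at A p" and d: "d \<in> charts_at A p"
  define \<tau> where "\<tau> = snd d \<circ> chart_inv c"
  let ?x = "snd c p" and ?U = "dom c (fst d)"
  have cA: "c \<in> A" "p \<in> fst c" and dA: "d \<in> A" "p \<in> fst d" using c d by (auto simp: charts_at_def)
  have U: "open ?U" "?x \<in> ?U" using dom_open[OF cA(1) chart_open[OF dA(1)]] in_dom cA dA by auto
  have \<tau>: "smooth_on ?U \<tau>" unfolding \<tau>_def by (rule transition_smooth[OF cA(1) dA(1)])
  have \<tau>x: "\<tau> ?x = snd d p" by (simp add: \<tau>_def chart_inv_left[OF cA])
  \<comment> \<open>The transformation law of \<open>Y\<close> differentiated along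
    \<open>w\<close>; the first summand on the right is the non-tensorial one.\<close>
  have *: "fd (\<lambda>x. Y (chart_inv d x) d) (snd d p) (fd \<tau> ?x w)
      = fd (\<lambda>x. fd \<tau> x (Y p c)) ?x w + fd \<tau> ?x (fd (\<lambda>x. Y (chart_inv c x) c) ?x w)"
    if Y: "\<And>p. Y p \<in> tangent_space A p" "\<And>c. c \<in> charts_at A p \<Longrightarrow> (\<lambda>x. Y (chart_inv c x) c) differentiable at (snd c p)"
    for Y w
  proof -
    have eq: "Y (chart_inv d (\<tau> x)) d = fd \<tau> x (Y (chart_inv c x) c)" if x: "x \<in> ?U" for x
    proof -
      have x': "x \<in> img c" "chart_inv c x \<in> fst d" using x by (auto simp: dom_def)
      have "chart_inv d (\<tau> x) = chart_inv c x" using x' dA by (simp add: \<tau>_def chart_inv_left)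
      moreover have "d \<in> charts_at A (chart_inv c x)" using x' dA by (simp add: charts_at_def)
      ultimately show ?thesis
        using tangent_spaceD[OF Y(1) chart_inv_at[OF cA(1) x'(1)], of d] chart_inv_right[OF cA(1) x'(1)]
        by (simp add: \<tau>_def)
    qed
    have Yd: "((\<lambda>x. Y (chart_inv d x) d) has_derivative fd (\<lambda>x. Y (chart_inv d x) d) (snd d p)) (at (\<tau> ?x))"
      unfolding \<tau>x by (rule fd_has_derivative[OF Y(2)[OF d]])
    have 1: "((\<lambda>x. Y (chart_inv d (\<tau> x)) d) has_derivative
        (\<lambda>w. fd (\<lambda>x. Y (chart_inv d x) d) (snd d p) (fd \<tau> ?x w))) (at ?x)"
      using diff_chain_at[OF smooth_on_has_derivative[OF \<tau> U(2)] Yd] by (simp add: comp_def)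
    have 2: "((\<lambda>x. fd \<tau> x (Y (chart_inv c x) c)) has_derivative
       (\<lambda>w. fd (\<lambda>x. fd \<tau> x (Y (chart_inv c ?x) c)) ?x w + fd \<tau> ?x (fd (\<lambda>x. Y (chart_inv c x) c) ?x w))) (at ?x)"
      by (rule lin_family_has_derivative[OF lin_family_fd_dir[OF \<tau>] U(1) has_derivative_ident U(2)
            fd_has_derivative[OF Y(2)[OF c]]])
    have "(\<lambda>w. fd (\<lambda>x. Y (chart_inv d x) d) (snd d p) (fd \<tau> ?x w))
       = (\<lambda>w. fd (\<lambda>x. fd \<tau> x (Y (chart_inv c ?x) c)) ?x w + fd \<tau> ?x (fd (\<lambda>x. Y (chart_inv c x) c) ?x w))"
      using fd_cong[OF U, of "\<lambda>x. Y (chart_inv d (\<tau> x)) d" "\<lambda>x. fd \<tau> x (Y (chart_inv c x) c)"] eq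
      unfolding fd_eqI[OF 1] fd_eqI[OF 2] by blast
    then show ?thesis unfolding chart_inv_left[OF cA] by (rule fun_cong)
  qed
  have V: "V p d = fd \<tau> ?x (V p c)" if "\<And>p. V p \<in> tangent_space A p" for V
    unfolding \<tau>_def by (rule tangent_spaceD[OF that c d])
  have "fd (\<lambda>x. fd \<tau> x (Y p c)) ?x (Z p c) = fd (\<lambda>x. fd \<tau> x (Z p c)) ?x (Y p c)"
    by (rule second_derivative_symmetric[OF U \<tau>])
  then show "field_bracket A Y Z p d = fd (snd d \<circ> chart_inv c) (snd c p) (field_bracket A Y Z p c)"
    using c d *[OF Y, of "Z p c"] *[OF Z, of "Y p c"] V[OF Y(1)] V[OF Z(1)]
      linear_diff[OF transition_linear[OF c d]]
    by (simp add: field_bracket_def \<tau>_def)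
qed (simp add: field_bracket_def)

end

section \<open>Right-invariant fields on a Lie group with a left-invariant metric\<close>

text \<open>The chart \<open>c0\<close> identifies the Lie algebra with \<open>'e\<close>, so that
  curves in the Lie algebra have ordinary derivatives.\<close>

locale lie_group_metric =
  fixes A :: "('g::{t2_space, second_countable_topology}, 'e::euclidean_space) chart set"
    and mul :: "'g \<Rightarrow> 'g \<Rightarrow> 'g" and e :: 'g and iv :: "'g \<Rightarrow> 'g" and h :: "('g, 'e) metric"
    and c0 :: "('g, 'e) chart"
  assumes lie: "lie_group A mul e iv" and metric: "left_invariant_metric A mul h"
    and c0: "c0 \<in> charts_at A e"
begin

sublocale smooth_manifold A
  using lie by unfold_locales (simp add: lie_group_def)

lemma group: "group mul e iv" using lie by (simp add: lie_group_def)

lemma mul_assoc: "mul (mul x y) z = mul x (mul y z)"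
  using group by (simp add: group_def semigroup_def)

lemma mul_e [simp]: "mul e x = x" "mul x e = x" and mul_iv [simp]: "mul (iv x) x = e" "mul x (iv x) = e"
  and iv_iv [simp]: "iv (iv x) = x"
proof -
  interpret g: group mul e iv by (rule group)
  show "mul e x = x" "mul x e = x" "mul (iv x) x = e" "mul x (iv x) = e" "iv (iv x) = x" by simp_all
qed

definition pdom :: "('g, 'e) chart \<Rightarrow> ('g, 'e) chart \<Rightarrow> ('g, 'e) chart \<Rightarrow> ('e \<times> 'e) set" where
  "pdom c d b = {(x, y). x \<in> img c \<and> y \<in> img d \<and> mul (chart_inv c x) (chart_inv d y) \<in> fst b}"

text \<open>Its partial derivative in the first slot yields right-invariant fields, the one in the
  second slot the differentials of left translations.\<close>

definition pmul :: "('g, 'e) chart \<Rightarrow> ('g, 'e) chart \<Rightarrow> ('g, 'e) chart \<Rightarrow> 'e \<times> 'e \<Rightarrow> 'e" where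
  "pmul c d b z = snd b (mul (chart_inv c (fst z)) (chart_inv d (snd z)))"

lemma
  assumes c: "c \<in> A" and d: "d \<in> A" and b: "b \<in> A"
  shows pdom_open: "open (pdom c d b)" and pmul_smooth: "smooth_on (pdom c d b) (pmul c d b)"
proof -
  let ?m = "\<lambda>(x, y). mul x y"
  let ?cd = "(fst c \<times> fst d, map_prod (snd c) (snd d))"
  have sm: "smooth_map (product_atlas A A) A ?m" using lie by (simp add: lie_group_def)
  \<comment> \<open>\<open>chart_inv\<close> of a product chart is an \<open>inv_into\<close> on a
    product set; it has to be identified with the pair of inverses before the smooth multiplication
    can be read in charts.\<close>
  have pinv: "chart_inv ?cd (x, y) = (chart_inv c x, chart_inv d y)" if "x \<in> img c" "y \<in> img d" for x y
  proof -
    have "inj_on (map_prod (snd c) (snd d)) (fst c \<times> fst d)"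
      by (rule map_prod_inj_on) (use chart_inv_left[OF c] chart_inv_left[OF d] in \<open>auto intro: inj_on_inverseI\<close>)
    from inv_into_f_f[OF this, of "(chart_inv c x, chart_inv d y)"] that show ?thesis
      by (simp add: chart_inv_def[of ?cd] chart_inv_in c d chart_inv_right)
  qed
  have dom_eq: "snd ?cd ` (fst ?cd \<inter> ?m -` fst b) = pdom c d b"
  proof (intro equalityI subsetI)
    fix z assume "z \<in> snd ?cd ` (fst ?cd \<inter> ?m -` fst b)"
    then show "z \<in> pdom c d b" by (auto simp: pdom_def chart_inv_left c d)
  next
    fix z assume z: "z \<in> pdom c d b"
    show "z \<in> snd ?cd ` (fst ?cd \<inter> ?m -` fst b)"
      by (rule image_eqI[of _ _ "(chart_inv c (fst z), chart_inv d (snd z))"])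
        (use z in \<open>auto simp: pdom_def chart_inv_right chart_inv_in c d\<close>)
  qed
  have cont: "continuous_on UNIV ?m" using sm by (simp add: smooth_map_def)
  have "continuous_on (img c \<times> img d) (\<lambda>z. ?m (chart_inv c (fst z), chart_inv d (snd z)))"
    by (rule continuous_on_compose2[OF cont])
      (auto intro!: continuous_on_Pair continuous_on_compose2[OF homeomorphism_cont2[OF chart_homeo[OF c]]]
        continuous_on_compose2[OF homeomorphism_cont2[OF chart_homeo[OF d]]] continuous_on_fst continuous_on_snd continuous_on_id)
  from continuous_open_preimage[OF this open_Times[OF img_open[OF c] img_open[OF d]] chart_open[OF b]]
  moreover have "(img c \<times> img d) \<inter> (\<lambda>z. ?m (chart_inv c (fst z), chart_inv d (snd z))) -` fst b = pdom c d b"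
    by (auto simp: pdom_def)
  ultimately show op: "open (pdom c d b)" by simp
  have "?cd \<in> product_atlas A A" 
    unfolding product_atlas_def using c d by blast
  then have "smooth_on (pdom c d b) (snd b \<circ> ?m \<circ> chart_inv ?cd)"
    using sm b dom_eq unfolding smooth_map_def by metis
  then show "smooth_on (pdom c d b) (pmul c d b)"
    by (rule smooth_on_cong[OF op, rotated]) (auto simp: pdom_def pmul_def pinv)
qed

lemma pmul_has_derivative:
  assumes "c \<in> A" "d \<in> A" "b \<in> A" "(x, y) \<in> pdom c d b"
  shows "((\<lambda>x. pmul c d b (x, y)) has_derivative (\<lambda>u. fd (pmul c d b) (x, y) (u, 0))) (at x)"
    "((\<lambda>y. pmul c d b (x, y)) has_derivative (\<lambda>u. fd (pmul c d b) (x, y) (0, u))) (at y)"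
proof -
  note D = smooth_on_has_derivative[OF pmul_smooth[OF assms(1-3)] assms(4)]
  have 1: "((\<lambda>x. (x, y)) has_derivative (\<lambda>u. (u, 0))) (at x)"
    by (intro has_derivative_Pair has_derivative_ident has_derivative_const)
  have 2: "((\<lambda>y. (x, y)) has_derivative (\<lambda>u. (0, u))) (at y)"
    by (intro has_derivative_Pair has_derivative_ident has_derivative_const)
  show "((\<lambda>x. pmul c d b (x, y)) has_derivative (\<lambda>u. fd (pmul c d b) (x, y) (u, 0))) (at x)"
    using diff_chain_at[OF 1 D] by (simp add: comp_def)
  show "((\<lambda>y. pmul c d b (x, y)) has_derivative (\<lambda>u. fd (pmul c d b) (x, y) (0, u))) (at y)"
    using diff_chain_at[OF 2 D] by (simp add: comp_def)
qed

lemma in_pdom: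
  assumes "c \<in> charts_at A p" "d \<in> charts_at A q" "b \<in> charts_at A (mul p q)"
  shows "(snd c p, snd d q) \<in> pdom c d b"
  using assms by (auto simp: charts_at_def pdom_def chart_inv_left)

lemma left_rep:
  assumes "b \<in> charts_at A g"
  shows "snd d \<circ> mul g \<circ> chart_inv c = (\<lambda>y. pmul b c d (snd b g, y))"
  using assms by (auto simp: pmul_def charts_at_def chart_inv_left)

lemma right_rep:
  assumes "b \<in> charts_at A g"
  shows "snd d \<circ> (\<lambda>x. mul x g) \<circ> chart_inv c = (\<lambda>y. pmul c b d (y, snd b g))"
  using assms by (auto simp: pmul_def charts_at_def chart_inv_left)

lemma mul_continuous:
  "continuous_on UNIV (mul g)" "continuous_on UNIV (\<lambda>x. mul x g)"
proof -
  have m: "continuous_on UNIV (\<lambda>(x, y). mul x y)" using lie by (simp add: lie_group_def smooth_map_def)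
  have "continuous_on UNIV (\<lambda>x. (\<lambda>(x, y). mul x y) (g, x))"
    by (rule continuous_on_compose2[OF m]) (auto intro!: continuous_intros)
  then show "continuous_on UNIV (mul g)" by simp
  have "continuous_on UNIV (\<lambda>x. (\<lambda>(x, y). mul x y) (x, g))"
    by (rule continuous_on_compose2[OF m]) (auto intro!: continuous_intros)
  then show "continuous_on UNIV (\<lambda>x. mul x g)" by simp
qed

lemma mdiff_left: "mdiff (mul g)"
  unfolding mdiff_def
proof (intro conjI allI ballI mul_continuous)
  fix p c d assume cd: "c \<in> charts_at A p" "d \<in> charts_at A (mul g p)"
  obtain b where b: "b \<in> charts_at A g" using charts_at_ex by blast
  show "(snd d \<circ> mul g \<circ> chart_inv c) differentiable at (snd c p)"
    unfolding left_rep[OF b] differentiable_def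
    using pmul_has_derivative(2)[OF _ _ _ in_pdom[OF b cd]] b cd charts_atD by blast
qed

lemma mdiff_right: "mdiff (\<lambda>x. mul x g)"
  unfolding mdiff_def
proof (intro conjI allI ballI mul_continuous)
  fix p c d assume cd: "c \<in> charts_at A p" "d \<in> charts_at A (mul p g)"
  obtain b where b: "b \<in> charts_at A g" using charts_at_ex by blast
  show "(snd d \<circ> (\<lambda>x. mul x g) \<circ> chart_inv c) differentiable at (snd c p)"
    unfolding right_rep[OF b] differentiable_def
    using pmul_has_derivative(1)[OF _ _ _ in_pdom[OF cd(1) b cd(2)]] b cd charts_atD by blast
qed

text \<open>Right-invariant fields generate left translations, which are the isometries at hand;
  this is why these fields, rather than the left-invariant ones, are Killing.\<close>

definition X :: "'e \<Rightarrow> 'g \<Rightarrow> ('g, 'e) tvec" where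
  "X a p = tangent_map A A (\<lambda>x. mul x p) e (coord_vec A c0 e a)"

lemma X_in: "X a p \<in> tangent_space A p"
  using tangent_map_in[OF mdiff_right coord_vec_in[OF c0], of p a] by (simp add: X_def)

lemma X_e: "X a e = coord_vec A c0 e a"
  using tangent_map_ident[OF coord_vec_in[OF c0]] by (simp add: X_def)

lemma X_component:
  assumes "d \<in> charts_at A p" "c \<in> charts_at A p"
  shows "X a p c = fd (pmul c0 d c) (snd c0 e, snd d p) (a, 0)"
proof -
  have "X a p c = fd (snd c \<circ> (\<lambda>x. mul x p) \<circ> chart_inv c0) (snd c0 e) (coord_vec A c0 e a c0)"
    unfolding X_def by (rule tangent_map_eq[OF mdiff_right coord_vec_in[OF c0] c0]) (use assms in simp)
  also have "\<dots> = fd (\<lambda>y. pmul c0 d c (y, snd d p)) (snd c0 e) a"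
    by (simp add: right_rep[OF assms(1)] coord_vec_self[OF c0])
  also have "\<dots> = fd (pmul c0 d c) (snd c0 e, snd d p) (a, 0)"
    by (rule fun_cong[OF fd_eqI[OF pmul_has_derivative(1)[OF _ _ _ in_pdom[OF c0 assms(1)]]]])
      (use assms c0 charts_atD in auto)
  finally show ?thesis .
qed

text \<open>Right translation by \<open>iv p\<close> carries \<open>X a p\<close> back to its value
  at \<open>e\<close>.\<close>

lemma X_inj:
  assumes "c \<in> charts_at A p"
  shows "inj (\<lambda>a. X a p c)"
proof (rule injI)
  fix a b assume "X a p c = X b p c"
  then have "X a p = X b p" by (rule tangent_space_eqI[OF X_in X_in assms])
  moreover have "tangent_map A A (\<lambda>x. mul x (iv p)) p (X a p) = coord_vec A c0 e a" for a
    using tangent_map_compose[OF mdiff_right mdiff_right coord_vec_in[OF c0], of p "iv p" a]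
      tangent_map_ident[OF coord_vec_in[OF c0], of a]
    by (simp add: X_def mul_assoc)
  ultimately have "coord_vec A c0 e a = coord_vec A c0 e b" by metis
  then show "a = b" using coord_vec_self[OF c0] by metis
qed

section \<open>The metric and the right-invariant frame in charts\<close>

lemma inner_product: "inner_product_on (tangent_space A p) (h p)"
  using metric by (simp add: left_invariant_metric_def riemannian_metric_def)

lemma h_left: "v \<in> tangent_space A q \<Longrightarrow> w \<in> tangent_space A q \<Longrightarrow>
    h (mul p q) (tangent_map A A (mul p) q v) (tangent_map A A (mul p) q w) = h q v w"
  using metric by (simp add: left_invariant_metric_def)

lemmas h_inner = inner_product[unfolded inner_product_on_def]

lemma h_sym: "u \<in> tangent_space A p \<Longrightarrow> w \<in> tangent_space A p \<Longrightarrow> h p u w = h p w u"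
  by (rule h_inner[THEN conjunct1, rule_format])

lemma h_add: "u \<in> tangent_space A p \<Longrightarrow> v \<in> tangent_space A p \<Longrightarrow> w \<in> tangent_space A p \<Longrightarrow>
    h p (u + v) w = h p u w + h p v w"
  by (rule h_inner[THEN conjunct2, THEN conjunct1, rule_format])

lemma h_scale: "u \<in> tangent_space A p \<Longrightarrow> w \<in> tangent_space A p \<Longrightarrow> h p (r *\<^sub>R u) w = r * h p u w"
  by (rule h_inner[THEN conjunct2, THEN conjunct2, THEN conjunct1, rule_format])

lemma h_pos: "u \<in> tangent_space A p \<Longrightarrow> u \<noteq> 0 \<Longrightarrow> 0 < h p u u"
  by (rule h_inner[THEN conjunct2, THEN conjunct2, THEN conjunct2, rule_format])

lemma h_eq_metric_coeff:
  assumes "c \<in> charts_at A p" "v \<in> tangent_space A p" "w \<in> tangent_space A p"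
  shows "h p v w = metric_coeff A h c (snd c p) (v c) (w c)"
  using assms charts_atD[OF assms(1)] by (simp add: metric_coeff_def chart_inv_left coord_vec_component)

lemma metric_chart_axioms:
  assumes c: "c \<in> A"
  shows "metric_chart (img c) (metric_coeff A h c)"
proof
  show "open (img c)" by (rule img_open[OF c])
  have sm: "smooth_on (img c) (\<lambda>x. metric_coeff A h c x a b)" for a b
    using metric c by (simp add: left_invariant_metric_def riemannian_metric_def)
  note at = chart_inv_at[OF c]
  show sym: "metric_coeff A h c x a b = metric_coeff A h c x b a" if "x \<in> img c" for x a b
    unfolding metric_coeff_def by (rule h_sym[OF coord_vec_in coord_vec_in]) (use at[OF that] in auto)
  have lin1: "linear (\<lambda>a. metric_coeff A h c x a b)" if "x \<in> img c" for x b
    unfolding metric_coeff_def using at[OF that]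
    by (intro linearI) (simp_all add: coord_vec_add coord_vec_scale h_add h_scale coord_vec_in)
  have lin2: "linear (metric_coeff A h c x a)" if x: "x \<in> img c" for x a
  proof -
    have "(\<lambda>b. metric_coeff A h c x b a) = metric_coeff A h c x a" using sym[OF x] by blast
    from lin1[OF x, of a, unfolded this] show ?thesis .
  qed
  show "bil_family (img c) (metric_coeff A h c)"
    unfolding bil_family_def lin_family_def by (intro conjI allI ballI lin1 lin2 sm)
  show "0 < metric_coeff A h c x a a" if "x \<in> img c" "a \<noteq> 0" for x a
    unfolding metric_coeff_def
  proof (rule h_pos[OF coord_vec_in[OF at[OF that(1)]]])
    show "coord_vec A c (chart_inv c x) a \<noteq> 0"
      using coord_vec_self[OF at[OF that(1)], of a] that(2) by auto
  qed
qed

definition Xc :: "('g, 'e) chart \<Rightarrow> 'e \<Rightarrow> 'e \<Rightarrow> 'e" where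
  "Xc c x a = X a (chart_inv c x) c"

lemma Xc_eq:
  assumes "c \<in> A" "x \<in> img c"
  shows "Xc c x a = fd (pmul c0 c c) (snd c0 e, x) (a, 0)"
  using X_component[OF chart_inv_at[OF assms] chart_inv_at[OF assms], of a] chart_inv_right[OF assms]
  by (simp add: Xc_def)

lemma in_pdom_e: "c \<in> A \<Longrightarrow> x \<in> img c \<Longrightarrow> (snd c0 e, x) \<in> pdom c0 c c"
  using in_pdom[OF c0, of c "chart_inv c x" c] chart_inv_at[of c x] chart_inv_right[of c x] by simp

lemma Xc_family:
  assumes c: "c \<in> A"
  shows "lin_family (img c) (Xc c)"
  unfolding lin_family_def
proof (intro conjI ballI allI)
  note c0A = charts_atD(1)[OF c0]
  fix x a assume x: "x \<in> img c"
  have lin: "linear (fd (pmul c0 c c) (snd c0 e, x))"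
    by (rule fd_linear[OF smooth_on_differentiable[OF pmul_smooth[OF c0A c c] in_pdom_e[OF c x]]])
  show "linear (Xc c x)"
    using linear_add[OF lin, of "(_, 0)" "(_, 0)"] linear_scale[OF lin, of _ "(_, 0)"]
    by (intro linearI) (simp_all add: Xc_eq[OF c x])
next
  note c0A = charts_atD(1)[OF c0]
  fix a
  have "smooth_on (img c) (\<lambda>x. fd (pmul c0 c c) (snd c0 e, x) (a, 0))"
    by (rule smooth_on_compose[OF img_open[OF c] pdom_open[OF c0A c c] in_pdom_e[OF c]
          smooth_on_fd[OF pmul_smooth[OF c0A c c]]
          smooth_on_Pair[OF img_open[OF c] smooth_on_const smooth_on_ident[OF img_open[OF c]]]])
  then show "smooth_on (img c) (\<lambda>x. Xc c x a)"
    by (rule smooth_on_cong[OF img_open[OF c], rotated]) (simp add: Xc_eq[OF c])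
qed

lemma Xc_fd:
  assumes c: "c \<in> A" and x: "x \<in> img c"
  shows "fd (\<lambda>y. Xc c y a) x v = fd (\<lambda>z. fd (pmul c0 c c) z (a, 0)) (snd c0 e, x) (0, v)"
proof -
  note c0A = charts_atD(1)[OF c0]
  have "fd (\<lambda>y. Xc c y a) x = fd (\<lambda>y. fd (pmul c0 c c) (snd c0 e, y) (a, 0)) x"
    by (rule fd_cong[OF img_open[OF c] x]) (rule Xc_eq[OF c])
  also have "\<dots> = (\<lambda>v. fd (\<lambda>z. fd (pmul c0 c c) z (a, 0)) (snd c0 e, x) (0, v))"
  proof (rule fd_eqI)
    have 1: "((\<lambda>y. (snd c0 e, y)) has_derivative (\<lambda>v. (0, v))) (at x)"
      by (intro has_derivative_Pair has_derivative_ident has_derivative_const)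
    show "((\<lambda>y. fd (pmul c0 c c) (snd c0 e, y) (a, 0)) has_derivative
        (\<lambda>v. fd (\<lambda>z. fd (pmul c0 c c) z (a, 0)) (snd c0 e, x) (0, v))) (at x)"
      using diff_chain_at[OF 1 smooth_on_has_derivative[OF smooth_on_fd[OF pmul_smooth[OF c0A c c]] in_pdom_e[OF c x]]]
      by (simp add: comp_def)
  qed
  finally show ?thesis by simp
qed

lemma pmul_e: "c \<in> A \<Longrightarrow> x \<in> img c \<Longrightarrow> pmul c0 c c (snd c0 e, x) = x"
  using chart_inv_left[OF charts_atD[OF c0]] by (simp add: pmul_def chart_inv_right)

lemma pmul_e_fd:
  assumes c: "c \<in> A" and x: "x \<in> img c"
  shows "fd (pmul c0 c c) (snd c0 e, x) (0, u) = u"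
proof -
  have "fd (\<lambda>y. pmul c0 c c (snd c0 e, y)) x = fd (\<lambda>y. y) x"
    by (rule fd_cong[OF img_open[OF c] x]) (rule pmul_e[OF c])
  then show ?thesis
    using fd_eqI[OF pmul_has_derivative(2)[OF charts_atD(1)[OF c0] c c in_pdom_e[OF c x]]] by (metis frechet_derivative_ident)
qed

text \<open>Left invariance with the translating element as a further variable: \<open>y\<close> is
  that element in \<open>c0\<close>, and \<open>x\<close> is the base point in \<open>c\<close>.
  Killing's equation is its derivative in \<open>y\<close>.\<close>

lemma metric_coeff_left_translation:
  assumes c: "c \<in> A" and yx: "(y, x) \<in> pdom c0 c c"
  shows "metric_coeff A h c (pmul c0 c c (y, x)) (fd (pmul c0 c c) (y, x) (0, p)) (fd (pmul c0 c c) (y, x) (0, q))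
    = metric_coeff A h c x p q"
proof -
  note c0A = charts_atD(1)[OF c0]
  define g where "g = chart_inv c0 y"
  define r where "r = chart_inv c x"
  have y: "y \<in> img c0" and x: "x \<in> img c" and gr: "mul g r \<in> fst c" using yx by (auto simp: pdom_def g_def r_def)
  have cg: "c0 \<in> charts_at A g" unfolding g_def by (rule chart_inv_at[OF c0A y])
  have cr: "c \<in> charts_at A r" unfolding r_def by (rule chart_inv_at[OF c x])
  have cgr: "c \<in> charts_at A (mul g r)" using c gr by (simp add: charts_at_def)
  have sg: "snd c0 g = y" and sr: "snd c r = x" by (simp_all add: g_def r_def chart_inv_right c0A c y x)
  let ?T = "\<lambda>p. tangent_map A A (mul g) r (coord_vec A c r p)"
  have Tin: "?T p \<in> tangent_space A (mul g r)" for p by (rule tangent_map_in[OF mdiff_left coord_vec_in[OF cr]])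
  have Tc: "?T p c = fd (pmul c0 c c) (y, x) (0, p)" for p
    using tangent_map_eq[OF mdiff_left coord_vec_in[OF cr] cr cgr, of p]
      fd_eqI[OF pmul_has_derivative(2)[OF c0A c c yx]]
    by (simp add: left_rep[OF cg] coord_vec_self[OF cr] sg sr)
  have "h (mul g r) (?T p) (?T q) = h r (coord_vec A c r p) (coord_vec A c r q)"
    by (rule h_left[OF coord_vec_in[OF cr] coord_vec_in[OF cr]])
  moreover have "snd c (mul g r) = pmul c0 c c (y, x)" by (simp add: pmul_def g_def r_def)
  moreover have "h (mul g r) (?T p) (?T q) = metric_coeff A h c (snd c (mul g r)) (?T p c) (?T q c)"
    by (rule h_eq_metric_coeff[OF cgr Tin Tin])
  ultimately show ?thesis unfolding Tc by (simp add: metric_coeff_def r_def)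
qed

text \<open>Invariance of the metric under left translation is differentiated in the translating
  element at \<open>e\<close>; the image of the fixed base point then moves with velocity
  \<open>Xc\<close>.\<close>

lemma killing_chart_axioms:
  assumes c: "c \<in> A"
  shows "killing_chart (img c) (metric_coeff A h c) (Xc c)"
proof -
  interpret metric_chart "img c" "metric_coeff A h c" by (rule metric_chart_axioms[OF c])
  note c0A = charts_atD(1)[OF c0]
  show ?thesis
  proof
    show "lin_family (img c) (Xc c)" by (rule Xc_family[OF c])
    show "inj (Xc c x)" if "x \<in> img c" for x
      using X_inj[OF chart_inv_at[OF c that]] by (simp add: Xc_def[abs_def])
    fix x p q a assume x: "x \<in> img c"
    let ?F = "pmul c0 c c" and ?P = "pdom c0 c c" and ?y = "snd c0 e"
    note F = pmul_smooth[OF c0A c c] and P = pdom_open[OF c0A c c] and z = in_pdom_e[OF c x]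
    have "continuous_on UNIV (\<lambda>y. (y, x))" by (intro continuous_intros)
    then have op: "open ((\<lambda>y. (y, x)) -` ?P)" by (rule open_vimage[OF P])
    have mem: "?y \<in> (\<lambda>y. (y, x)) -` ?P" using z by simp
    have 0: "metric_coeff A h c (?F (y, x)) (fd ?F (y, x) (0, p)) (fd ?F (y, x) (0, q)) - metric_coeff A h c x p q = 0"
      if "y \<in> (\<lambda>y. (y, x)) -` ?P" for y
      using metric_coeff_left_translation[OF c] that by simp
    have Pd: "((\<lambda>y. (y, x)) has_derivative (\<lambda>u. (u, 0))) (at ?y)"
      by (intro has_derivative_Pair has_derivative_ident has_derivative_const)
    have Fd: "((\<lambda>y. ?F (y, x)) has_derivative (\<lambda>u. Xc c x u)) (at ?y)"
      using pmul_has_derivative(1)[OF c0A c c z] by (simp add: Xc_eq[OF c x])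
    \<comment> \<open>Varying the differential of a left translation in the translating element
      gives the spatial derivative of the right-invariant field, because the mixed derivatives of
      the multiplication commute.\<close>
    have Fdd: "((\<lambda>y. fd ?F (y, x) (0, p)) has_derivative (\<lambda>u. fd (\<lambda>y. Xc c y u) x p)) (at ?y)" for p
      using diff_chain_at[OF Pd smooth_on_has_derivative[OF smooth_on_fd[OF F, of "(0, p)"] z]]
      unfolding comp_def Xc_fd[OF c x] second_derivative_symmetric[OF P z F, of "(0, p)" "(_, 0)"] .
    have D: "((\<lambda>y. metric_coeff A h c (?F (y, x)) (fd ?F (y, x) (0, p)) (fd ?F (y, x) (0, q)) - metric_coeff A h c x p q) has_derivative
       (\<lambda>u. D1 x p q (Xc c x u) + metric_coeff A h c x (fd (\<lambda>y. Xc c y u) x p) q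
         + metric_coeff A h c x p (fd (\<lambda>y. Xc c y u) x q) - 0)) (at ?y)"
      using bil_family_has_derivative[OF G open_S Fd _ Fdd[of p] Fdd[of q]] x
      by (intro has_derivative_diff has_derivative_const) (simp add: pmul_e[OF c x] pmul_e_fd[OF c x])
    show "D1 x p q (Xc c x a) + metric_coeff A h c x (fd (\<lambda>y. Xc c y a) x p) q
         + metric_coeff A h c x p (fd (\<lambda>y. Xc c y a) x q) = 0"
      using has_derivative_zero_fun[OF op mem 0 D, of a] by (simp only: diff_0_right)
  qed
qed

section \<open>Brackets of invariant fields and the adjoint bound\<close>

lemma X_chart_differentiable:
  assumes "c \<in> charts_at A p"
  shows "(\<lambda>x. X a (chart_inv c x) c) differentiable at (snd c p)"
  using smooth_on_differentiable[OF lin_familyD(2)[OF Xc_family[OF charts_atD(1)[OF assms]]], of "snd c p" a]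
    charts_atD(2)[OF assms] by (simp add: Xc_def)

lemma X_bracket_in: "field_bracket A (X a) (X b) p \<in> tangent_space A p"
  by (rule field_bracket_in[OF X_in X_chart_differentiable X_in X_chart_differentiable])

lemma left_field_in: "u \<in> tangent_space A e \<Longrightarrow> left_invariant_field A mul e u p \<in> tangent_space A p"
  using tangent_map_in[OF mdiff_left, of u e p] by (simp add: left_invariant_field_def)

lemma left_field_e: "u \<in> tangent_space A e \<Longrightarrow> left_invariant_field A mul e u e = u"
proof -
  assume u: "u \<in> tangent_space A e"
  have "mul e = (\<lambda>x. x)" by (rule ext) simp
  then show ?thesis using tangent_map_ident[OF u] by (simp add: left_invariant_field_def)
qed

lemma left_field_component:
  assumes u: "u \<in> tangent_space A e" and c: "c \<in> A" and x: "x \<in> img c"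
  shows "left_invariant_field A mul e u (chart_inv c x) c = fd (pmul c c0 c) (x, snd c0 e) (0, u c0)"
    and "(x, snd c0 e) \<in> pdom c c0 c"
proof -
  let ?p = "chart_inv c x"
  have cp: "c \<in> charts_at A ?p" "c \<in> charts_at A (mul ?p e)" using chart_inv_at[OF c x] by simp_all
  show z: "(x, snd c0 e) \<in> pdom c c0 c"
    using in_pdom[OF cp(1) c0 cp(2)] by (simp add: chart_inv_right[OF c x])
  show "left_invariant_field A mul e u ?p c = fd (pmul c c0 c) (x, snd c0 e) (0, u c0)"
    unfolding left_invariant_field_def tangent_map_eq[OF mdiff_left u c0 cp(2)] left_rep[OF cp(1)]
      chart_inv_right[OF c x]
    by (rule fun_cong[OF fd_eqI[OF pmul_has_derivative(2)[OF c charts_atD(1)[OF c0] c z]]])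
qed

lemma left_field_fd:
  assumes u: "u \<in> tangent_space A e" and c: "c \<in> A" and x: "x \<in> img c"
  shows "((\<lambda>x. left_invariant_field A mul e u (chart_inv c x) c) has_derivative
    (\<lambda>v. fd (\<lambda>z. fd (pmul c c0 c) z (0, u c0)) (x, snd c0 e) (v, 0))) (at x)"
proof (rule has_derivative_transform_within_open[OF _ img_open[OF c] x])
  have 1: "((\<lambda>x. (x, snd c0 e)) has_derivative (\<lambda>v. (v, 0))) (at x)"
    by (intro has_derivative_Pair has_derivative_ident has_derivative_const)
  show "((\<lambda>x. fd (pmul c c0 c) (x, snd c0 e) (0, u c0)) has_derivative
      (\<lambda>v. fd (\<lambda>z. fd (pmul c c0 c) z (0, u c0)) (x, snd c0 e) (v, 0))) (at x)"
    using diff_chain_at[OF 1 smooth_on_has_derivative[OF smooth_on_fd[OF pmul_smooth[OF c charts_atD(1)[OF c0] c]]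
          left_field_component(2)[OF u c x]]] by (simp only: comp_def)
qed (rule left_field_component(1)[OF u c, symmetric])

lemma lie_bracket_in:
  assumes u: "u \<in> tangent_space A e" and v: "v \<in> tangent_space A e"
  shows "lie_bracket A mul e u v \<in> tangent_space A e"
proof -
  have d: "(\<lambda>x. left_invariant_field A mul e u (chart_inv c x) c) differentiable at (snd c e)"
    if "u \<in> tangent_space A e" "c \<in> charts_at A e" for u c
    using left_field_fd[OF that(1) charts_atD(1)[OF that(2)], of "snd c e"] charts_atD(2)[OF that(2)]
    unfolding differentiable_def by blast
  show ?thesis
    unfolding lie_bracket_def
    by (rule field_bracket_in[OF left_field_in[OF u] d[OF u] left_field_in[OF v] d[OF v]])
qed

text \<open>Both brackets are antisymmetrised mixed second derivatives of the multiplication at \<open>(e, e)\<close>.\<close>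

lemma lie_bracket_eq:
  "lie_bracket A mul e (coord_vec A c0 e a) (coord_vec A c0 e b) = (- 1) *\<^sub>R field_bracket A (X a) (X b) e"
proof (rule tangent_space_eqI[OF lie_bracket_in subspace_scale[OF tangent_space_subspace X_bracket_in] c0])
  note v = coord_vec_in[OF c0] and c0A = charts_atD(1)[OF c0]
  let ?y = "snd c0 e" and ?F = "pmul c0 c0 c0"
  have y: "?y \<in> img c0" using charts_atD(2)[OF c0] by simp
  have L: "fd (\<lambda>x. left_invariant_field A mul e (coord_vec A c0 e a) (chart_inv c0 x) c0) ?y b
      = fd (\<lambda>z. fd ?F z (0, a)) (?y, ?y) (b, 0)" for a b
    using fun_cong[OF fd_eqI[OF left_field_fd[OF v c0A y]], of a b] by (simp only: coord_vec_self[OF c0])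
  have R: "fd (\<lambda>x. X a (chart_inv c0 x) c0) ?y b = fd (\<lambda>z. fd ?F z (a, 0)) (?y, ?y) (0, b)" for a b
    using Xc_fd[OF c0A y, of a b] by (simp only: Xc_def)
  \<comment> \<open>Swapping the derivatives turns the left-invariant term with label
    \<open>a\<close> into the right-invariant term with label \<open>b\<close>; hence the opposite
    sign of the brackets.\<close>
  have S: "fd (\<lambda>z. fd ?F z (0, a)) (?y, ?y) (b, 0) = fd (\<lambda>z. fd ?F z (b, 0)) (?y, ?y) (0, a)" for a b
    by (rule second_derivative_symmetric[OF pdom_open[OF c0A c0A c0A] in_pdom_e[OF c0A y] pmul_smooth[OF c0A c0A c0A]])
  show "lie_bracket A mul e (coord_vec A c0 e a) (coord_vec A c0 e b) c0 = ((- 1) *\<^sub>R field_bracket A (X a) (X b) e) c0"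
    using c0 by (simp add: lie_bracket_def field_bracket_def left_field_e[OF v] coord_vec_self[OF c0]
        X_e L R S scaleR_fun_def)
qed (rule coord_vec_in[OF c0])+

text \<open>Right translation by \<open>p\<close> is conjugation by \<open>iv p\<close> followed by
  left translation by \<open>p\<close>. By left invariance \<open>X a p\<close> has the length of
  the conjugated vector \<open>u\<close>; since \<open>Ad\<close> at \<open>p\<close> maps
  \<open>u\<close> back to \<open>v\<close>, the lower bound at \<open>u\<close> bounds
  \<open>u\<close> from above.\<close>

lemma X_bound:
  assumes c: "0 < c" and Ad: "\<forall>w\<in>tangent_space A e. c * metric_norm h e w \<le> metric_norm h e (Ad A mul e iv p w)"
  shows "h p (X a p) (X a p) \<le> h e (coord_vec A c0 e a) (coord_vec A c0 e a) / c\<^sup>2"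
proof -
  define v where "v = coord_vec A c0 e a"
  have v: "v \<in> tangent_space A e" unfolding v_def by (rule coord_vec_in[OF c0])
  define k where "k g = (\<lambda>x. mul (mul g x) (iv g))" for g
  have k: "mdiff (k g)" for g
    unfolding k_def by (rule mdiff_compose[OF mdiff_left mdiff_right])
  have ke: "k g e = e" for g by (simp add: k_def)
  define u where "u = tangent_map A A (k (iv p)) e v"
  have u: "u \<in> tangent_space A e" using tangent_map_in[OF k v, of "iv p"] by (simp add: u_def ke)
  have "(\<lambda>x. mul x p) = (\<lambda>x. mul p (k (iv p) x))"
    by (rule ext) (simp add: k_def mul_assoc[symmetric])
  then have "X a p = tangent_map A A (mul p) e u"
    using tangent_map_compose[OF k[of "iv p"] mdiff_left[of p] v] by (simp add: X_def v_def[symmetric] u_def ke)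
  then have hX: "h p (X a p) (X a p) = h e u u" using h_left[OF u u, of p] by simp
  have "(\<lambda>x. k p (k (iv p) x)) = (\<lambda>x. x)"
    by (rule ext) (simp add: k_def mul_assoc, simp add: mul_assoc[symmetric])
  then have "tangent_map A A (k p) e u = v"
    using tangent_map_compose[OF k[of "iv p"] k[of p] v] tangent_map_ident[OF v] by (simp add: u_def ke)
  then have "c * metric_norm h e u \<le> metric_norm h e v"
    using Ad[rule_format, OF u] by (simp add: Ad_def k_def)
  then have le: "c * sqrt (h e u u) \<le> sqrt (h e v v)" by (simp add: metric_norm_def)
  have pos: "0 \<le> h e w w" if w: "w \<in> tangent_space A e" for w
  proof (cases "w = 0")
    case True
    then show ?thesis using h_scale[OF w w, of 0] by simp
  qed (use h_pos[OF w] in simp)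
  have "(c * sqrt (h e u u))\<^sup>2 \<le> (sqrt (h e v v))\<^sup>2"
    by (rule power_mono[OF le]) (use c pos[OF u] in simp)
  then have "c\<^sup>2 * h e u u \<le> h e v v" using pos[OF u] pos[OF v] by (simp add: power_mult_distrib)
  then show ?thesis using c unfolding hX v_def[symmetric] by (simp add: field_simps)
qed

end

section \<open>Jacobi fields along a geodesic in the right-invariant frame\<close>

lemma has_vector_derivative_cong_open:
  assumes "open T" "t \<in> T" "\<And>s. s \<in> T \<Longrightarrow> f s = g s"
  shows "(f has_vector_derivative D) (at t) \<longleftrightarrow> (g has_vector_derivative D) (at t)"
proof
  assume "(f has_vector_derivative D) (at t)"
  then show "(g has_vector_derivative D) (at t)"
    by (rule has_vector_derivative_transform_within_open[OF _ assms])
next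
  assume "(g has_vector_derivative D) (at t)"
  then show "(f has_vector_derivative D) (at t)"
    by (rule has_vector_derivative_transform_within_open[OF _ assms(1,2)]) (simp add: assms(3))
qed

lemma vector_derivative_cong_open:
  assumes "open T" "t \<in> T" "\<And>s. s \<in> T \<Longrightarrow> f s = g s"
  shows "vector_derivative f (at t) = vector_derivative g (at t)"
proof -
  have "(\<lambda>D. (f has_vector_derivative D) (at t)) = (\<lambda>D. (g has_vector_derivative D) (at t))"
    by (rule ext) (rule has_vector_derivative_cong_open[OF assms])
  then show ?thesis unfolding vector_derivative_def by (rule arg_cong)
qed

lemma DERIV_cong_open:
  fixes f g :: "real \<Rightarrow> real"
  assumes "open T" "t \<in> T" "\<And>s. s \<in> T \<Longrightarrow> f s = g s"
  shows "(f has_real_derivative D) (at t) \<longleftrightarrow> (g has_real_derivative D) (at t)"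
  unfolding has_real_derivative_iff_has_vector_derivative by (rule has_vector_derivative_cong_open[OF assms])

locale lie_group_geodesic = lie_group_metric A mul e iv h c0
  for A :: "('g::{t2_space, second_countable_topology}, 'e::euclidean_space) chart set"
    and mul :: "'g \<Rightarrow> 'g \<Rightarrow> 'g" and e :: 'g and iv :: "'g \<Rightarrow> 'g" and h :: "('g, 'e) metric"
    and c0 :: "('g, 'e) chart" +
  fixes \<gamma> :: "real \<Rightarrow> 'g"
  assumes geodesic: "geodesic A h \<gamma>" and start: "\<gamma> 0 = e"
begin

abbreviation cI :: "('g, 'e) chart \<Rightarrow> real set" where
  "cI c \<equiv> \<gamma> -` fst c"

definition xc :: "('g, 'e) chart \<Rightarrow> real \<Rightarrow> 'e" where
  "xc c t = snd c (\<gamma> t)"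

definition v1 :: "('g, 'e) chart \<Rightarrow> real \<Rightarrow> 'e" where
  "v1 c t = vector_derivative (xc c) (at t)"

definition v2 :: "('g, 'e) chart \<Rightarrow> real \<Rightarrow> 'e" where
  "v2 c t = vector_derivative (v1 c) (at t)"

lemma in_cI: "c \<in> A \<Longrightarrow> t \<in> cI c \<Longrightarrow> c \<in> charts_at A (\<gamma> t)"
  by (simp add: charts_at_def)

lemma chart_at_time: "\<exists>c\<in>A. t \<in> cI c"
proof -
  obtain c where c: "c \<in> charts_at A (\<gamma> t)" using charts_at_ex by blast
  show ?thesis by (rule bexI[of _ c]) (use charts_atD[OF c] in simp_all)
qed

lemma curve:
  assumes c: "c \<in> A"
  shows cI_open: "open (cI c)" and xc_smooth: "smooth_on (cI c) (xc c)"
proof -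
  have sm: "smooth_map euclidean_atlas A \<gamma>" using geodesic by (simp add: geodesic_def)
  then have "continuous_on UNIV \<gamma>" by (simp add: smooth_map_def)
  then show "open (cI c)" by (rule open_vimage[OF chart_open[OF c]])
  have inv: "chart_inv (UNIV, \<lambda>x::real. x) = (\<lambda>x. x)"
  proof
    fix x :: real
    show "chart_inv (UNIV, \<lambda>x::real. x) x = x"
      using inv_into_f_f[of "\<lambda>x::real. x" UNIV x] by (simp add: chart_inv_def)
  qed
  have E: "(UNIV, \<lambda>x::real. x) \<in> euclidean_atlas" by (simp add: euclidean_atlas_def)
  from bspec[OF bspec[OF sm[unfolded smooth_map_def, THEN conjunct2] E] c]
  show "smooth_on (cI c) (xc c)" by (simp add: inv comp_def xc_def[abs_def])
qed

lemma v1_smooth: "c \<in> A \<Longrightarrow> smooth_on (cI c) (v1 c)"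
  unfolding v1_def[abs_def] by (rule smooth_on_vector_derivative[OF xc_smooth cI_open])

lemma xc_in: "c \<in> A \<Longrightarrow> t \<in> cI c \<Longrightarrow> xc c t \<in> img c"
  by (simp add: xc_def)

lemma chart_inv_xc: "c \<in> A \<Longrightarrow> t \<in> cI c \<Longrightarrow> chart_inv c (xc c t) = \<gamma> t"
  by (simp add: xc_def chart_inv_left)

lemma xc_derivative: "c \<in> A \<Longrightarrow> t \<in> cI c \<Longrightarrow> (xc c has_vector_derivative v1 c t) (at t)"
  unfolding v1_def by (rule smooth_on_has_vector_derivative[OF xc_smooth])

lemma v1_derivative: "c \<in> A \<Longrightarrow> t \<in> cI c \<Longrightarrow> (v1 c has_vector_derivative v2 c t) (at t)"
  unfolding v2_def by (rule smooth_on_has_vector_derivative[OF v1_smooth])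

lemma velocity_component: "c \<in> A \<Longrightarrow> t \<in> cI c \<Longrightarrow> velocity A \<gamma> t c = v1 c t"
  by (simp add: velocity_def v1_def xc_def[abs_def] charts_at_def)

lemma velocity_in: "velocity A \<gamma> t \<in> tangent_space A (\<gamma> t)"
  unfolding tangent_space_def
proof (intro CollectI conjI ballI allI impI)
  fix c d assume cd: "c \<in> charts_at A (\<gamma> t)" "d \<in> charts_at A (\<gamma> t)"
  have c: "c \<in> A" "t \<in> cI c" and d: "d \<in> A" "t \<in> cI d" using cd by (auto simp: charts_at_def)
  let ?\<tau> = "snd d \<circ> chart_inv c"
  have xt: "xc c t \<in> dom c (fst d)" unfolding xc_def using c d by (intro in_dom) auto
  have \<tau>: "(?\<tau> has_derivative fd ?\<tau> (xc c t)) (at (xc c t))"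
    by (rule smooth_on_has_derivative[OF transition_smooth[OF c(1) d(1)] xt])
  have "((\<lambda>s. ?\<tau> (xc c s)) has_vector_derivative fd ?\<tau> (xc c t) (v1 c t)) (at t)"
    using diff_chain_at[OF xc_derivative[OF c, unfolded has_vector_derivative_def] \<tau>]
    unfolding has_vector_derivative_def comp_def linear_scale[OF has_derivative_linear[OF \<tau>], unfolded comp_def] .
  then have "(xc d has_vector_derivative fd ?\<tau> (xc c t) (v1 c t)) (at t)"
    by (rule has_vector_derivative_transform_within_open[OF _ cI_open[OF c(1)] c(2)])
      (simp add: chart_inv_xc[OF c(1)], simp add: xc_def)
  then have "v1 d t = fd ?\<tau> (xc c t) (v1 c t)" unfolding v1_def by (rule vector_derivative_at)
  then show "velocity A \<gamma> t d = fd ?\<tau> (snd c (\<gamma> t)) (velocity A \<gamma> t c)"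
    by (simp add: velocity_component[OF c] velocity_component[OF d] xc_def)
qed (simp add: velocity_def)

section \<open>Metric and bracket forms of the frame along the geodesic\<close>

definition \<Lambda> :: "real \<Rightarrow> 'e \<Rightarrow> 'e \<Rightarrow> real" where
  "\<Lambda> t a b = h (\<gamma> t) (X a (\<gamma> t)) (X b (\<gamma> t))"

text \<open>The form \<open>K\<close> before it is known to be constant, in terms of right-invariant
  fields. Their bracket at \<open>e\<close> is minus the Lie bracket, which accounts for the sign of
  \<open>K\<close>.\<close>

definition \<kappa> :: "real \<Rightarrow> 'e \<Rightarrow> 'e \<Rightarrow> real" where
  "\<kappa> t a b = h (\<gamma> t) (velocity A \<gamma> t) (field_bracket A (X a) (X b) (\<gamma> t))"

lemma X_xc: "c \<in> A \<Longrightarrow> t \<in> cI c \<Longrightarrow> X a (\<gamma> t) c = Xc c (xc c t) a"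
  by (simp add: Xc_def chart_inv_xc)

lemma \<Lambda>_chart:
  assumes "c \<in> A" "t \<in> cI c"
  shows "\<Lambda> t a b = metric_coeff A h c (xc c t) (Xc c (xc c t) a) (Xc c (xc c t) b)"
  using h_eq_metric_coeff[OF in_cI[OF assms] X_in X_in, of a b]
  by (simp add: \<Lambda>_def X_xc[OF assms] xc_def[symmetric])

lemma \<kappa>_chart:
  assumes c: "c \<in> A" "t \<in> cI c"
  shows "\<kappa> t a b = killing_chart.twist (metric_coeff A h c) (Xc c) (xc c t) (v1 c t) a b"
proof -
  interpret killing_chart "img c" "metric_coeff A h c" "Xc c" by (rule killing_chart_axioms[OF c(1)])
  have ct: "c \<in> charts_at A (\<gamma> t)" by (rule in_cI[OF c])
  have "field_bracket A (X a) (X b) (\<gamma> t) c = DX (xc c t) b (Xc c (xc c t) a) - DX (xc c t) a (Xc c (xc c t) b)"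
    using ct by (simp add: field_bracket_def X_xc[OF c] Xc_def[symmetric] xc_def[symmetric])
  then show ?thesis
    using h_eq_metric_coeff[OF ct velocity_in X_bracket_in, of a b] linear_diff[OF G_lin(1)[OF xc_in[OF c]]]
    by (simp add: \<kappa>_def twist_def velocity_component[OF c] xc_def[symmetric])
qed

lemma geodesic_chart:
  assumes c: "c \<in> A" "t \<in> cI c"
  shows "v2 c t + christoffel A h c (xc c t) (v1 c t) (v1 c t) = 0"
proof -
  have "vector_derivative (\<lambda>s. velocity A \<gamma> s c) (at t) = v2 c t"
    unfolding v2_def by (rule vector_derivative_cong_open[OF cI_open[OF c(1)] c(2)])
      (rule velocity_component[OF c(1)])
  moreover have "covariant_derivative A h \<gamma> (velocity A \<gamma>) t c = 0"
    using geodesic by (simp add: geodesic_def)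
  ultimately show ?thesis
    using c by (simp add: covariant_derivative_def charts_at_def velocity_component xc_def)
qed

text \<open>Conservation of the momentum belonging to the bracket of two Killing fields. Every time
  has its own chart, but a derivative that vanishes at all times is enough.\<close>

lemma \<kappa>_constant: "\<kappa> t a b = \<kappa> 0 a b"
proof -
  have "((\<lambda>t. \<kappa> t a b) has_real_derivative 0) (at t)" for t
  proof -
    obtain c where c: "c \<in> A" "t \<in> cI c" using chart_at_time by blast
    interpret killing_chart "img c" "metric_coeff A h c" "Xc c" by (rule killing_chart_axioms[OF c(1)])
    have \<Gamma>: "christoffel A h c = \<Gamma>" by (intro ext) (simp add: christoffel_def \<Gamma>_def)
    have "((\<lambda>t. twist (xc c t) (v1 c t) a b) has_real_derivative 0) (at t)"
      by (rule twist_constant[OF xc_in[OF c] xc_derivative[OF c] v1_derivative[OF c] geodesic_chart[OF c, unfolded \<Gamma>]])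
    then show ?thesis
      using DERIV_cong_open[OF cI_open[OF c(1)] c(2), of "\<lambda>t. \<kappa> t a b" "\<lambda>t. twist (xc c t) (v1 c t) a b"]
        \<kappa>_chart[OF c(1)] by simp
  qed
  then show ?thesis using DERIV_isconst_all[of "\<lambda>t. \<kappa> t a b" t 0] by blast
qed

text \<open>In the frame of right-invariant fields, which are Killing, the Jacobi equation for
  \<open>J = X w\<close> integrates once: \<open>\<Lambda> (w', b) + \<kappa> (w, b)\<close> is constant for every \<open>b\<close>.\<close>

lemma jacobi_field_iff:
  assumes J: "smooth_field_along A \<gamma> J" "\<And>t. J t = X (w t) (\<gamma> t)"
    and w: "\<And>t. (w has_vector_derivative w1 t) (at t)" and w1: "\<And>t. (w1 has_vector_derivative w2 t) (at t)"
  shows "jacobi_field A h \<gamma> J \<longleftrightarrow>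
    (\<forall>t b. ((\<lambda>s. \<Lambda> s (w1 s) b) has_real_derivative - \<kappa> t (w1 t) b) (at t))"
proof -
  define E where "E t = covariant_derivative A h \<gamma> (covariant_derivative A h \<gamma> J) t
        + curvature A h (\<gamma> t) (J t) (velocity A \<gamma> t) (velocity A \<gamma> t)" for t
  define R where "R t \<longleftrightarrow> (\<forall>b. ((\<lambda>s. \<Lambda> s (w1 s) b) has_real_derivative - \<kappa> t (w1 t) b) (at t))" for t
  \<comment> \<open>\<open>R t\<close> does not mention the chart, so one chart suffices from left
    to right, and the converse reaches every chart around the point.\<close>
  have comp: "E t c = 0 \<longleftrightarrow> R t" if c: "c \<in> A" "t \<in> cI c" for t c
  proof -
    interpret killing_chart "img c" "metric_coeff A h c" "Xc c" by (rule killing_chart_axioms[OF c(1)])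
    have \<Gamma>: "christoffel A h c = \<Gamma>" by (intro ext) (simp add: christoffel_def \<Gamma>_def)
    note xt = xc_in[OF c] and geo = geodesic_chart[OF c, unfolded \<Gamma>]
    note ctx = xc_in[OF c] xc_derivative[OF c] v1_derivative[OF c] geodesic_chart[OF c, unfolded \<Gamma>]
    define \<xi> where "\<xi> s = Xc c (xc c s) (w s)" for s
    define \<xi>1 where "\<xi>1 s = DX (xc c s) (w s) (v1 c s) + Xc c (xc c s) (w1 s)" for s
    define \<xi>2 where "\<xi>2 = D2X (xc c t) (w t) (v1 c t) (v1 c t) + 2 *\<^sub>R DX (xc c t) (w1 t) (v1 c t)
        + DX (xc c t) (w t) (v2 c t) + Xc c (xc c t) (w2 t)"
    have \<xi>d: "(\<xi> has_vector_derivative \<xi>1 s) (at s)" if s: "s \<in> cI c" for s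
      unfolding \<xi>_def[abs_def] \<xi>1_def
      by (rule lin_family_has_vector_derivative[OF X open_S xc_derivative[OF c(1) s] xc_in[OF c(1) s] w])
    have \<xi>1d: "(\<xi>1 has_vector_derivative \<xi>2) (at t)"
      unfolding \<xi>1_def[abs_def] \<xi>2_def by (rule killing_combination_derivative2[OF ctx w w1])
    have Jc: "J s c = \<xi> s" if "s \<in> cI c" for s
      using that by (simp add: J(2) X_xc[OF c(1)] \<xi>_def)
    have cov1: "covariant_derivative A h \<gamma> J s c = \<xi>1 s + \<Gamma> (xc c s) (v1 c s) (\<xi> s)" if s: "s \<in> cI c" for s
    proof -
      have "vector_derivative (\<lambda>s. J s c) (at s) = vector_derivative \<xi> (at s)"
        by (rule vector_derivative_cong_open[OF cI_open[OF c(1)] s]) (rule Jc)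
      also have "\<dots> = \<xi>1 s" by (rule vector_derivative_at[OF \<xi>d[OF s]])
      finally show ?thesis
        using c(1) s by (simp add: covariant_derivative_def charts_at_def velocity_component Jc \<Gamma> xc_def[symmetric])
    qed
    have "((\<lambda>s. \<xi>1 s + \<Gamma> (xc c s) (v1 c s) (\<xi> s)) has_vector_derivative
        \<xi>2 + (fd (\<lambda>y. \<Gamma> y (v1 c t) (\<xi> t)) (xc c t) (v1 c t) + \<Gamma> (xc c t) (v2 c t) (\<xi> t)
          + \<Gamma> (xc c t) (v1 c t) (\<xi>1 t))) (at t)"
      by (rule has_vector_derivative_add[OF \<xi>1d bil_family_has_vector_derivative[OF christoffel_family open_S
              xc_derivative[OF c] xt v1_derivative[OF c] \<xi>d[OF c(2)]]])
    then have vd: "vector_derivative (\<lambda>s. covariant_derivative A h \<gamma> J s c) (at t) =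
        \<xi>2 + (fd (\<lambda>y. \<Gamma> y (v1 c t) (\<xi> t)) (xc c t) (v1 c t) + \<Gamma> (xc c t) (v2 c t) (\<xi> t)
          + \<Gamma> (xc c t) (v1 c t) (\<xi>1 t))"
      using vector_derivative_cong_open[OF cI_open[OF c(1)] c(2), of "\<lambda>s. covariant_derivative A h \<gamma> J s c"
          "\<lambda>s. \<xi>1 s + \<Gamma> (xc c s) (v1 c s) (\<xi> s)"] cov1
      by (simp add: vector_derivative_at)
    have ct: "c \<in> charts_at A (\<gamma> t)" by (rule in_cI[OF c])
    have Ec: "E t c = \<xi>2 + (fd (\<lambda>y. \<Gamma> y (v1 c t) (\<xi> t)) (xc c t) (v1 c t) + \<Gamma> (xc c t) (v2 c t) (\<xi> t)
          + \<Gamma> (xc c t) (v1 c t) (\<xi>1 t)) + \<Gamma> (xc c t) (v1 c t) (\<xi>1 t + \<Gamma> (xc c t) (v1 c t) (\<xi> t))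
       + (fd (\<lambda>y. \<Gamma> y (v1 c t) (v1 c t)) (xc c t) (\<xi> t) - fd (\<lambda>y. \<Gamma> y (\<xi> t) (v1 c t)) (xc c t) (v1 c t)
        + \<Gamma> (xc c t) (\<xi> t) (\<Gamma> (xc c t) (v1 c t) (v1 c t)) - \<Gamma> (xc c t) (v1 c t) (\<Gamma> (xc c t) (\<xi> t) (v1 c t)))"
    proof -
      have "covariant_derivative A h \<gamma> (covariant_derivative A h \<gamma> J) t c
        = vector_derivative (\<lambda>s. covariant_derivative A h \<gamma> J s c) (at t)
          + \<Gamma> (xc c t) (v1 c t) (covariant_derivative A h \<gamma> J t c)"
        using ct unfolding covariant_derivative_def[of A h \<gamma> "covariant_derivative A h \<gamma> J"]
        by (simp add: velocity_component[OF c] \<Gamma> xc_def[symmetric])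
      moreover have "curvature A h (\<gamma> t) (J t) (velocity A \<gamma> t) (velocity A \<gamma> t) c
        = fd (\<lambda>y. \<Gamma> y (v1 c t) (v1 c t)) (xc c t) (\<xi> t) - fd (\<lambda>y. \<Gamma> y (\<xi> t) (v1 c t)) (xc c t) (v1 c t)
        + \<Gamma> (xc c t) (\<xi> t) (\<Gamma> (xc c t) (v1 c t) (v1 c t)) - \<Gamma> (xc c t) (v1 c t) (\<Gamma> (xc c t) (\<xi> t) (v1 c t))"
        using ct by (simp add: curvature_def Let_def velocity_component[OF c] Jc[OF c(2)] \<Gamma> xc_def[symmetric])
      ultimately show ?thesis by (simp only: E_def plus_fun_apply vd cov1[OF c(2)])
    qed
    have "E t c = 0 \<longleftrightarrow> (\<forall>\<eta>. metric_coeff A h c (xc c t) (E t c) \<eta> = 0)"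
      using G_eqI[OF xt, of "E t c" 0] linear_0[OF G_lin(2)[OF xt]] by auto
    also have "\<dots> \<longleftrightarrow> (\<forall>\<eta>. jacobi_form (xc c t) (v1 c t) (v2 c t) (\<xi> t) (\<xi>1 t) \<xi>2 \<eta> = 0)"
      unfolding Ec jacobi_operator_eq[OF xt geo] ..
    also have "\<dots> \<longleftrightarrow> (\<forall>b. ((\<lambda>s. metric_coeff A h c (xc c s) (Xc c (xc c s) (w1 s)) (Xc c (xc c s) b))
        has_real_derivative - twist (xc c t) (v1 c t) (w1 t) b) (at t))"
      unfolding \<xi>_def \<xi>1_def \<xi>2_def by (rule jacobi_killing_combination_iff[OF ctx w1])
    also have "\<dots> \<longleftrightarrow> R t"
    proof -
      have "((\<lambda>s. metric_coeff A h c (xc c s) (Xc c (xc c s) (w1 s)) (Xc c (xc c s) b)) has_real_derivative D) (at t)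
        \<longleftrightarrow> ((\<lambda>s. \<Lambda> s (w1 s) b) has_real_derivative D) (at t)" for b D
        by (rule DERIV_cong_open[OF cI_open[OF c(1)] c(2)]) (rule \<Lambda>_chart[OF c(1), symmetric])
      then show ?thesis unfolding R_def \<kappa>_chart[OF c] by blast
    qed
    finally show ?thesis .
  qed
  have "E t = 0 \<longleftrightarrow> R t" for t
  proof
    obtain c where c: "c \<in> A" "t \<in> cI c" using chart_at_time by blast
    assume "E t = 0"
    then show "R t" using comp[OF c] by simp
  next
    assume R: "R t"
    show "E t = 0"
    proof
      fix c
      show "E t c = (0 :: ('g, 'e) tvec) c"
      proof (cases "c \<in> charts_at A (\<gamma> t)")
        case True
        then have c: "c \<in> A" "t \<in> cI c" by (auto simp: charts_at_def)
        show ?thesis using comp[OF c] R by simp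
      qed (simp add: E_def covariant_derivative_def curvature_def)
    qed
  qed
  then show ?thesis using J(1) unfolding jacobi_field_def E_def R_def by blast
qed

text \<open>Linearity and local smoothness are read off in a chart around the current point; the
  family itself is free of charts and defined on the whole line.\<close>

lemma \<Lambda>_family: "bil_family UNIV \<Lambda>"
proof -
  have lin: "linear (\<Lambda> t a) \<and> linear (\<lambda>a. \<Lambda> t a b)" for t a b
  proof -
    obtain c where c: "c \<in> A" "t \<in> cI c" using chart_at_time by blast
    interpret killing_chart "img c" "metric_coeff A h c" "Xc c" by (rule killing_chart_axioms[OF c(1)])
    note xt = xc_in[OF c]
    have e: "\<Lambda> t = (\<lambda>a b. metric_coeff A h c (xc c t) (Xc c (xc c t) a) (Xc c (xc c t) b))"
      by (intro ext) (rule \<Lambda>_chart[OF c])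
    show ?thesis
      using linear_compose[OF X_lin[OF xt] G_lin(1)[OF xt], of "Xc c (xc c t) a"]
        linear_compose[OF X_lin[OF xt] G_lin(2)[OF xt], of "Xc c (xc c t) b"]
      unfolding e by (simp add: comp_def)
  qed
  have sm: "smooth_on UNIV (\<lambda>t. \<Lambda> t a b)" for a b
  proof (rule smooth_on_local)
    fix t
    obtain c where c: "c \<in> A" "t \<in> cI c" using chart_at_time by blast
    interpret killing_chart "img c" "metric_coeff A h c" "Xc c" by (rule killing_chart_axioms[OF c(1)])
    have Xs: "smooth_on (cI c) (\<lambda>t. Xc c (xc c t) a)" for a
      by (rule smooth_on_compose[OF cI_open[OF c(1)] open_S xc_in[OF c(1)] X_smooth xc_smooth[OF c(1)]])
    have "smooth_on (cI c) (\<lambda>t. metric_coeff A h c (xc c t) (Xc c (xc c t) a) (Xc c (xc c t) b))"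
      by (rule smooth_on_bil_family[OF G open_S cI_open[OF c(1)] xc_smooth[OF c(1)] xc_in[OF c(1)] Xs Xs])
    then have "smooth_on (cI c) (\<lambda>t. \<Lambda> t a b)"
      by (rule smooth_on_cong[OF cI_open[OF c(1)], rotated]) (rule \<Lambda>_chart[OF c(1), symmetric])
    then show "\<exists>T. open T \<and> t \<in> T \<and> smooth_on (T \<inter> UNIV) (\<lambda>t. \<Lambda> t a b)"
      using cI_open[OF c(1)] c(2) by auto
  qed
  show ?thesis
    unfolding bil_family_def lin_family_def by (intro conjI allI ballI lin[THEN conjunct1] lin[THEN conjunct2] sm)
qed

lemma X_eq_0:
  assumes "X a p = 0"
  shows "a = 0"
proof -
  obtain c where c: "c \<in> charts_at A p" using charts_at_ex by blast
  have "Xc c (snd c p) 0 = 0"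
    using linear_0[OF lin_familyD(1)[OF Xc_family[OF charts_atD(1)[OF c]]]] charts_atD(2)[OF c] by simp
  then have "X 0 p c = 0" using charts_atD[OF c] by (simp add: Xc_def chart_inv_left)
  then have "X a p c = X 0 p c" using assms by simp
  then show ?thesis using injD[OF X_inj[OF c]] by blast
qed

lemma X_0: "X 0 p = 0"
proof -
  obtain c where c: "c \<in> charts_at A p" using charts_at_ex by blast
  have "Xc c (snd c p) 0 = 0"
    using linear_0[OF lin_familyD(1)[OF Xc_family[OF charts_atD(1)[OF c]]]] charts_atD(2)[OF c] by simp
  then show ?thesis
    using charts_atD[OF c] by (intro tangent_space_eqI[OF X_in subspace_0[OF tangent_space_subspace] c])
      (simp add: Xc_def chart_inv_left)
qed

lemma \<Lambda>_metric: "inner_family UNIV \<Lambda>"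
proof
  show "\<Lambda> t a b = \<Lambda> t b a" for t a b unfolding \<Lambda>_def by (rule h_sym[OF X_in X_in])
  show "0 < \<Lambda> t a a" if "a \<noteq> 0" for t a
    unfolding \<Lambda>_def by (rule h_pos[OF X_in]) (use X_eq_0 that in blast)
qed (simp_all add: \<Lambda>_family)

sublocale L: inner_family UNIV \<Lambda> by (rule \<Lambda>_metric)

lemma \<kappa>_linear: "linear (\<lambda>a. \<kappa> t a b)" and \<kappa>_antisym: "\<kappa> t a b = - \<kappa> t b a"
proof -
  obtain c where c: "c \<in> A" "t \<in> cI c" using chart_at_time by blast
  interpret killing_chart "img c" "metric_coeff A h c" "Xc c" by (rule killing_chart_axioms[OF c(1)])
  note xt = xc_in[OF c]
  show "\<kappa> t a b = - \<kappa> t b a" by (simp add: \<kappa>_chart[OF c] twist_def)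
  show "linear (\<lambda>a. \<kappa> t a b)"
    unfolding \<kappa>_chart[OF c] twist_def
    by (rule linearI)
      (simp_all add: linear_add[OF G_lin(1)[OF xt]] linear_add[OF X_lin[OF xt]] linear_add[OF DX_lin(1)[OF xt]]
        linear_add[OF DX_lin(2)[OF xt]] linear_scale[OF G_lin(1)[OF xt]] linear_scale[OF X_lin[OF xt]]
        linear_scale[OF DX_lin(1)[OF xt]] linear_scale[OF DX_lin(2)[OF xt]] right_diff_distrib)
qed

lemma h_velocity_bracket:
  "h e (velocity A \<gamma> 0) (lie_bracket A mul e (coord_vec A c0 e a) (coord_vec A c0 e b)) = - \<kappa> 0 a b"
proof -
  have v: "velocity A \<gamma> 0 \<in> tangent_space A e" using velocity_in[of 0] by (simp add: start)
  note B = X_bracket_in[of a b e]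
  have "h e (velocity A \<gamma> 0) ((- 1) *\<^sub>R field_bracket A (X a) (X b) e)
      = h e ((- 1) *\<^sub>R field_bracket A (X a) (X b) e) (velocity A \<gamma> 0)"
    by (rule h_sym[OF v subspace_scale[OF tangent_space_subspace B]])
  also have "\<dots> = - 1 * h e (field_bracket A (X a) (X b) e) (velocity A \<gamma> 0)" by (rule h_scale[OF B v])
  also have "h e (field_bracket A (X a) (X b) e) (velocity A \<gamma> 0) = \<kappa> 0 a b"
    unfolding \<kappa>_def start by (rule h_sym[OF B v])
  finally show ?thesis unfolding lie_bracket_eq by (simp only: mult_minus1)
qed

text \<open>Every Lie algebra element is the \<open>coord_vec\<close> of its component in
  \<open>c0\<close>, so both sides test the same brackets; the span adds only linear
  combinations.\<close>

lemma orthogonal_iff: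
  "orthogonal_to h e (velocity A \<gamma> 0) (derived_algebra A mul e) \<longleftrightarrow> (\<forall>a b. \<kappa> 0 a b = 0)"
proof -
  let ?u = "velocity A \<gamma> 0"
  let ?B = "{lie_bracket A mul e p q | p q. p \<in> tangent_space A e \<and> q \<in> tangent_space A e}"
  have u: "?u \<in> tangent_space A e" using velocity_in[of 0] by (simp add: start)
  show ?thesis
  proof
    assume orth: "orthogonal_to h e ?u (derived_algebra A mul e)"
    show "\<forall>a b. \<kappa> 0 a b = 0"
    proof (intro allI)
      fix a b
      have "lie_bracket A mul e (coord_vec A c0 e a) (coord_vec A c0 e b) \<in> derived_algebra A mul e"
        unfolding derived_algebra_def using coord_vec_in[OF c0] by (intro span_base) blast
      then show "\<kappa> 0 a b = 0" using orth h_velocity_bracket[of a b] by (simp add: orthogonal_to_def)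
    qed
  next
    assume \<kappa>0: "\<forall>a b. \<kappa> 0 a b = 0"
    \<comment> \<open>Membership in the tangent space is carried through the induction because
      \<open>h\<close> is additive and homogeneous only there.\<close>
    have T: "w \<in> tangent_space A e \<and> h e w ?u = 0" if "w \<in> span ?B" for w
      using that
    proof (induction rule: span_induct_alt)
      case base
      have "0 \<in> tangent_space A e" by (rule subspace_0[OF tangent_space_subspace])
      moreover from h_scale[OF this u, of 0] have "h e 0 ?u = 0" by simp
      ultimately show ?case by blast
    next
      case (step r x y)
      then obtain p q where pq: "x = lie_bracket A mul e p q" "p \<in> tangent_space A e" "q \<in> tangent_space A e" by blast
      have x: "x \<in> tangent_space A e" unfolding pq(1) by (rule lie_bracket_in[OF pq(2,3)])
      have "x = lie_bracket A mul e (coord_vec A c0 e (p c0)) (coord_vec A c0 e (q c0))"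
        by (simp add: pq coord_vec_component c0)
      then have "h e x ?u = 0" using h_velocity_bracket[of "p c0" "q c0"] \<kappa>0 h_sym[OF x u] by simp
      moreover have rx: "r *\<^sub>R x \<in> tangent_space A e" by (rule subspace_scale[OF tangent_space_subspace x])
      moreover have y: "y \<in> tangent_space A e" "h e y ?u = 0" using step.IH by blast+
      ultimately have "h e (r *\<^sub>R x + y) ?u = 0"
        using h_add[OF rx y(1) u] h_scale[OF x u, of r] by simp
      then show ?case using subspace_add[OF tangent_space_subspace rx y(1)] by (intro conjI)
    qed
    have "h e ?u w = 0" if w: "w \<in> span ?B" for w
      using h_sym[OF u T[OF w, THEN conjunct1]] T[OF w, THEN conjunct2] by (rule trans)
    then show "orthogonal_to h e ?u (derived_algebra A mul e)"
      unfolding orthogonal_to_def derived_algebra_def by (rule ballI)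
  qed
qed

section \<open>Absence and existence of conjugate points\<close>

lemma no_conjugate_point:
  assumes \<kappa>0: "\<And>a b. \<kappa> 0 a b = 0"
  shows "\<not> has_conjugate_point A h \<gamma>"
proof
  assume "has_conjugate_point A h \<gamma>"
  then obtain \<tau> J where \<tau>: "0 < \<tau>" and J: "jacobi_field A h \<gamma> J" "\<exists>t. J t \<noteq> 0" "J 0 = 0" "J \<tau> = 0"
    unfolding has_conjugate_point_def by blast
  have Js: "smooth_field_along A \<gamma> J" using J(1) by (simp add: jacobi_field_def)
  have Jin: "J t \<in> tangent_space A (\<gamma> t)" for t using Js by (simp add: smooth_field_along_def)
  have "\<exists>a. J t = X a (\<gamma> t)" for t
  proof -
    obtain c where c: "c \<in> A" "t \<in> cI c" using chart_at_time by blast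
    have ct: "c \<in> charts_at A (\<gamma> t)" by (rule in_cI[OF c])
    have "surj (Xc c (xc c t))"
      by (rule linear_inj_imp_surj[OF lin_familyD(1)[OF Xc_family[OF c(1)] xc_in[OF c]]])
        (use X_inj[OF ct] in \<open>simp add: X_xc[OF c]\<close>)
    then obtain a where "J t c = Xc c (xc c t) a" by (rule surjE)
    then have "J t = X a (\<gamma> t)" by (intro tangent_space_eqI[OF Jin X_in ct]) (simp add: X_xc[OF c])
    then show ?thesis by blast
  qed
  then have "\<exists>w. \<forall>t. J t = X (w t) (\<gamma> t)" by (rule choice[OF allI])
  then obtain w where w: "\<And>t. J t = X (w t) (\<gamma> t)" by blast
  \<comment> \<open>In each chart the frame coefficients solve a linear system with smooth data, so
    \<open>w\<close> inherits the smoothness of \<open>J\<close>.\<close>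
  have ws: "smooth_on UNIV w"
  proof (rule smooth_on_local)
    fix t
    obtain c where c: "c \<in> A" "t \<in> cI c" using chart_at_time by blast
    note I = cI_open[OF c(1)]
    have fam: "lin_family (cI c) (\<lambda>s. Xc c (xc c s))"
      unfolding lin_family_def
    proof (intro conjI ballI allI)
      show "linear (Xc c (xc c s))" if "s \<in> cI c" for s
        by (rule lin_familyD(1)[OF Xc_family[OF c(1)] xc_in[OF c(1) that]])
      show "smooth_on (cI c) (\<lambda>s. Xc c (xc c s) a)" for a
        by (rule smooth_on_compose[OF I img_open[OF c(1)] xc_in[OF c(1)] lin_familyD(2)[OF Xc_family[OF c(1)]]
              xc_smooth[OF c(1)]])
    qed
    have inj: "inj (Xc c (xc c s))" if s: "s \<in> cI c" for s
      using X_inj[OF in_cI[OF c(1) s]] by (simp add: X_xc[OF c(1) s])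
    have sm: "smooth_on (cI c) (\<lambda>s. J s c)" using Js c(1) by (simp add: smooth_field_along_def)
    have "smooth_on (cI c) w"
      by (rule linear_solution_smooth[OF fam I inj sm]) (simp_all add: w X_xc[OF c(1)])
    then show "\<exists>T. open T \<and> t \<in> T \<and> smooth_on (T \<inter> UNIV) w" using I c(2) by auto
  qed
  define w1 where "w1 = (\<lambda>t. vector_derivative w (at t))"
  have w1s: "smooth_on UNIV w1" unfolding w1_def by (rule smooth_on_vector_derivative[OF ws open_UNIV])
  have wd: "(w has_vector_derivative w1 t) (at t)" for t
    unfolding w1_def by (rule smooth_on_has_vector_derivative[OF ws UNIV_I])
  have w1d: "(w1 has_vector_derivative vector_derivative w1 (at t)) (at t)" for t
    by (rule smooth_on_has_vector_derivative[OF w1s UNIV_I])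
  have "((\<lambda>s. \<Lambda> s (w1 s) b) has_real_derivative 0) (at t)" for t b
  proof -
    have "((\<lambda>s. \<Lambda> s (w1 s) b) has_real_derivative - \<kappa> t (w1 t) b) (at t)"
      using jacobi_field_iff[OF Js w wd w1d] J(1) by blast
    then show ?thesis using \<kappa>_constant[of t "w1 t" b] \<kappa>0 by simp
  qed
  then have const: "\<Lambda> t (w1 t) b = \<Lambda> 0 (w1 0) b" for t b
    using DERIV_isconst_all[of "\<lambda>s. \<Lambda> s (w1 s) b" t 0] by blast
  define m where "m = L.flat 0 (w1 0)"
  have m: "\<Lambda> t (w1 t) b = m \<bullet> b" for t b
    unfolding m_def by (simp add: L.flat_inner const[of t])
  have w0: "w 0 = 0" "w \<tau> = 0" using J(3,4) w X_eq_0 by metis+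
  have md: "((\<lambda>t. m \<bullet> w t) has_real_derivative m \<bullet> w1 t) (at t)" for t
    using bounded_linear.has_vector_derivative[OF bounded_linear_inner_right wd, of m t]
    by (simp add: has_real_derivative_iff_has_vector_derivative)
  \<comment> \<open>\<open>m \<bullet> w\<close> vanishes at 0 and at \<tau>, so its derivative
    vanishes somewhere in between; there it equals \<open>\<Lambda> s (w1 s) (w1 s)\<close>.\<close>
  obtain s where "m \<bullet> w \<tau> - m \<bullet> w 0 = (\<tau> - 0) * (m \<bullet> w1 s)"
    using MVT2[OF \<tau>, of "\<lambda>t. m \<bullet> w t" "\<lambda>t. m \<bullet> w1 t"] md by blast
  then have "\<Lambda> s (w1 s) (w1 s) = 0" using w0 \<tau> by (simp add: m)
  then have "w1 s = 0" using L.G_pos[of s "w1 s"] by force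
  \<comment> \<open>A zero of \<open>w1\<close> at one time makes the conserved momentum
    \<open>m\<close> zero, hence \<open>w1\<close> at all times.\<close>
  then have "\<Lambda> t (w1 t) b = 0" for t b
    using m[of t b] m[of s b] linear_0[OF L.G_lin(2)[of s b]] by simp
  then have "w1 t = 0" for t using L.G_pos[of t "w1 t"] by force
  then have "(w has_derivative (\<lambda>_. 0)) (at t)" for t using wd[of t] by (simp add: has_vector_derivative_def)
  then have "w t = w 0" for t
    using has_derivative_zero_unique[of UNIV w t 0] by simp
  then have "J t = 0" for t using w[of t] w0 X_0 by simp
  then show False using J(2) by blast
qed

text \<open>A vector \<open>a\<close> annihilated by \<open>W \<tau>\<close> is the momentum of the
  Jacobi field sought: \<open>X (W t a)\<close> along the geodesic vanishes at 0 and at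
  \<tau>.\<close>

lemma conjugate_point_exists:
  assumes \<kappa>0: "\<kappa> 0 a\<^sub>0 b\<^sub>0 \<noteq> 0" and Ad: "Ad_bounded_below_along A mul e iv h \<gamma>"
  shows "has_conjugate_point A h \<gamma>"
proof -
  let ?P = L.flat
  have P: "?P t a \<bullet> b = \<Lambda> t a b" for t a b by (rule L.flat_inner) simp
  have Pl: "linear (?P t)" and Pinj: "inj (?P t)" for t
    using lin_familyD(1)[OF L.flat_family] L.flat_inj by auto
  define M where "M t = inv (?P t)" for t
  have PM: "?P t (M t a) = a" for t a
    unfolding M_def by (rule surj_f_inv_f[OF linear_inj_imp_surj[OF Pl Pinj]])
  have Ms: "smooth_on UNIV (\<lambda>t. M t a)" for a
    by (rule linear_solution_smooth[OF L.flat_family open_UNIV L.flat_inj smooth_on_const]) (simp_all add: PM)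
  have Madd: "M t (a + b) = M t a + M t b" for t a b
    by (rule injD[OF Pinj[of t]]) (simp add: PM linear_add[OF Pl])
  have Mscale: "M t (r *\<^sub>R a) = r *\<^sub>R M t a" for t a r
    by (rule injD[OF Pinj[of t]]) (simp add: PM linear_scale[OF Pl])
  have Ml: "linear (M t)" for t by (rule linearI) (simp_all add: Madd Mscale)
  define K where "K a = (\<Sum>i\<in>Basis. \<kappa> 0 a i *\<^sub>R i)" for a
  have \<kappa>lin2: "linear (\<kappa> 0 a)" for a
  proof -
    have "\<kappa> 0 a = (\<lambda>b. - \<kappa> 0 b a)" by (rule ext) (rule \<kappa>_antisym)
    then show ?thesis using linear_compose_neg[OF \<kappa>_linear[of 0 a]] by simp
  qed
  have K: "K a \<bullet> b = \<kappa> 0 a b" for a b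
    unfolding K_def inner_sum_left using linear_eq_sum_Basis[OF \<kappa>lin2[of a], of b]
    by (simp add: inner_commute mult.commute)
  have Kl: "linear K"
    unfolding K_def using linear_add[OF \<kappa>_linear[of 0]] linear_scale[OF \<kappa>_linear[of 0]]
    by (intro linearI) (simp_all add: scaleR_add_left sum.distrib scaleR_sum_right)
  have Kanti: "K a \<bullet> b = - (a \<bullet> K b)" for a b
    using \<kappa>_antisym[of 0 a b] K[of a b] K[of b a] by (simp add: inner_commute)
  have K0: "K a\<^sub>0 \<noteq> 0" using K[of a\<^sub>0 b\<^sub>0] \<kappa>0 by auto

  obtain c where c: "0 < c" and
    cAd: "\<And>t. \<forall>w\<in>tangent_space A e. c * metric_norm h e w \<le> metric_norm h e (Ad A mul e iv (\<gamma> t) w)"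
    using Ad unfolding Ad_bounded_below_along_def by blast
  obtain B0 where B0: "0 < B0" "\<And>a. norm (?P 0 a) \<le> norm a * B0"
    using bounded_linear.pos_bounded[OF linear_conv_bounded_linear[THEN iffD1, OF Pl[of 0]]] by blast
  \<comment> \<open>\<open>c\<close> compares the frame at time \<open>t\<close> with the frame at
    time 0, and \<open>B0\<close> compares the metric at \<open>e\<close> with the Euclidean inner
    product.\<close>
  define C where "C = B0 / c\<^sup>2"
  have C: "0 < C" using B0 c by (simp add: C_def)
  have up: "\<Lambda> t a a \<le> C * (a \<bullet> a)" for t a
  proof -
    have "\<Lambda> t a a \<le> \<Lambda> 0 a a / c\<^sup>2"
      using X_bound[OF c cAd, of t a] by (simp add: \<Lambda>_def start X_e)
    also have "\<Lambda> 0 a a \<le> norm (?P 0 a) * norm a" using P[of 0 a a] norm_cauchy_schwarz[of "?P 0 a" a] by simp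
    also have "\<dots> \<le> norm a * B0 * norm a" by (rule mult_right_mono[OF B0(2)]) simp
    also have "\<dots> = B0 * (a \<bullet> a)" by (simp add: dot_square_norm power2_eq_square)
    finally show ?thesis using c by (simp add: C_def divide_right_mono)
  qed
  have Msym: "M t a \<bullet> b = a \<bullet> M t b" for t a b
  proof -
    have "M t a \<bullet> b = \<Lambda> t (M t b) (M t a)" using P[of t "M t b" "M t a"] by (simp add: PM inner_commute)
    also have "\<dots> = \<Lambda> t (M t a) (M t b)" by (rule L.G_sym) simp
    also have "\<dots> = a \<bullet> M t b" using P[of t "M t a" "M t b"] by (simp add: PM)
    finally show ?thesis .
  qed
  \<comment> \<open>An upper bound \<open>C\<close> for \<Lambda> becomes the lower bound
    \<open>1 / C\<close> for its inverse: the square of \<open>M t a - (1 / C) *\<^sub>R a\<close>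
    in the inner product \<open>\<Lambda> t\<close> is nonnegative.\<close>
  have Mpos: "1 / C * (a \<bullet> a) \<le> M t a \<bullet> a" for t a
  proof -
    let ?x = "M t a" and ?s = "1 / C"
    let ?z = "?x - ?s *\<^sub>R a"
    note l1 = L.G_lin(1)[of t, OF UNIV_I] and l2 = L.G_lin(2)[of t, OF UNIV_I]
    have "0 \<le> \<Lambda> t ?z ?z"
      using L.G_pos[of t ?z] linear_0[OF l1] by (cases "?z = 0") force+
    also have "\<Lambda> t ?z ?z = \<Lambda> t ?x ?x - ?s * \<Lambda> t ?x a - ?s * \<Lambda> t a ?x + ?s * (?s * \<Lambda> t a a)"
      by (simp only: linear_diff[OF l1] linear_diff[OF l2] linear_scale[OF l1] linear_scale[OF l2] real_scaleR_def)
        (simp add: algebra_simps)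
    also have "\<Lambda> t a ?x = \<Lambda> t ?x a" by (rule L.G_sym) simp
    also have "\<Lambda> t ?x a = a \<bullet> a" using P[of t ?x a] by (simp add: PM)
    also have "\<Lambda> t ?x ?x = ?x \<bullet> a" using P[of t ?x ?x] by (simp add: PM inner_commute)
    finally have "0 \<le> ?x \<bullet> a - ?s * (a \<bullet> a) - ?s * (a \<bullet> a) + ?s * (?s * \<Lambda> t a a)" .
    moreover have "?s * (?s * \<Lambda> t a a) \<le> ?s * (a \<bullet> a)"
      using up[of t a] C by (intro mult_left_mono) (simp_all add: field_simps)
    ultimately show ?thesis by linarith
  qed

  have fam: "lin_family UNIV (\<lambda>t a. M t (- K a))"
    unfolding lin_family_def
    using linear_compose[OF linear_compose_neg[OF Kl] Ml] Ms by (simp add: comp_def)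
  \<comment> \<open>One solution for each basis vector \<open>i\<close> as momentum: these are the
    columns of \<open>W\<close>, and a general \<open>a\<close> is reached by linearity.\<close>
  have "\<exists>y. y 0 = 0 \<and> (\<forall>t. (y has_vector_derivative M t (- K (y t)) + M t i) (at t))" for i
    by (rule linear_ode_exists[OF fam smooth_on_continuous[OF Ms]])
  then have "\<forall>i. \<exists>y. y 0 = 0 \<and> (\<forall>t. (y has_vector_derivative M t (- K (y t)) + M t i) (at t))" by blast
  from choice[OF this] obtain y where y: "\<And>i. y i 0 = 0"
    "\<And>i t. (y i has_vector_derivative M t (- K (y i t)) + M t i) (at t)" by blast
  have ys: "smooth_on UNIV (y i)" for i by (rule linear_ode_smooth[OF fam Ms y(2)])
  define W where "W t a = (\<Sum>i\<in>Basis. (a \<bullet> i) *\<^sub>R y i t)" for t a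
  have W0: "W 0 a = 0" for a by (simp add: W_def y(1))
  have Wfam: "lin_family UNIV W"
    unfolding lin_family_def
  proof (intro conjI ballI allI)
    show "linear (W t)" for t
      unfolding W_def by (rule linearI) (simp_all add: inner_add_left scaleR_add_left sum.distrib scaleR_sum_right)
    show "smooth_on UNIV (\<lambda>t. W t a)" for a
      unfolding W_def by (intro smooth_on_sum smooth_on_cmult ys open_UNIV)
  qed
  have Wd: "((\<lambda>t. W t a) has_vector_derivative M t (a - K (W t a))) (at t)" for t a
  proof -
    have "((\<lambda>t. W t a) has_vector_derivative (\<Sum>i\<in>Basis. (a \<bullet> i) *\<^sub>R (M t (- K (y i t)) + M t i))) (at t)"
      unfolding W_def
      by (intro has_vector_derivative_sum bounded_linear.has_vector_derivative[OF bounded_linear_scaleR_right] y(2))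
    moreover have "(\<Sum>i\<in>Basis. (a \<bullet> i) *\<^sub>R (M t (- K (y i t)) + M t i)) = M t (a - K (W t a))"
    proof -
      have "M t (a - K (W t a)) = M t ((\<Sum>i\<in>Basis. (a \<bullet> i) *\<^sub>R i) - K (\<Sum>i\<in>Basis. (a \<bullet> i) *\<^sub>R y i t))"
        by (simp only: W_def euclidean_representation)
      also have "\<dots> = (\<Sum>i\<in>Basis. (a \<bullet> i) *\<^sub>R M t i) - (\<Sum>i\<in>Basis. (a \<bullet> i) *\<^sub>R M t (K (y i t)))"
        by (simp only: linear_sum[OF Kl] linear_scale[OF Kl] linear_diff[OF Ml] linear_sum[OF Ml] linear_scale[OF Ml])
      finally show ?thesis
        by (simp add: linear_neg[OF Ml] sum_subtractf scaleR_diff_right)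
    qed
    ultimately show ?thesis by simp
  qed
  have C': "0 < 1 / C" using C by simp
  from rotating_system_degenerates[OF Msym C' Mpos Kl Kanti K0 Wfam W0 Wd]
  obtain \<tau> a where \<tau>: "0 < \<tau>" and a: "a \<noteq> 0" "W \<tau> a = 0" by blast

  define w where "w = (\<lambda>t. W t a)"
  define w1 where "w1 t = M t (a - K (w t))" for t
  have ws: "smooth_on UNIV w" unfolding w_def by (rule lin_familyD(2)[OF Wfam])
  have wd: "(w has_vector_derivative w1 t) (at t)" for t unfolding w1_def w_def by (rule Wd)
  have "w1 = (\<lambda>t. vector_derivative w (at t))" using vector_derivative_at[OF wd] by force
  then have w1s: "smooth_on UNIV w1" using smooth_on_vector_derivative[OF ws open_UNIV] by simp
  have w1d: "(w1 has_vector_derivative vector_derivative w1 (at t)) (at t)" for t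
    by (rule smooth_on_has_vector_derivative[OF w1s UNIV_I])
  define J where "J t = X (w t) (\<gamma> t)" for t
  have Js: "smooth_field_along A \<gamma> J"
    unfolding smooth_field_along_def
  proof (intro conjI allI ballI)
    show "J t \<in> tangent_space A (\<gamma> t)" for t unfolding J_def by (rule X_in)
    fix c assume c: "c \<in> A"
    have "smooth_on (cI c) (\<lambda>t. Xc c (xc c t) (w t))"
      by (rule smooth_on_lin_family[OF Xc_family[OF c] img_open[OF c] cI_open[OF c] xc_smooth[OF c] xc_in[OF c]
            smooth_on_subset[OF ws subset_UNIV]])
    then show "smooth_on (cI c) (\<lambda>t. J t c)"
      by (rule smooth_on_cong[OF cI_open[OF c], rotated]) (simp add: J_def X_xc[OF c])
  qed
  have "((\<lambda>s. \<Lambda> s (w1 s) b) has_real_derivative - \<kappa> t (w1 t) b) (at t)" for t b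
  proof -
    \<comment> \<open>The integrated Jacobi equation, whose constant is the momentum
      \<open>a\<close>.\<close>
    have 1: "\<Lambda> s (w1 s) b = (a - K (w s)) \<bullet> b" for s using P[of s "w1 s" b] by (simp add: w1_def PM)
    have "((\<lambda>s. (a - K (w s)) \<bullet> b) has_vector_derivative (0 - K (w1 t)) \<bullet> b) (at t)"
      by (intro bounded_linear.has_vector_derivative[OF bounded_linear_inner_left] has_vector_derivative_diff
          has_vector_derivative_const bounded_linear.has_vector_derivative[OF linear_conv_bounded_linear[THEN iffD1, OF Kl] wd])
    then show ?thesis by (simp add: 1 has_real_derivative_iff_has_vector_derivative K \<kappa>_constant[of t])
  qed
  then have jac: "jacobi_field A h \<gamma> J" using jacobi_field_iff[OF Js J_def wd w1d] by blast
  \<comment> \<open>If \<open>J\<close> vanished, so would the initial velocity \<open>M 0 a\<close>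
    of \<open>w\<close>, although \<open>M 0\<close> is invertible and \<open>a\<close> is
    nonzero.\<close>
  have "\<exists>t. J t \<noteq> 0"
  proof (rule ccontr)
    assume "\<not> ?thesis"
    then have w0: "w t = 0" for t using X_eq_0[of "w t" "\<gamma> t"] by (simp add: J_def)
    then have "w = (\<lambda>_. 0)" by (rule ext)
    then have "(w has_vector_derivative 0) (at 0)" by (simp only: has_vector_derivative_const)
    from vector_derivative_unique_at[OF this wd[of 0]] have "M 0 a = 0"
      by (simp add: w0 w1_def linear_0[OF Kl])
    then have "a = 0" using PM[of 0 a] linear_0[OF Pl[of 0]] by simp
    then show False using a(1) by simp
  qed
  moreover have "J 0 = 0" "J \<tau> = 0" by (simp_all add: J_def w_def W0 a(2) X_0)
  ultimately show ?thesis unfolding has_conjugate_point_def using jac \<tau> by blast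
qed

end

theorem theorem3p2:
  fixes A :: "('g::{t2_space, second_countable_topology}, 'e::euclidean_space) chart set"
    and mul :: "'g \<Rightarrow> 'g \<Rightarrow> 'g" and e :: 'g and iv :: "'g \<Rightarrow> 'g"
    and h :: "('g, 'e) metric"
    and u0 :: "('g, 'e) tvec" and \<gamma> :: "real \<Rightarrow> 'g"
  assumes "lie_group A mul e iv"
    and "left_invariant_metric A mul h"
    and "u0 \<in> tangent_space A e"
    and "geodesic A h \<gamma>" and "\<gamma> 0 = e" and "velocity A \<gamma> 0 = u0"
  shows "(\<not> orthogonal_to h e u0 (derived_algebra A mul e) \<and>
            Ad_bounded_below_along A mul e iv h \<gamma> \<longrightarrow> has_conjugate_point A h \<gamma>) \<and>
         (orthogonal_to h e u0 (derived_algebra A mul e) \<longrightarrow> \<not> has_conjugate_point A h \<gamma>)"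
proof -
  have "charts_at A e \<noteq> {}" using assms(1) by (simp add: lie_group_def smooth_atlas_def)
  then obtain c0 where c0: "c0 \<in> charts_at A e" by blast
  interpret lie_group_geodesic A mul e iv h c0 \<gamma>
    by unfold_locales (use assms c0 in auto)
  show ?thesis
    using orthogonal_iff no_conjugate_point conjugate_point_exists unfolding assms(6) by blast
qed

end
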